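(* Let $A=\mathbb{C}_\theta[\mathbb{T}^2]$ be the noncommutative torus and $B=\mathbb{C}[S^1]=\mathbb{C}[t,t^{-1}]$ with its classical calculus. Let $E=A\oplus A$ be the $B$-$A$ bimodule with $t\triangleright(f\oplus h)=uf\oplus vh$ and $(f\oplus h)\triangleleft k=fk\oplus hk$, equipped with the zero-curvature extendable right bimodule connection $(\nabla_E,\sigma_E)$ given for $f,h\in A$ by $$\nabla_E(f\oplus0)=(1\oplus0)\otimes\mathrm{d}f,\quad\nabla_E(0\oplus h)=(0\oplus1)\otimes\mathrm{d}h,$$ $$\sigma_E(\mathrm{d}t\otimes(f\oplus0))=(1\oplus0)\otimes\mathrm{d}u.f,\quad\sigma_E(\mathrm{d}t\otimes(0\oplus h))=(0\oplus1)\otimes\mathrm{d}v.h.$$ Then the map $$g:\Omega^p_B\otimes_BM_{0,q}\to M_{p,q},\qquad g(\xi\otimes[e\otimes\eta])=[(\sigma_E\wedge\mathrm{id})(\xi\otimes e\otimes\eta)]$$ is an isomorphism (for all $p,q\ge0$), where $$M_{p,q}=\frac{\sigma_E(\Omega^p_B\otimes_BE)\wedge\Omega^q_A}{\sigma_E(\Omega^{p+1}_B\otimes_BE)\wedge\Omega^{q-1}_A}.$$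
   Context: The noncommutative torus $\mathbb{C}_\theta[\mathbb{T}^2]$ ($\theta$ a real parameter) is the algebra with invertible generators $u,v$ and relation $vu=e^{i\theta}uv$. Its calculus has $\Omega^1_A$ the free left module on $\mathrm{d}u,\mathrm{d}v$ with $\mathrm{d}u.u=u.\mathrm{d}u$, $\mathrm{d}v.v=v.\mathrm{d}v$, $\mathrm{d}v.u=e^{i\theta}u.\mathrm{d}v$, $\mathrm{d}u.v=e^{-i\theta}v.\mathrm{d}u$; the higher calculus is the maximal prolongation: $\mathrm{d}u\wedge\mathrm{d}u=0=\mathrm{d}v\wedge\mathrm{d}v$, $\mathrm{d}v\wedge\mathrm{d}u=-e^{i\theta}\mathrm{d}u\wedge\mathrm{d}v$, so $\Omega^2_A=\mathrm{d}u\wedge\mathrm{d}v.A$ and $\Omega^q_A=0$ for $q\ge3$. The classical calculus on $B=\mathbb{C}[t,t^{-1}]$: $\Omega^1_B$ is free on $\mathrm{d}t$ with $t.\mathrm{d}t=\mathrm{d}t.t$, and $\Omega^p_B=0$ for $p\ge2$. Here $(\sigma_E\wedge\mathrm{id})(\xi\otimes e\otimes\eta)=\sigma_E(\xi\otimes e)\wedge\eta\in E\otimes_A\Omega^{p+q}_A$ for $\xi\in\Omega^p_B$, $\eta\in\Omega^q_A$, with $\sigma_E(b\otimes e)=be\otimes1$ for $p=0$ and $\sigma_E=0$ for $p\ge2$; $\sigma_E$ on $\Omega^1_B\otimes_BE$ is a $B$-$A$ bimodule map. The denominator of $M_{p,q}$ is $0$ when $q=0$. In particular $M_{0,q}=(E\otimes_A\Omega^q_A)/(\sigma_E(\Omega^1_B\otimes_BE)\wedge\Omega^{q-1}_A)$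 is a left $B$-module via $b[e\otimes\eta]=[be\otimes\eta]$. *)

theory Defs
  imports "HOL-Algebra.Algebra" "HOL-Library.Product_Plus" Complex_Main
begin

section \<open>Bimodules and tensor products over noncommutative rings\<close>

text \<open>
  As for \<^const>\<open>free_Abelian_group\<close>, the underlying abelian group of a bimodule is written
  multiplicatively: \<open>\<otimes>\<close> is addition, \<open>\<one>\<close> is zero and \<open>inv\<close> is the negative.
\<close>

record ('l, 'm, 'r) bimod = "'m monoid" +
  lact :: "'l \<Rightarrow> 'm \<Rightarrow> 'm"
  ract :: "'m \<Rightarrow> 'r \<Rightarrow> 'm"

locale bimodule =
  fixes L :: "('l, 'x) ring_scheme" and R :: "('r, 'y) ring_scheme"
    and M :: "('l, 'm, 'r, 'z) bimod_scheme"
  assumes ring_L: "ring L" and ring_R: "ring R" and comm_group_M: "comm_group M"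
    and lact_closed: "\<And>l x. \<lbrakk>l \<in> carrier L; x \<in> carrier M\<rbrakk> \<Longrightarrow> lact M l x \<in> carrier M"
    and ract_closed: "\<And>x r. \<lbrakk>x \<in> carrier M; r \<in> carrier R\<rbrakk> \<Longrightarrow> ract M x r \<in> carrier M"
    and lact_add: "\<And>l x y. \<lbrakk>l \<in> carrier L; x \<in> carrier M; y \<in> carrier M\<rbrakk> \<Longrightarrow>
      lact M l (x \<otimes>\<^bsub>M\<^esub> y) = lact M l x \<otimes>\<^bsub>M\<^esub> lact M l y"
    and ract_add: "\<And>x y r. \<lbrakk>x \<in> carrier M; y \<in> carrier M; r \<in> carrier R\<rbrakk> \<Longrightarrow>
      ract M (x \<otimes>\<^bsub>M\<^esub> y) r = ract M x r \<otimes>\<^bsub>M\<^esub> ract M y r"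
    and add_lact: "\<And>k l x. \<lbrakk>k \<in> carrier L; l \<in> carrier L; x \<in> carrier M\<rbrakk> \<Longrightarrow>
      lact M (k \<oplus>\<^bsub>L\<^esub> l) x = lact M k x \<otimes>\<^bsub>M\<^esub> lact M l x"
    and add_ract: "\<And>x r s. \<lbrakk>x \<in> carrier M; r \<in> carrier R; s \<in> carrier R\<rbrakk> \<Longrightarrow>
      ract M x (r \<oplus>\<^bsub>R\<^esub> s) = ract M x r \<otimes>\<^bsub>M\<^esub> ract M x s"
    and mult_lact: "\<And>k l x. \<lbrakk>k \<in> carrier L; l \<in> carrier L; x \<in> carrier M\<rbrakk> \<Longrightarrow>
      lact M (k \<otimes>\<^bsub>L\<^esub> l) x = lact M k (lact M l x)"
    and mult_ract: "\<And>x r s. \<lbrakk>x \<in> carrier M; r \<in> carrier R; s \<in> carrier R\<rbrakk> \<Longrightarrow>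
      ract M x (r \<otimes>\<^bsub>R\<^esub> s) = ract M (ract M x r) s"
    and one_lact: "\<And>x. x \<in> carrier M \<Longrightarrow> lact M \<one>\<^bsub>L\<^esub> x = x"
    and one_ract: "\<And>x. x \<in> carrier M \<Longrightarrow> ract M x \<one>\<^bsub>R\<^esub> = x"
    and lact_ract: "\<And>l x r. \<lbrakk>l \<in> carrier L; x \<in> carrier M; r \<in> carrier R\<rbrakk> \<Longrightarrow>
      ract M (lact M l x) r = lact M l (ract M x r)"

definition bimod_hom ::
  "('l, 'x) ring_scheme \<Rightarrow> ('r, 'y) ring_scheme \<Rightarrow> ('l, 'm, 'r, 'z) bimod_scheme \<Rightarrow>
   ('l, 'n, 'r, 'w) bimod_scheme \<Rightarrow> ('m \<Rightarrow> 'n) set" where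
  "bimod_hom L R M N = {h \<in> hom M N.
     (\<forall>l\<in>carrier L. \<forall>x\<in>carrier M. h (lact M l x) = lact N l (h x)) \<and>
     (\<forall>x\<in>carrier M. \<forall>r\<in>carrier R. h (ract M x r) = ract N (h x) r)}"

definition bimod_iso ::
  "('l, 'x) ring_scheme \<Rightarrow> ('r, 'y) ring_scheme \<Rightarrow> ('l, 'm, 'r, 'z) bimod_scheme \<Rightarrow>
   ('l, 'n, 'r, 'w) bimod_scheme \<Rightarrow> ('m \<Rightarrow> 'n) set" where
  "bimod_iso L R M N = {h \<in> bimod_hom L R M N. bij_betw h (carrier M) (carrier N)}"

text \<open>
  \<open>M \<otimes>\<^sub>S N\<close> is the free abelian group on \<open>carrier M \<times> carrier N\<close> modulo biadditivity and
  \<open>S\<close>-balancedness.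
\<close>

definition tensor_relators ::
  "('l, 'm, 's, 'z) bimod_scheme \<Rightarrow> ('s, 'x) ring_scheme \<Rightarrow> ('s, 'n, 'r, 'w) bimod_scheme \<Rightarrow>
   ('m \<times> 'n \<Rightarrow>\<^sub>0 int) set" where
  "tensor_relators M S N =
     {frag_of (x \<otimes>\<^bsub>M\<^esub> x', y) - frag_of (x, y) - frag_of (x', y) | x x' y.
        x \<in> carrier M \<and> x' \<in> carrier M \<and> y \<in> carrier N} \<union>
     {frag_of (x, y \<otimes>\<^bsub>N\<^esub> y') - frag_of (x, y) - frag_of (x, y') | x y y'.
        x \<in> carrier M \<and> y \<in> carrier N \<and> y' \<in> carrier N} \<union>
     {frag_of (ract M x s, y) - frag_of (x, lact N s y) | x s y.
        x \<in> carrier M \<and> s \<in> carrier S \<and> y \<in> carrier N}"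

definition tensor_kernel ::
  "('l, 'm, 's, 'z) bimod_scheme \<Rightarrow> ('s, 'x) ring_scheme \<Rightarrow> ('s, 'n, 'r, 'w) bimod_scheme \<Rightarrow>
   ('m \<times> 'n \<Rightarrow>\<^sub>0 int) set" where
  "tensor_kernel M S N =
     generate (free_Abelian_group (carrier M \<times> carrier N)) (tensor_relators M S N)"

definition tensor_group ::
  "('l, 'm, 's, 'z) bimod_scheme \<Rightarrow> ('s, 'x) ring_scheme \<Rightarrow> ('s, 'n, 'r, 'w) bimod_scheme \<Rightarrow>
   ('m \<times> 'n \<Rightarrow>\<^sub>0 int) set monoid" where
  "tensor_group M S N =
     free_Abelian_group (carrier M \<times> carrier N) Mod tensor_kernel M S N"

definition pure_tensor ::
  "('l, 'm, 's, 'z) bimod_scheme \<Rightarrow> ('s, 'x) ring_scheme \<Rightarrow> ('s, 'n, 'r, 'w) bimod_scheme \<Rightarrow>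
   'm \<Rightarrow> 'n \<Rightarrow> ('m \<times> 'n \<Rightarrow>\<^sub>0 int) set" where
  "pure_tensor M S N x y =
     tensor_kernel M S N #>\<^bsub>free_Abelian_group (carrier M \<times> carrier N)\<^esub> frag_of (x, y)"

text \<open>
  The additive map on a tensor product that sends \<open>x \<otimes> y\<close> to \<open>f x y\<close>, computed on
  representatives of the coset; it is meaningful only for biadditive balanced \<open>f\<close>.
\<close>

definition tensor_lift ::
  "('p, 'z) monoid_scheme \<Rightarrow> ('m \<Rightarrow> 'n \<Rightarrow> 'p) \<Rightarrow> ('m \<times> 'n \<Rightarrow>\<^sub>0 int) set \<Rightarrow> 'p" where
  "tensor_lift P f T =
     the_elem ((\<lambda>c. finprod P (\<lambda>(x, y). f x y [^]\<^bsub>P\<^esub> Poly_Mapping.lookup c (x, y))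
                  (Poly_Mapping.keys c)) ` T)"

definition tensor ::
  "('l, 'm, 's, 'z) bimod_scheme \<Rightarrow> ('s, 'x) ring_scheme \<Rightarrow> ('s, 'n, 'r, 'w) bimod_scheme \<Rightarrow>
   ('l, ('m \<times> 'n \<Rightarrow>\<^sub>0 int) set, 'r) bimod" where
  "tensor M S N = monoid.extend (tensor_group M S N)
     \<lparr>lact = (\<lambda>l. tensor_lift (tensor_group M S N) (\<lambda>x y. pure_tensor M S N (lact M l x) y)),
      ract = (\<lambda>t r. tensor_lift (tensor_group M S N) (\<lambda>x y. pure_tensor M S N x (ract N y r)) t)\<rparr>"

text \<open>The subquotient \<open>H/D\<close> of \<open>M\<close>, for sub-bimodules \<open>D \<subseteq> H\<close>.\<close>

definition subquotient ::
  "('l, 'm, 'r, 'z) bimod_scheme \<Rightarrow> 'm set \<Rightarrow> 'm set \<Rightarrow> ('l, 'm set, 'r) bimod" where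
  "subquotient M H D = monoid.extend (M\<lparr>carrier := H\<rparr> Mod D)
     \<lparr>lact = (\<lambda>l T. \<Union>x\<in>T. D #>\<^bsub>M\<^esub> lact M l x),
      ract = (\<lambda>T r. \<Union>x\<in>T. D #>\<^bsub>M\<^esub> ract M x r)\<rparr>"


section \<open>Differential calculi and right bimodule connections\<close>

text \<open>
  A calculus on an algebra \<open>A\<close>: the ring of forms under \<open>\<wedge>\<close>, its graded pieces \<open>\<Omega>\<^sup>n\<close>, the
  identification of \<open>A\<close> with \<open>\<Omega>\<^sup>0\<close>, and \<open>d\<close>.
\<close>

record ('a, 'w) calculus = "'w ring" +
  grade :: "nat \<Rightarrow> 'w set"
  emb :: "'a \<Rightarrow> 'w"
  dif :: "'w \<Rightarrow> 'w"

definition Forms :: "('a, 'w, 'z) calculus_scheme \<Rightarrow> nat \<Rightarrow> ('a, 'w, 'a) bimod" where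
  "Forms \<Omega> n = \<lparr>carrier = grade \<Omega> n, monoid.mult = add \<Omega>, one = \<zero>\<^bsub>\<Omega>\<^esub>,
     lact = (\<lambda>a w. emb \<Omega> a \<otimes>\<^bsub>\<Omega>\<^esub> w), ract = (\<lambda>w a. w \<otimes>\<^bsub>\<Omega>\<^esub> emb \<Omega> a)\<rparr>"

text \<open>\<open>E \<otimes>\<^sub>A \<Omega>\<^sup>n\<^sub>A\<close> and \<open>\<Omega>\<^sup>n\<^sub>B \<otimes>\<^sub>B E\<close>\<close>

abbreviation EForms where
  "EForms A OA E n \<equiv> tensor E A (Forms OA n)"

abbreviation FormsE where
  "FormsE B OB E n \<equiv> tensor (Forms OB n) B E"

text \<open>\<open>(e \<otimes> \<omega>) \<wedge> \<eta> = e \<otimes> (\<omega> \<wedge> \<eta>)\<close>, of total degree \<open>n\<close>\<close>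

definition wedge ::
  "('a, 'x) ring_scheme \<Rightarrow> ('a, 'w, 'z) calculus_scheme \<Rightarrow> ('b, 'e, 'a, 'y) bimod_scheme \<Rightarrow> nat \<Rightarrow>
   ('e \<times> 'w \<Rightarrow>\<^sub>0 int) set \<Rightarrow> 'w \<Rightarrow> ('e \<times> 'w \<Rightarrow>\<^sub>0 int) set" where
  "wedge A OA E n t \<eta> =
     tensor_lift (EForms A OA E n) (\<lambda>e \<omega>. pure_tensor E A (Forms OA n) e (\<omega> \<otimes>\<^bsub>OA\<^esub> \<eta>)) t"

text \<open>
  Complex linearity of \<open>\<nabla>\<close> needs no separate clause: it is the Leibniz rule for scalars, on
  which \<open>d\<close> vanishes.
\<close>

definition right_connection ::
  "('a, 'x) ring_scheme \<Rightarrow> ('a, 'w, 'z) calculus_scheme \<Rightarrow> ('b, 'e, 'a, 'y) bimod_scheme \<Rightarrow>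
   ('e \<Rightarrow> ('e \<times> 'w \<Rightarrow>\<^sub>0 int) set) \<Rightarrow> bool" where
  "right_connection A OA E nabla \<longleftrightarrow>
     nabla \<in> hom E (EForms A OA E 1) \<and>
     (\<forall>e\<in>carrier E. \<forall>a\<in>carrier A.
        nabla (ract E e a) = ract (EForms A OA E 1) (nabla e) a
          \<otimes>\<^bsub>EForms A OA E 1\<^esub> pure_tensor E A (Forms OA 1) e (dif OA (emb OA a)))"

definition right_bimodule_connection ::
  "('b, 'v) ring_scheme \<Rightarrow> ('b, 'wb, 'u) calculus_scheme \<Rightarrow>
   ('a, 'x) ring_scheme \<Rightarrow> ('a, 'w, 'z) calculus_scheme \<Rightarrow> ('b, 'e, 'a, 'y) bimod_scheme \<Rightarrow>
   ('e \<Rightarrow> ('e \<times> 'w \<Rightarrow>\<^sub>0 int) set) \<Rightarrow>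
   (('wb \<times> 'e \<Rightarrow>\<^sub>0 int) set \<Rightarrow> ('e \<times> 'w \<Rightarrow>\<^sub>0 int) set) \<Rightarrow> bool" where
  "right_bimodule_connection B OB A OA E nabla \<sigma> \<longleftrightarrow>
     bimodule B A E \<and> right_connection A OA E nabla \<and>
     \<sigma> \<in> bimod_hom B A (FormsE B OB E 1) (EForms A OA E 1) \<and>
     (\<forall>b\<in>carrier B. \<forall>e\<in>carrier E.
        \<sigma> (pure_tensor (Forms OB 1) B E (dif OB (emb OB b)) e) =
          nabla (lact E b e) \<otimes>\<^bsub>EForms A OA E 1\<^esub>
            inv\<^bsub>EForms A OA E 1\<^esub> lact (EForms A OA E 1) b (nabla e))"

text \<open>
  The curvature of a right connection is \<open>\<nabla>\<^sup>[\<^sup>1\<^sup>] \<circ> \<nabla>\<close> with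
  \<open>\<nabla>\<^sup>[\<^sup>1\<^sup>](e \<otimes> \<omega>) = \<nabla> e \<wedge> \<omega> + e \<otimes> d\<omega>\<close>.
\<close>

definition curvature ::
  "('a, 'x) ring_scheme \<Rightarrow> ('a, 'w, 'z) calculus_scheme \<Rightarrow> ('b, 'e, 'a, 'y) bimod_scheme \<Rightarrow>
   ('e \<Rightarrow> ('e \<times> 'w \<Rightarrow>\<^sub>0 int) set) \<Rightarrow> 'e \<Rightarrow> ('e \<times> 'w \<Rightarrow>\<^sub>0 int) set" where
  "curvature A OA E nabla e =
     tensor_lift (EForms A OA E 2)
       (\<lambda>e' \<omega>. wedge A OA E 2 (nabla e') \<omega> \<otimes>\<^bsub>EForms A OA E 2\<^esub>
                pure_tensor E A (Forms OA 2) e' (dif OA \<omega>)) (nabla e)"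

definition zero_curvature ::
  "('a, 'x) ring_scheme \<Rightarrow> ('a, 'w, 'z) calculus_scheme \<Rightarrow> ('b, 'e, 'a, 'y) bimod_scheme \<Rightarrow>
   ('e \<Rightarrow> ('e \<times> 'w \<Rightarrow>\<^sub>0 int) set) \<Rightarrow> bool" where
  "zero_curvature A OA E nabla \<longleftrightarrow> (\<forall>e\<in>carrier E. curvature A OA E nabla e = \<one>\<^bsub>EForms A OA E 2\<^esub>)"

text \<open>The canonical map \<open>\<Omega>\<^sup>0\<^sub>B \<otimes>\<^sub>B E \<rightarrow> E \<otimes>\<^sub>A \<Omega>\<^sup>0\<^sub>A\<close>, \<open>b \<otimes> e \<mapsto> be \<otimes> 1\<close>\<close>

definition sigma_zero ::
  "('b, 'v) ring_scheme \<Rightarrow> ('b, 'wb, 'u) calculus_scheme \<Rightarrow>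
   ('a, 'x) ring_scheme \<Rightarrow> ('a, 'w, 'z) calculus_scheme \<Rightarrow> ('b, 'e, 'a, 'y) bimod_scheme \<Rightarrow>
   ('wb \<times> 'e \<Rightarrow>\<^sub>0 int) set \<Rightarrow> ('e \<times> 'w \<Rightarrow>\<^sub>0 int) set" where
  "sigma_zero B OB A OA E =
     tensor_lift (EForms A OA E 0)
       (\<lambda>\<beta> e. pure_tensor E A (Forms OA 0) (lact E (inv_into (carrier B) (emb OB) \<beta>) e) \<one>\<^bsub>OA\<^esub>)"

text \<open>
  \<open>\<sigma>\<close> is extendable if it is the degree one part of a family
  \<open>s n : \<Omega>\<^sup>n\<^sub>B \<otimes>\<^sub>B E \<rightarrow> E \<otimes>\<^sub>A \<Omega>\<^sup>n\<^sub>A\<close> with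
  \<open>s (\<xi> \<wedge> \<zeta> \<otimes> e) = (s \<wedge> id) (\<xi> \<otimes> s (\<zeta> \<otimes> e))\<close>.
\<close>

definition extendable ::
  "('b, 'v) ring_scheme \<Rightarrow> ('b, 'wb, 'u) calculus_scheme \<Rightarrow>
   ('a, 'x) ring_scheme \<Rightarrow> ('a, 'w, 'z) calculus_scheme \<Rightarrow> ('b, 'e, 'a, 'y) bimod_scheme \<Rightarrow>
   (('wb \<times> 'e \<Rightarrow>\<^sub>0 int) set \<Rightarrow> ('e \<times> 'w \<Rightarrow>\<^sub>0 int) set) \<Rightarrow> bool" where
  "extendable B OB A OA E \<sigma> \<longleftrightarrow>
     (\<exists>s. (\<forall>n. s n \<in> bimod_hom B A (FormsE B OB E n) (EForms A OA E n)) \<and>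
          (\<forall>t\<in>carrier (FormsE B OB E 0). s 0 t = sigma_zero B OB A OA E t) \<and>
          (\<forall>t\<in>carrier (FormsE B OB E 1). s 1 t = \<sigma> t) \<and>
          (\<forall>n m. \<forall>\<xi>\<in>grade OB n. \<forall>\<zeta>\<in>grade OB m. \<forall>e\<in>carrier E.
             s (n + m) (pure_tensor (Forms OB (n + m)) B E (\<xi> \<otimes>\<^bsub>OB\<^esub> \<zeta>) e) =
               tensor_lift (EForms A OA E (n + m))
                 (\<lambda>e' \<omega>. wedge A OA E (n + m) (s n (pure_tensor (Forms OB n) B E \<xi> e')) \<omega>)
                 (s m (pure_tensor (Forms OB m) B E \<zeta> e))))"


section \<open>The bimodules \<open>M\<^bsub>p,q\<^esub>\<close>\<close>

text \<open>\<open>\<sigma>\<^sub>E\<close> in all degrees, for a calculus with \<open>\<Omega>\<^sup>p\<^sub>B = 0\<close> for \<open>p \<ge> 2\<close>\<close>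

definition sigma_ext ::
  "('b, 'v) ring_scheme \<Rightarrow> ('b, 'wb, 'u) calculus_scheme \<Rightarrow>
   ('a, 'x) ring_scheme \<Rightarrow> ('a, 'w, 'z) calculus_scheme \<Rightarrow> ('b, 'e, 'a, 'y) bimod_scheme \<Rightarrow>
   (('wb \<times> 'e \<Rightarrow>\<^sub>0 int) set \<Rightarrow> ('e \<times> 'w \<Rightarrow>\<^sub>0 int) set) \<Rightarrow> nat \<Rightarrow>
   ('wb \<times> 'e \<Rightarrow>\<^sub>0 int) set \<Rightarrow> ('e \<times> 'w \<Rightarrow>\<^sub>0 int) set" where
  "sigma_ext B OB A OA E \<sigma> p =
     (if p = 0 then sigma_zero B OB A OA E
      else if p = 1 then \<sigma>
      else (\<lambda>t. \<one>\<^bsub>EForms A OA E p\<^esub>))"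

text \<open>\<open>(\<sigma>\<^sub>E \<wedge> id)(\<xi> \<otimes> e \<otimes> \<eta>)\<close> for \<open>\<xi>\<close>, \<open>\<eta>\<close> of degrees \<open>p\<close>, \<open>q\<close>\<close>

definition sigma_wedge ::
  "('b, 'v) ring_scheme \<Rightarrow> ('b, 'wb, 'u) calculus_scheme \<Rightarrow>
   ('a, 'x) ring_scheme \<Rightarrow> ('a, 'w, 'z) calculus_scheme \<Rightarrow> ('b, 'e, 'a, 'y) bimod_scheme \<Rightarrow>
   (('wb \<times> 'e \<Rightarrow>\<^sub>0 int) set \<Rightarrow> ('e \<times> 'w \<Rightarrow>\<^sub>0 int) set) \<Rightarrow> nat \<Rightarrow> nat \<Rightarrow>
   'wb \<Rightarrow> 'e \<Rightarrow> 'w \<Rightarrow> ('e \<times> 'w \<Rightarrow>\<^sub>0 int) set" where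
  "sigma_wedge B OB A OA E \<sigma> p q \<xi> e \<eta> =
     wedge A OA E (p + q) (sigma_ext B OB A OA E \<sigma> p (pure_tensor (Forms OB p) B E \<xi> e)) \<eta>"

text \<open>The additive span \<open>\<sigma>\<^sub>E(\<Omega>\<^sup>p\<^sub>B \<otimes>\<^sub>B E) \<wedge> \<Omega>\<^sup>q\<^sub>A\<close> in \<open>E \<otimes>\<^sub>A \<Omega>\<^sup>p\<^sup>+\<^sup>q\<^sub>A\<close>\<close>

definition M_num ::
  "('b, 'v) ring_scheme \<Rightarrow> ('b, 'wb, 'u) calculus_scheme \<Rightarrow>
   ('a, 'x) ring_scheme \<Rightarrow> ('a, 'w, 'z) calculus_scheme \<Rightarrow> ('b, 'e, 'a, 'y) bimod_scheme \<Rightarrow>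
   (('wb \<times> 'e \<Rightarrow>\<^sub>0 int) set \<Rightarrow> ('e \<times> 'w \<Rightarrow>\<^sub>0 int) set) \<Rightarrow> nat \<Rightarrow> nat \<Rightarrow>
   ('e \<times> 'w \<Rightarrow>\<^sub>0 int) set set" where
  "M_num B OB A OA E \<sigma> p q =
     generate (EForms A OA E (p + q))
       {wedge A OA E (p + q) (sigma_ext B OB A OA E \<sigma> p t) \<eta> | t \<eta>.
          t \<in> carrier (FormsE B OB E p) \<and> \<eta> \<in> grade OA q}"

definition M_den ::
  "('b, 'v) ring_scheme \<Rightarrow> ('b, 'wb, 'u) calculus_scheme \<Rightarrow>
   ('a, 'x) ring_scheme \<Rightarrow> ('a, 'w, 'z) calculus_scheme \<Rightarrow> ('b, 'e, 'a, 'y) bimod_scheme \<Rightarrow>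
   (('wb \<times> 'e \<Rightarrow>\<^sub>0 int) set \<Rightarrow> ('e \<times> 'w \<Rightarrow>\<^sub>0 int) set) \<Rightarrow> nat \<Rightarrow> nat \<Rightarrow>
   ('e \<times> 'w \<Rightarrow>\<^sub>0 int) set set" where
  "M_den B OB A OA E \<sigma> p q =
     (if q = 0 then {\<one>\<^bsub>EForms A OA E (p + q)\<^esub>} else M_num B OB A OA E \<sigma> (p + 1) (q - 1))"

definition M_bimod ::
  "('b, 'v) ring_scheme \<Rightarrow> ('b, 'wb, 'u) calculus_scheme \<Rightarrow>
   ('a, 'x) ring_scheme \<Rightarrow> ('a, 'w, 'z) calculus_scheme \<Rightarrow> ('b, 'e, 'a, 'y) bimod_scheme \<Rightarrow>
   (('wb \<times> 'e \<Rightarrow>\<^sub>0 int) set \<Rightarrow> ('e \<times> 'w \<Rightarrow>\<^sub>0 int) set) \<Rightarrow> nat \<Rightarrow> nat \<Rightarrow>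
   ('b, ('e \<times> 'w \<Rightarrow>\<^sub>0 int) set set, 'a) bimod" where
  "M_bimod B OB A OA E \<sigma> p q =
     subquotient (EForms A OA E (p + q)) (M_num B OB A OA E \<sigma> p q) (M_den B OB A OA E \<sigma> p q)"

text \<open>The class \<open>[x] \<in> M\<^bsub>p,q\<^esub>\<close>\<close>

definition M_class ::
  "('b, 'v) ring_scheme \<Rightarrow> ('b, 'wb, 'u) calculus_scheme \<Rightarrow>
   ('a, 'x) ring_scheme \<Rightarrow> ('a, 'w, 'z) calculus_scheme \<Rightarrow> ('b, 'e, 'a, 'y) bimod_scheme \<Rightarrow>
   (('wb \<times> 'e \<Rightarrow>\<^sub>0 int) set \<Rightarrow> ('e \<times> 'w \<Rightarrow>\<^sub>0 int) set) \<Rightarrow> nat \<Rightarrow> nat \<Rightarrow>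
   ('e \<times> 'w \<Rightarrow>\<^sub>0 int) set \<Rightarrow> ('e \<times> 'w \<Rightarrow>\<^sub>0 int) set set" where
  "M_class B OB A OA E \<sigma> p q x = M_den B OB A OA E \<sigma> p q #>\<^bsub>EForms A OA E (p + q)\<^esub> x"


section \<open>The noncommutative torus and its calculus\<close>

definition scale :: "complex \<Rightarrow> ('k \<Rightarrow>\<^sub>0 complex) \<Rightarrow> ('k \<Rightarrow>\<^sub>0 complex)" where
  "scale c f = Poly_Mapping.map ((*) c) f"

text \<open>\<open>lin F\<close> is the linear map with value \<open>F k\<close> on the basis vector \<open>k\<close>.\<close>

definition lin :: "('k \<Rightarrow> ('j \<Rightarrow>\<^sub>0 complex)) \<Rightarrow> ('k \<Rightarrow>\<^sub>0 complex) \<Rightarrow> ('j \<Rightarrow>\<^sub>0 complex)" where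
  "lin F f = (\<Sum>k\<in>Poly_Mapping.keys f. scale (Poly_Mapping.lookup f k) (F k))"

text \<open>
  The basis vector \<open>(m, n)\<close> stands for the monomial \<open>u\<^sup>m v\<^sup>n\<close>, so that
  \<open>u\<^sup>m v\<^sup>n u\<^sup>m\<^sup>' v\<^sup>n\<^sup>' = exp (\<i>\<theta>nm') u\<^sup>m\<^sup>+\<^sup>m\<^sup>' v\<^sup>n\<^sup>+\<^sup>n\<^sup>'\<close>.
\<close>

type_synonym torus = "int \<times> int \<Rightarrow>\<^sub>0 complex"

definition torus_monom :: "int \<Rightarrow> int \<Rightarrow> torus" where
  "torus_monom m n = Poly_Mapping.single (m, n) 1"

definition torus_mult :: "real \<Rightarrow> torus \<Rightarrow> torus \<Rightarrow> torus" where
  "torus_mult \<theta> f g =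
     lin (\<lambda>(m, n). lin (\<lambda>(m', n'). scale (cis (\<theta> * of_int (n * m'))) (torus_monom (m + m') (n + n'))) g) f"

definition nc_torus :: "real \<Rightarrow> torus ring" where
  "nc_torus \<theta> = \<lparr>carrier = UNIV, monoid.mult = torus_mult \<theta>, one = torus_monom 0 0,
     ring.zero = 0, add = (+)\<rparr>"

abbreviation torus_u :: torus where "torus_u \<equiv> torus_monom 1 0"
abbreviation torus_v :: torus where "torus_v \<equiv> torus_monom 0 1"

text \<open>
  \<open>du.f = twist_u f.du\<close> and \<open>dv.f = twist_v f.dv\<close>, from \<open>du.v = exp (-\<i>\<theta>) v.du\<close> and
  \<open>dv.u = exp (\<i>\<theta>) u.dv\<close>
\<close>

definition twist_u :: "real \<Rightarrow> torus \<Rightarrow> torus" where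
  "twist_u \<theta> = lin (\<lambda>(m, n). scale (cis (- \<theta> * of_int n)) (torus_monom m n))"

definition twist_v :: "real \<Rightarrow> torus \<Rightarrow> torus" where
  "twist_v \<theta> = lin (\<lambda>(m, n). scale (cis (\<theta> * of_int m)) (torus_monom m n))"

text \<open>
  \<open>df = diff_u f.du + diff_v f.dv\<close>; the phase arises from moving \<open>du\<close> past \<open>v\<^sup>n\<close> in
  \<open>d(u\<^sup>m v\<^sup>n) = m u\<^sup>m\<^sup>-\<^sup>1 du.v\<^sup>n + n u\<^sup>m v\<^sup>n\<^sup>-\<^sup>1 dv\<close>.
\<close>

definition diff_u :: "real \<Rightarrow> torus \<Rightarrow> torus" where
  "diff_u \<theta> = lin (\<lambda>(m, n). scale (of_int m * cis (- \<theta> * of_int n)) (torus_monom (m - 1) n))"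

definition diff_v :: "torus \<Rightarrow> torus" where
  "diff_v = lin (\<lambda>(m, n). scale (of_int n) (torus_monom m (n - 1)))"

text \<open>\<open>(a, b, c, f)\<close> is the form \<open>a + b.du + c.dv + f.du \<and> dv\<close>.\<close>

type_synonym torus_form = "torus \<times> torus \<times> torus \<times> torus"

fun torus_wedge :: "real \<Rightarrow> torus_form \<Rightarrow> torus_form \<Rightarrow> torus_form" where
  "torus_wedge \<theta> (a, b, c, f) (a', b', c', f') =
     (torus_mult \<theta> a a',
      torus_mult \<theta> a b' + torus_mult \<theta> b (twist_u \<theta> a'),
      torus_mult \<theta> a c' + torus_mult \<theta> c (twist_v \<theta> a'),
      torus_mult \<theta> a f' + torus_mult \<theta> b (twist_u \<theta> c')
        - scale (cis \<theta>) (torus_mult \<theta> c (twist_v \<theta> b'))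
        + torus_mult \<theta> f (twist_u \<theta> (twist_v \<theta> a')))"

fun torus_d :: "real \<Rightarrow> torus_form \<Rightarrow> torus_form" where
  "torus_d \<theta> (a, b, c, f) =
     (0, diff_u \<theta> a, diff_v a, diff_u \<theta> c - scale (cis \<theta>) (diff_v b))"

definition torus_grade :: "nat \<Rightarrow> torus_form set" where
  "torus_grade n =
     (if n = 0 then {(a, 0, 0, 0) | a. True}
      else if n = 1 then {(0, b, c, 0) | b c. True}
      else if n = 2 then {(0, 0, 0, f) | f. True}
      else {0})"

definition torus_calculus :: "real \<Rightarrow> (torus, torus_form) calculus" where
  "torus_calculus \<theta> =
     \<lparr>carrier = UNIV, monoid.mult = torus_wedge \<theta>, one = (torus_monom 0 0, 0, 0, 0),
      ring.zero = 0, add = (+), grade = torus_grade, emb = (\<lambda>a. (a, 0, 0, 0)), dif = torus_d \<theta>\<rparr>"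

abbreviation torus_du :: torus_form where "torus_du \<equiv> (0, torus_monom 0 0, 0, 0)"
abbreviation torus_dv :: torus_form where "torus_dv \<equiv> (0, 0, torus_monom 0 0, 0)"


section \<open>The circle and its classical calculus\<close>

text \<open>The basis vector \<open>k\<close> stands for \<open>t\<^sup>k\<close>, and \<open>(a, b)\<close> is the form \<open>a + b.dt\<close>.\<close>

type_synonym circle = "int \<Rightarrow>\<^sub>0 complex"

definition circle_algebra :: "circle ring" where
  "circle_algebra = \<lparr>carrier = UNIV, monoid.mult = (*), one = 1, ring.zero = 0, add = (+)\<rparr>"

abbreviation circle_t :: circle where "circle_t \<equiv> Poly_Mapping.single 1 1"

definition circle_diff :: "circle \<Rightarrow> circle" where
  "circle_diff = lin (\<lambda>k. Poly_Mapping.single (k - 1) (of_int k))"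

type_synonym circle_form = "circle \<times> circle"

definition circle_grade :: "nat \<Rightarrow> circle_form set" where
  "circle_grade n =
     (if n = 0 then {(a, 0) | a. True} else if n = 1 then {(0, b) | b. True} else {0})"

definition circle_calculus :: "(circle, circle_form) calculus" where
  "circle_calculus =
     \<lparr>carrier = UNIV, monoid.mult = (\<lambda>(a, b) (a', b'). (a * a', a * b' + b * a')), one = (1, 0),
      ring.zero = 0, add = (+), grade = circle_grade, emb = (\<lambda>a. (a, 0)),
      dif = (\<lambda>(a, b). (0, circle_diff a))\<rparr>"

abbreviation circle_dt :: circle_form where "circle_dt \<equiv> (0, 1)"


section \<open>The bimodule \<open>E = A \<oplus> A\<close>\<close>

text \<open>\<open>b \<in> \<complex>[t, t\<^sup>-\<^sup>1]\<close> evaluated at \<open>t = u\<close> and at \<open>t = v\<close>\<close>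

definition eval_u :: "circle \<Rightarrow> torus" where
  "eval_u = lin (\<lambda>k. torus_monom k 0)"

definition eval_v :: "circle \<Rightarrow> torus" where
  "eval_v = lin (\<lambda>k. torus_monom 0 k)"

definition torus_E :: "real \<Rightarrow> (circle, torus \<times> torus, torus) bimod" where
  "torus_E \<theta> = \<lparr>carrier = UNIV, monoid.mult = (+), one = 0,
     lact = (\<lambda>b (f, h). (torus_mult \<theta> (eval_u b) f, torus_mult \<theta> (eval_v b) h)),
     ract = (\<lambda>(f, h) k. (torus_mult \<theta> f k, torus_mult \<theta> h k))\<rparr>"


section \<open>Tensor products: universal property and bimodule structure\<close>

lemma (in comm_group) eq_mult_iff2:
  assumes "a \<in> carrier G" "b \<in> carrier G"
  shows "a \<otimes> inv b = \<one> \<longleftrightarrow> a = b"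
  using assms inv_equality[of a "inv b"] by auto

lemma (in comm_group) eq_mult_iff3:
  assumes "a \<in> carrier G" "b \<in> carrier G" "c \<in> carrier G"
  shows "a \<otimes> inv b \<otimes> inv c = \<one> \<longleftrightarrow> a = b \<otimes> c"
proof -
  have "a \<otimes> inv b \<otimes> inv c = a \<otimes> inv (b \<otimes> c)"
    unfolding inv_mult[OF assms(2,3)] by (rule m_assoc) (use assms in auto)
  then show ?thesis using eq_mult_iff2[of a "b \<otimes> c"] assms by simp
qed

locale tensor_context =
  M: bimodule L S M + N: bimodule S R N
  for L :: "('l, 'x) ring_scheme" and S :: "('s, 'y) ring_scheme" and R :: "('r, 'v) ring_scheme"
    and M :: "('l, 'm, 's, 'z) bimod_scheme" and N :: "('s, 'n, 'r, 'w) bimod_scheme"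
begin

abbreviation "F \<equiv> free_Abelian_group (carrier M \<times> carrier N)"
abbreviation "K \<equiv> tensor_kernel M S N"
abbreviation "TG \<equiv> tensor_group M S N"

lemma comm_group_F: "comm_group F"
  by (rule abelian_free_Abelian_group)

lemma M_mult_closed: "x \<in> carrier M \<Longrightarrow> y \<in> carrier M \<Longrightarrow> x \<otimes>\<^bsub>M\<^esub> y \<in> carrier M"
  using M.comm_group_M by (simp add: comm_group_def group_def monoid.m_closed)

lemma N_mult_closed: "x \<in> carrier N \<Longrightarrow> y \<in> carrier N \<Longrightarrow> x \<otimes>\<^bsub>N\<^esub> y \<in> carrier N"
  using N.comm_group_M by (simp add: comm_group_def group_def monoid.m_closed)

lemma keys_diff3: "Poly_Mapping.keys (a - b - c) \<subseteq> Poly_Mapping.keys a \<union> Poly_Mapping.keys b \<union> Poly_Mapping.keys (c :: 'q \<Rightarrow>\<^sub>0 int)"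
  using keys_diff[of "a - b" c] keys_diff[of a b] by blast

lemma relators_carrier: "tensor_relators M S N \<subseteq> carrier F"
proof
  fix c assume c: "c \<in> tensor_relators M S N"
  have k2: "Poly_Mapping.keys (frag_of z - frag_of z') \<subseteq> {z, z'}" for z z' :: "'m \<times> 'n"
    using keys_diff[of "frag_of z" "frag_of z'"] by auto
  have k3: "Poly_Mapping.keys (frag_of z - frag_of z' - frag_of z'') \<subseteq> {z, z', z''}" for z z' z'' :: "'m \<times> 'n"
    using keys_diff3[of "frag_of z" "frag_of z'" "frag_of z''"] by auto
  have *: "Poly_Mapping.keys c \<subseteq> carrier M \<times> carrier N"
  proof -
    consider (1) x x' y where "c = frag_of (x \<otimes>\<^bsub>M\<^esub> x', y) - frag_of (x, y) - frag_of (x', y)"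
        "x \<in> carrier M" "x' \<in> carrier M" "y \<in> carrier N"
      | (2) x y y' where "c = frag_of (x, y \<otimes>\<^bsub>N\<^esub> y') - frag_of (x, y) - frag_of (x, y')"
        "x \<in> carrier M" "y \<in> carrier N" "y' \<in> carrier N"
      | (3) x s y where "c = frag_of (ract M x s, y) - frag_of (x, lact N s y)"
        "x \<in> carrier M" "s \<in> carrier S" "y \<in> carrier N"
      using c unfolding tensor_relators_def by blast
    then show ?thesis
    proof cases
      case 1
      show ?thesis unfolding 1(1) by (rule order_trans[OF k3]) (use 1 M_mult_closed in simp)
    next
      case 2
      show ?thesis unfolding 2(1) by (rule order_trans[OF k3]) (use 2 N_mult_closed in simp)
    next
      case 3
      show ?thesis unfolding 3(1)
        by (rule order_trans[OF k2]) (use 3 M.ract_closed N.lact_closed in simp)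
    qed
  qed
  then show "c \<in> carrier F" by simp
qed

lemma K_subgroup: "subgroup K F"
  unfolding tensor_kernel_def
  by (rule group.generate_is_subgroup[OF group_free_Abelian_group relators_carrier])

lemma K_normal: "K \<lhd> F"
  using comm_group.subgroup_imp_normal[OF comm_group_F K_subgroup] .

lemma comm_group_TG: "comm_group TG"
  unfolding tensor_group_def by (rule comm_group.abelian_FactGroup[OF comm_group_F K_subgroup])

lemma coset_hom: "(\<lambda>c. K #>\<^bsub>F\<^esub> c) \<in> hom F TG"
  unfolding tensor_group_def by (rule normal.r_coset_hom_Mod[OF K_normal])

lemma pure_closed: "x \<in> carrier M \<Longrightarrow> y \<in> carrier N \<Longrightarrow> pure_tensor M S N x y \<in> carrier TG"
  unfolding pure_tensor_def by (rule hom_in_carrier[OF coset_hom]) simp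

lemma coset_relator: "c \<in> tensor_relators M S N \<Longrightarrow> K #>\<^bsub>F\<^esub> c = \<one>\<^bsub>TG\<^esub>"
  unfolding tensor_group_def one_FactGroup
  by (rule subgroup.rcos_const[OF K_subgroup group_free_Abelian_group])
     (simp add: tensor_kernel_def generate.incl)


lemma coset_add:
  assumes "c \<in> carrier F" "d \<in> carrier F"
  shows "K #>\<^bsub>F\<^esub> (c + d) = (K #>\<^bsub>F\<^esub> c) \<otimes>\<^bsub>TG\<^esub> (K #>\<^bsub>F\<^esub> d)"
  using hom_mult[OF coset_hom assms] by simp

lemma coset_diff:
  assumes "c \<in> carrier F" "d \<in> carrier F"
  shows "K #>\<^bsub>F\<^esub> (c - d) = (K #>\<^bsub>F\<^esub> c) \<otimes>\<^bsub>TG\<^esub> inv\<^bsub>TG\<^esub> (K #>\<^bsub>F\<^esub> d)"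
proof -
  have m: "- d \<in> carrier F" using assms by simp
  have "K #>\<^bsub>F\<^esub> (- d) = inv\<^bsub>TG\<^esub> (K #>\<^bsub>F\<^esub> d)"
    using group_hom.hom_inv[of F TG "\<lambda>c. K #>\<^bsub>F\<^esub> c" d] assms coset_hom comm_group_TG
    by (simp add: group_hom_def group_hom_axioms_def comm_group_def)
  then show ?thesis
    using coset_add[OF assms(1) m] by simp
qed

lemma frag_in: "x \<in> carrier M \<Longrightarrow> y \<in> carrier N \<Longrightarrow> frag_of (x, y) \<in> carrier F"
  by simp

lemma F_diff_closed: "a \<in> carrier F \<Longrightarrow> b \<in> carrier F \<Longrightarrow> a - b \<in> carrier F"
  using keys_diff by fastforce

lemma pure_add_left:
  assumes "x \<in> carrier M" "x' \<in> carrier M" "y \<in> carrier N"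
  shows "pure_tensor M S N (x \<otimes>\<^bsub>M\<^esub> x') y = pure_tensor M S N x y \<otimes>\<^bsub>TG\<^esub> pure_tensor M S N x' y"
proof -
  interpret TG: comm_group TG by (rule comm_group_TG)
  have "K #>\<^bsub>F\<^esub> (frag_of (x \<otimes>\<^bsub>M\<^esub> x', y) - frag_of (x, y) - frag_of (x', y)) = \<one>\<^bsub>TG\<^esub>"
    by (rule coset_relator) (use assms in \<open>auto simp: tensor_relators_def\<close>)
  then have "pure_tensor M S N (x \<otimes>\<^bsub>M\<^esub> x') y \<otimes>\<^bsub>TG\<^esub> inv\<^bsub>TG\<^esub> pure_tensor M S N x y
      \<otimes>\<^bsub>TG\<^esub> inv\<^bsub>TG\<^esub> pure_tensor M S N x' y = \<one>\<^bsub>TG\<^esub>"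
    using assms M_mult_closed unfolding pure_tensor_def
    by (simp add: coset_diff frag_in F_diff_closed del: carrier_free_Abelian_group_iff)
  then show ?thesis
    using assms M_mult_closed pure_closed
    by (simp add: TG.eq_mult_iff3)
qed

lemma pure_add_right:
  assumes "x \<in> carrier M" "y \<in> carrier N" "y' \<in> carrier N"
  shows "pure_tensor M S N x (y \<otimes>\<^bsub>N\<^esub> y') = pure_tensor M S N x y \<otimes>\<^bsub>TG\<^esub> pure_tensor M S N x y'"
proof -
  interpret TG: comm_group TG by (rule comm_group_TG)
  have "K #>\<^bsub>F\<^esub> (frag_of (x, y \<otimes>\<^bsub>N\<^esub> y') - frag_of (x, y) - frag_of (x, y')) = \<one>\<^bsub>TG\<^esub>"
    by (rule coset_relator) (use assms in \<open>auto simp: tensor_relators_def\<close>)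
  then have "pure_tensor M S N x (y \<otimes>\<^bsub>N\<^esub> y') \<otimes>\<^bsub>TG\<^esub> inv\<^bsub>TG\<^esub> pure_tensor M S N x y
      \<otimes>\<^bsub>TG\<^esub> inv\<^bsub>TG\<^esub> pure_tensor M S N x y' = \<one>\<^bsub>TG\<^esub>"
    using assms N_mult_closed unfolding pure_tensor_def
    by (simp add: coset_diff frag_in F_diff_closed del: carrier_free_Abelian_group_iff)
  then show ?thesis
    using assms N_mult_closed pure_closed
    by (simp add: TG.eq_mult_iff3)
qed

lemma pure_balanced:
  assumes "x \<in> carrier M" "s \<in> carrier S" "y \<in> carrier N"
  shows "pure_tensor M S N (ract M x s) y = pure_tensor M S N x (lact N s y)"
proof -
  interpret TG: comm_group TG by (rule comm_group_TG)
  have "K #>\<^bsub>F\<^esub> (frag_of (ract M x s, y) - frag_of (x, lact N s y)) = \<one>\<^bsub>TG\<^esub>"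
    by (rule coset_relator) (use assms in \<open>auto simp: tensor_relators_def\<close>)
  then have "pure_tensor M S N (ract M x s) y \<otimes>\<^bsub>TG\<^esub> inv\<^bsub>TG\<^esub> pure_tensor M S N x (lact N s y) = \<one>\<^bsub>TG\<^esub>"
    using assms M.ract_closed N.lact_closed unfolding pure_tensor_def
    by (simp add: coset_diff frag_in F_diff_closed del: carrier_free_Abelian_group_iff)
  then show ?thesis
    using assms M.ract_closed N.lact_closed pure_closed
    by (simp add: TG.eq_mult_iff2)
qed

lemma tensor_induct [consumes 1, case_names pure mult inv one]:
  assumes t: "t \<in> carrier TG"
    and pure: "\<And>x y. x \<in> carrier M \<Longrightarrow> y \<in> carrier N \<Longrightarrow> P (pure_tensor M S N x y)"
    and mult: "\<And>t t'. t \<in> carrier TG \<Longrightarrow> t' \<in> carrier TG \<Longrightarrow> P t \<Longrightarrow> P t' \<Longrightarrow> P (t \<otimes>\<^bsub>TG\<^esub> t')"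
    and inv: "\<And>t. t \<in> carrier TG \<Longrightarrow> P t \<Longrightarrow> P (inv\<^bsub>TG\<^esub> t)"
    and one: "P \<one>\<^bsub>TG\<^esub>"
  shows "P t"
proof -
  interpret TG: comm_group TG by (rule comm_group_TG)
  obtain c where c: "c \<in> carrier F" "t = K #>\<^bsub>F\<^esub> c"
    using t by (auto simp: tensor_group_def carrier_FactGroup)
  have "P (K #>\<^bsub>F\<^esub> c)" if "Poly_Mapping.keys c \<subseteq> carrier M \<times> carrier N" for c
    using that
  proof (induction c rule: free_Abelian_group_induct[consumes 1, case_names zero diff frag])
    case zero
    have "K #>\<^bsub>F\<^esub> 0 = \<one>\<^bsub>TG\<^esub>"
      using group_hom.hom_one[of F TG "\<lambda>c. K #>\<^bsub>F\<^esub> c"] coset_hom comm_group_TG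
      by (simp add: group_hom_def group_hom_axioms_def comm_group_def)
    then show ?case using one by simp
  next
    case (diff a b)
    then have ab: "a \<in> carrier F" "b \<in> carrier F" by auto
    then have "K #>\<^bsub>F\<^esub> a \<in> carrier TG" "K #>\<^bsub>F\<^esub> b \<in> carrier TG"
      using hom_in_carrier[OF coset_hom] by blast+
    then show ?case
      using diff by (simp add: coset_diff[OF ab] mult inv)
  next
    case (frag a)
    then show ?case using pure by (cases a) (auto simp: pure_tensor_def)
  qed
  then show ?thesis using c by simp
qed

lemma tensor_hom_ext:
  assumes "group P" "h \<in> hom TG P" "h' \<in> hom TG P"
    and "\<And>x y. x \<in> carrier M \<Longrightarrow> y \<in> carrier N \<Longrightarrow> h (pure_tensor M S N x y) = h' (pure_tensor M S N x y)"
    and "t \<in> carrier TG"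
  shows "h t = h' t"
proof -
  interpret h: group_hom TG P h
    using assms comm_group_TG by (simp add: group_hom_def group_hom_axioms_def comm_group_def)
  interpret h': group_hom TG P h'
    using assms comm_group_TG by (simp add: group_hom_def group_hom_axioms_def comm_group_def)
  show ?thesis
    using assms(5)
  proof (induction t rule: tensor_induct)
    case (pure x y)
    then show ?case using assms(4) by simp
  qed auto
qed

end

locale balanced = tensor_context L S R M N
  for L :: "('l, 'x) ring_scheme" and S :: "('s, 'y) ring_scheme" and R :: "('r, 'v) ring_scheme"
    and M :: "('l, 'm, 's, 'z) bimod_scheme" and N :: "('s, 'n, 'r, 'w) bimod_scheme" +
  fixes P :: "('p, 'u) monoid_scheme" and f :: "'m \<Rightarrow> 'n \<Rightarrow> 'p"
  assumes P: "comm_group P"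
    and f_closed: "\<And>x y. x \<in> carrier M \<Longrightarrow> y \<in> carrier N \<Longrightarrow> f x y \<in> carrier P"
    and f_add_left: "\<And>x x' y. x \<in> carrier M \<Longrightarrow> x' \<in> carrier M \<Longrightarrow> y \<in> carrier N \<Longrightarrow>
      f (x \<otimes>\<^bsub>M\<^esub> x') y = f x y \<otimes>\<^bsub>P\<^esub> f x' y"
    and f_add_right: "\<And>x y y'. x \<in> carrier M \<Longrightarrow> y \<in> carrier N \<Longrightarrow> y' \<in> carrier N \<Longrightarrow>
      f x (y \<otimes>\<^bsub>N\<^esub> y') = f x y \<otimes>\<^bsub>P\<^esub> f x y'"
    and f_balanced: "\<And>x s y. x \<in> carrier M \<Longrightarrow> s \<in> carrier S \<Longrightarrow> y \<in> carrier N \<Longrightarrow>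
      f (ract M x s) y = f x (lact N s y)"
begin

sublocale P: comm_group P by (rule P)

definition H :: "('m \<times> 'n \<Rightarrow>\<^sub>0 int) \<Rightarrow> 'p" where
  "H c = finprod P (\<lambda>(x, y). f x y [^]\<^bsub>P\<^esub> Poly_Mapping.lookup c (x, y)) (Poly_Mapping.keys c)"

lemma H_superset:
  assumes "finite A" "Poly_Mapping.keys c \<subseteq> A" "A \<subseteq> carrier M \<times> carrier N"
  shows "H c = finprod P (\<lambda>(x, y). f x y [^]\<^bsub>P\<^esub> Poly_Mapping.lookup c (x, y)) A"
  unfolding H_def
  by (rule P.finprod_mono_neutral_cong_left)
     (use assms in \<open>auto simp: in_keys_iff intro!: P.int_pow_closed f_closed\<close>)

lemma H_hom: "H \<in> hom F P"
proof (rule homI)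
  fix c assume "c \<in> carrier F"
  then show "H c \<in> carrier P"
    unfolding H_def by (intro P.finprod_closed) (auto intro!: P.int_pow_closed f_closed)
next
  fix c d assume cd: "c \<in> carrier F" "d \<in> carrier F"
  define A where "A = Poly_Mapping.keys c \<union> Poly_Mapping.keys d"
  have A: "finite A" "A \<subseteq> carrier M \<times> carrier N" "Poly_Mapping.keys c \<subseteq> A" "Poly_Mapping.keys d \<subseteq> A"
    "Poly_Mapping.keys (c + d) \<subseteq> A"
    using cd keys_add[of c d] by (auto simp: A_def)
  have "H (c + d) = finprod P (\<lambda>z. (\<lambda>(x, y). f x y [^]\<^bsub>P\<^esub> Poly_Mapping.lookup c (x, y)) z
      \<otimes>\<^bsub>P\<^esub> (\<lambda>(x, y). f x y [^]\<^bsub>P\<^esub> Poly_Mapping.lookup d (x, y)) z) A"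
    unfolding H_superset[OF A(1,5,2)]
    by (rule P.finprod_cong)
       (use A in \<open>auto simp: simp_implies_def lookup_add P.int_pow_mult f_closed subset_eq intro!: P.int_pow_closed P.m_closed f_closed\<close>)
  also have "\<dots> = H c \<otimes>\<^bsub>P\<^esub> H d"
    unfolding H_superset[OF A(1,3,2)] H_superset[OF A(1,4,2)]
    by (rule P.finprod_multf) (use A in \<open>auto intro!: P.int_pow_closed f_closed\<close>)
  finally show "H (c \<otimes>\<^bsub>F\<^esub> d) = H c \<otimes>\<^bsub>P\<^esub> H d" by simp
qed

sublocale H: group_hom F P H
  using H_hom by (simp add: group_hom_def group_hom_axioms_def P.is_group)

lemma H_frag: "x \<in> carrier M \<Longrightarrow> y \<in> carrier N \<Longrightarrow> H (frag_of (x, y)) = f x y"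
  unfolding H_def by (simp add: P.finprod_singleton f_closed)

lemma H_diff: "c \<in> carrier F \<Longrightarrow> d \<in> carrier F \<Longrightarrow> H (c - d) = H c \<otimes>\<^bsub>P\<^esub> inv\<^bsub>P\<^esub> H d"
  using H.hom_mult[of c "- d"] H.hom_inv[of d] by simp

lemma H_relators: "tensor_relators M S N \<subseteq> kernel F P H"
proof
  fix c assume c: "c \<in> tensor_relators M S N"
  then have cF: "c \<in> carrier F" using relators_carrier by blast
  have "H c = \<one>\<^bsub>P\<^esub>"
  proof -
    have 3: "H (frag_of z - frag_of z' - frag_of z'') = \<one>\<^bsub>P\<^esub> \<longleftrightarrow> H (frag_of z) = H (frag_of z') \<otimes>\<^bsub>P\<^esub> H (frag_of z'')"
      if "frag_of z \<in> carrier F" "frag_of z' \<in> carrier F" "frag_of z'' \<in> carrier F" for z z' z''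
      using P.eq_mult_iff3[of "H (frag_of z)" "H (frag_of z')" "H (frag_of z'')"] that
      by (simp add: H_diff F_diff_closed H.hom_closed del: carrier_free_Abelian_group_iff frag_of_in_free_Abelian_group)
    have 2: "H (frag_of z - frag_of z') = \<one>\<^bsub>P\<^esub> \<longleftrightarrow> H (frag_of z) = H (frag_of z')"
      if "frag_of z \<in> carrier F" "frag_of z' \<in> carrier F" for z z'
      using P.eq_mult_iff2[of "H (frag_of z)" "H (frag_of z')"] that
      by (simp add: H_diff F_diff_closed H.hom_closed del: carrier_free_Abelian_group_iff frag_of_in_free_Abelian_group)
    consider (1) x x' y where "c = frag_of (x \<otimes>\<^bsub>M\<^esub> x', y) - frag_of (x, y) - frag_of (x', y)"
        "x \<in> carrier M" "x' \<in> carrier M" "y \<in> carrier N"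
      | (2) x y y' where "c = frag_of (x, y \<otimes>\<^bsub>N\<^esub> y') - frag_of (x, y) - frag_of (x, y')"
        "x \<in> carrier M" "y \<in> carrier N" "y' \<in> carrier N"
      | (3) x s y where "c = frag_of (ract M x s, y) - frag_of (x, lact N s y)"
        "x \<in> carrier M" "s \<in> carrier S" "y \<in> carrier N"
      using c unfolding tensor_relators_def by blast
    then show ?thesis
    proof cases
      case 1
      note c = this
      show ?thesis unfolding c(1)
        by (rule 3[THEN iffD2]) (use c(2-) in \<open>simp_all add: H_frag M_mult_closed f_add_left\<close>)
    next
      case 2
      note c = this
      show ?thesis unfolding c(1)
        by (rule 3[THEN iffD2]) (use c(2-) in \<open>simp_all add: H_frag N_mult_closed f_add_right\<close>)
    next
      case 3
      note c = this
      show ?thesis unfolding c(1)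
        by (rule 2[THEN iffD2]) (use c(2-) in \<open>simp_all add: H_frag M.ract_closed N.lact_closed f_balanced\<close>)
    qed
  qed
  then show "c \<in> kernel F P H"
    using cF by (simp add: kernel_def)
qed

lemma H_K: "k \<in> K \<Longrightarrow> H k = \<one>\<^bsub>P\<^esub>"
  using group.generate_subgroup_incl[OF group_free_Abelian_group H_relators H.subgroup_kernel]
  by (auto simp: tensor_kernel_def kernel_def)

lemma lift_coset:
  assumes "c \<in> carrier F"
  shows "tensor_lift P f (K #>\<^bsub>F\<^esub> c) = H c"
proof -
  have "H d = H c" if d: "d \<in> K #>\<^bsub>F\<^esub> c" for d
  proof -
    obtain k where k: "k \<in> K" "d = k + c"
      using d unfolding r_coset_def mult_free_Abelian_group UN_iff singleton_iff by metis
    then have kF: "k \<in> carrier F" using subgroup.mem_carrier[OF K_subgroup] by blast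
    have "H d = H k \<otimes>\<^bsub>P\<^esub> H c" using H.hom_mult[OF kF assms] k(2) unfolding mult_free_Abelian_group by metis
    also have "\<dots> = H c" unfolding H_K[OF k(1)] by (rule P.l_one[OF H.hom_closed[OF assms]])
    finally show ?thesis .
  qed
  then have "H ` (K #>\<^bsub>F\<^esub> c) = (\<lambda>_. H c) ` (K #>\<^bsub>F\<^esub> c)"
    by (rule image_cong[OF refl])
  moreover have "c \<in> K #>\<^bsub>F\<^esub> c"
    using group.rcos_self[OF group_free_Abelian_group assms K_subgroup] .
  then have "K #>\<^bsub>F\<^esub> c \<noteq> {}" by (metis empty_iff)
  ultimately have "H ` (K #>\<^bsub>F\<^esub> c) = {H c}" by (simp only: image_constant_conv if_False)
  moreover have "tensor_lift P f (K #>\<^bsub>F\<^esub> c) = the_elem (H ` (K #>\<^bsub>F\<^esub> c))"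
    unfolding tensor_lift_def H_def[abs_def] ..
  ultimately show ?thesis by (simp only: the_elem_eq)
qed

lemma lift_hom: "tensor_lift P f \<in> hom TG P"
proof (rule homI)
  fix t assume "t \<in> carrier TG"
  then show "tensor_lift P f t \<in> carrier P"
    by (auto simp: tensor_group_def carrier_FactGroup lift_coset simp del: carrier_free_Abelian_group_iff)
next
  fix t t' assume "t \<in> carrier TG" "t' \<in> carrier TG"
  then obtain c d where cd: "c \<in> carrier F" "d \<in> carrier F" "t = K #>\<^bsub>F\<^esub> c" "t' = K #>\<^bsub>F\<^esub> d"
    by (auto simp: tensor_group_def carrier_FactGroup simp del: carrier_free_Abelian_group_iff)
  have "c + d \<in> carrier F" using cd H.G.m_closed[of c d] by simp
  then show "tensor_lift P f (t \<otimes>\<^bsub>TG\<^esub> t') = tensor_lift P f t \<otimes>\<^bsub>P\<^esub> tensor_lift P f t'"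
    using cd H.hom_mult[of c d] by (simp add: coset_add[symmetric] lift_coset del: carrier_free_Abelian_group_iff)
qed

lemma lift_pure: "x \<in> carrier M \<Longrightarrow> y \<in> carrier N \<Longrightarrow> tensor_lift P f (pure_tensor M S N x y) = f x y"
  by (simp add: pure_tensor_def lift_coset H_frag frag_in del: carrier_free_Abelian_group_iff)

sublocale lift: group_hom TG P "tensor_lift P f"
  using lift_hom comm_group_TG by (simp add: group_hom_def group_hom_axioms_def P.is_group comm_group_def)

end


lemma carrier_tensor [simp]: "carrier (tensor M S N) = carrier (tensor_group M S N)"
  and mult_tensor [simp]: "monoid.mult (tensor M S N) = monoid.mult (tensor_group M S N)"
  and one_tensor [simp]: "one (tensor M S N) = one (tensor_group M S N)"
  by (simp_all add: tensor_def monoid.defs)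

lemma lact_tensor: "lact (tensor M S N) l = tensor_lift (tensor_group M S N) (\<lambda>x y. pure_tensor M S N (lact M l x) y)"
  and ract_tensor: "ract (tensor M S N) t r = tensor_lift (tensor_group M S N) (\<lambda>x y. pure_tensor M S N x (ract N y r)) t"
  by (simp_all add: tensor_def monoid.defs)

lemma inv_tensor [simp]: "m_inv (tensor M S N) = m_inv (tensor_group M S N)"
  by (simp add: m_inv_def fun_eq_iff)

lemma comm_group_cong:
  assumes "comm_group G" "carrier G = carrier G'" "monoid.mult G = monoid.mult G'" "one G = one G'"
  shows "comm_group G'"
proof -
  interpret comm_group G by fact
  show ?thesis
    by (rule comm_groupI; unfold assms(2-)[symmetric]; (rule m_assoc m_comm l_inv_ex)?; simp)
qed

lemma hom_tensor_left [simp]: "hom (tensor M S N) P = hom (tensor_group M S N) P"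
  and hom_tensor_right [simp]: "hom Q (tensor M S N) = hom Q (tensor_group M S N)"
  by (simp_all add: hom_def)

lemma finprod_tensor [simp]: "finprod (tensor M S N) g A = finprod (tensor_group M S N) g A"
  by (simp add: finprod_def)

lemma int_pow_tensor [simp]: "x [^]\<^bsub>tensor M S N\<^esub> (n::int) = x [^]\<^bsub>tensor_group M S N\<^esub> n"
  by (cases "n < 0") (simp_all add: int_pow_def nat_pow_def)

lemma tensor_lift_tensor [simp]: "tensor_lift (tensor M S N) f = tensor_lift (tensor_group M S N) f"
  by (simp add: tensor_lift_def fun_eq_iff)

context tensor_context
begin

lemma lact_balanced: "l \<in> carrier L \<Longrightarrow> balanced L S R M N TG (\<lambda>x y. pure_tensor M S N (lact M l x) y)"
  unfolding balanced_def balanced_axioms_def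
  by (simp add: pure_closed pure_add_left pure_add_right M.lact_closed M.ract_closed N.lact_closed
    comm_group_TG tensor_context_axioms M.lact_add flip: pure_balanced M.lact_ract)

lemma ract_balanced: "r \<in> carrier R \<Longrightarrow> balanced L S R M N TG (\<lambda>x y. pure_tensor M S N x (ract N y r))"
  unfolding balanced_def balanced_axioms_def
  by (simp add: pure_closed pure_add_left pure_add_right pure_balanced N.ract_closed M.ract_closed
    N.lact_closed comm_group_TG tensor_context_axioms N.ract_add N.lact_ract)

lemma lact_hom: "l \<in> carrier L \<Longrightarrow> lact (tensor M S N) l \<in> hom TG TG"
  unfolding lact_tensor by (rule balanced.lift_hom[OF lact_balanced])

lemma ract_hom: "r \<in> carrier R \<Longrightarrow> (\<lambda>t. ract (tensor M S N) t r) \<in> hom TG TG"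
  unfolding ract_tensor by (rule balanced.lift_hom[OF ract_balanced])

lemma lact_pure: "l \<in> carrier L \<Longrightarrow> x \<in> carrier M \<Longrightarrow> y \<in> carrier N \<Longrightarrow>
    lact (tensor M S N) l (pure_tensor M S N x y) = pure_tensor M S N (lact M l x) y"
  unfolding lact_tensor by (rule balanced.lift_pure[OF lact_balanced])

lemma ract_pure: "r \<in> carrier R \<Longrightarrow> x \<in> carrier M \<Longrightarrow> y \<in> carrier N \<Longrightarrow>
    ract (tensor M S N) (pure_tensor M S N x y) r = pure_tensor M S N x (ract N y r)"
  unfolding ract_tensor by (rule balanced.lift_pure[OF ract_balanced])

lemma hom_mult_TG:
  assumes "f \<in> hom TG TG" "g \<in> hom TG TG"
  shows "(\<lambda>t. f t \<otimes>\<^bsub>TG\<^esub> g t) \<in> hom TG TG"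
proof -
  interpret TG: comm_group TG by (rule comm_group_TG)
  show ?thesis
    using assms hom_in_carrier[OF assms(1)] hom_in_carrier[OF assms(2)]
    by (intro homI) (auto simp: hom_mult TG.m_ac)
qed

lemma hom_comp_TG: "f \<in> hom TG TG \<Longrightarrow> g \<in> hom TG TG \<Longrightarrow> (\<lambda>t. f (g t)) \<in> hom TG TG"
  using hom_compose[of g TG TG f TG] by (simp add: o_def)

lemma bimodule_tensor: "bimodule L R (tensor M S N)"
proof -
  interpret TG: comm_group TG by (rule comm_group_TG)
  interpret L: ring L by (rule M.ring_L)
  interpret R: ring R by (rule N.ring_R)
  note ext = tensor_hom_ext[OF TG.is_group]
  have id: "(\<lambda>t. t) \<in> hom TG TG" by (simp add: hom_def)
  show ?thesis
  proof (rule bimodule.intro)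
    show "comm_group (tensor M S N)"
      by (rule comm_group_cong[OF comm_group_TG]) simp_all
  next
    fix l x assume "l \<in> carrier L" "x \<in> carrier (tensor M S N)"
    then show "lact (tensor M S N) l x \<in> carrier (tensor M S N)"
      using hom_in_carrier[OF lact_hom] by simp
  next
    fix l x assume "l \<in> carrier R" "x \<in> carrier (tensor M S N)"
    then show "ract (tensor M S N) x l \<in> carrier (tensor M S N)"
      using hom_in_carrier[OF ract_hom] by simp
  next
    fix l x y assume "l \<in> carrier L" "x \<in> carrier (tensor M S N)" "y \<in> carrier (tensor M S N)"
    then show "lact (tensor M S N) l (x \<otimes>\<^bsub>tensor M S N\<^esub> y) =
        lact (tensor M S N) l x \<otimes>\<^bsub>tensor M S N\<^esub> lact (tensor M S N) l y"
      using hom_mult[OF lact_hom] by simp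
  next
    fix l x y assume "l \<in> carrier R" "x \<in> carrier (tensor M S N)" "y \<in> carrier (tensor M S N)"
    then show "ract (tensor M S N) (x \<otimes>\<^bsub>tensor M S N\<^esub> y) l =
        ract (tensor M S N) x l \<otimes>\<^bsub>tensor M S N\<^esub> ract (tensor M S N) y l"
      using hom_mult[OF ract_hom] by simp
  next
    fix k l x assume a: "k \<in> carrier L" "l \<in> carrier L" "x \<in> carrier (tensor M S N)"
    have "lact (tensor M S N) (k \<oplus>\<^bsub>L\<^esub> l) x = lact (tensor M S N) k x \<otimes>\<^bsub>TG\<^esub> lact (tensor M S N) l x"
      by (rule ext[OF lact_hom hom_mult_TG[OF lact_hom lact_hom]])
         (use a in \<open>simp_all add: lact_pure M.add_lact pure_add_left M.lact_closed\<close>)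
    then show "lact (tensor M S N) (k \<oplus>\<^bsub>L\<^esub> l) x = lact (tensor M S N) k x \<otimes>\<^bsub>tensor M S N\<^esub> lact (tensor M S N) l x"
      by simp
    show "lact (tensor M S N) (k \<otimes>\<^bsub>L\<^esub> l) x = lact (tensor M S N) k (lact (tensor M S N) l x)"
      by (rule ext[OF lact_hom hom_comp_TG[OF lact_hom lact_hom]])
         (use a in \<open>simp_all add: lact_pure M.mult_lact M.lact_closed\<close>)
  next
    fix x r s assume a: "x \<in> carrier (tensor M S N)" "r \<in> carrier R" "s \<in> carrier R"
    have "ract (tensor M S N) x (r \<oplus>\<^bsub>R\<^esub> s) = ract (tensor M S N) x r \<otimes>\<^bsub>TG\<^esub> ract (tensor M S N) x s"
      by (rule ext[OF ract_hom hom_mult_TG[OF ract_hom ract_hom]])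
         (use a in \<open>simp_all add: ract_pure N.add_ract pure_add_right N.ract_closed\<close>)
    then show "ract (tensor M S N) x (r \<oplus>\<^bsub>R\<^esub> s) = ract (tensor M S N) x r \<otimes>\<^bsub>tensor M S N\<^esub> ract (tensor M S N) x s"
      by simp
    show "ract (tensor M S N) x (r \<otimes>\<^bsub>R\<^esub> s) = ract (tensor M S N) (ract (tensor M S N) x r) s"
      by (rule ext[OF ract_hom hom_comp_TG[OF ract_hom ract_hom]])
         (use a in \<open>simp_all add: ract_pure N.mult_ract N.ract_closed\<close>)
  next
    fix x assume a: "x \<in> carrier (tensor M S N)"
    show "lact (tensor M S N) \<one>\<^bsub>L\<^esub> x = x"
      by (rule ext[OF lact_hom id]) (use a in \<open>simp_all add: lact_pure M.one_lact\<close>)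
    show "ract (tensor M S N) x \<one>\<^bsub>R\<^esub> = x"
      by (rule ext[OF ract_hom id]) (use a in \<open>simp_all add: ract_pure N.one_ract\<close>)
  next
    fix l x r assume a: "l \<in> carrier L" "x \<in> carrier (tensor M S N)" "r \<in> carrier R"
    show "ract (tensor M S N) (lact (tensor M S N) l x) r = lact (tensor M S N) l (ract (tensor M S N) x r)"
      by (rule ext[OF hom_comp_TG[OF ract_hom lact_hom] hom_comp_TG[OF lact_hom ract_hom]])
         (use a in \<open>simp_all add: ract_pure lact_pure M.lact_closed N.ract_closed\<close>)
  qed (fact M.ring_L N.ring_R)+
qed

end


section \<open>Properties of the noncommutative torus and its calculus\<close>

lemma lookup_scale [simp]: "Poly_Mapping.lookup (scale c f) k = c * Poly_Mapping.lookup f k"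
  by (simp add: scale_def Poly_Mapping.map.rep_eq when_def)

lemma scale_simps [simp]:
  "scale c 0 = 0" "scale 0 f = 0" "scale 1 f = f" "scale c (scale d f) = scale (c * d) f"
  "scale c (Poly_Mapping.single k x) = Poly_Mapping.single k (c * x)"
  by (rule poly_mapping_eqI; simp add: lookup_single when_def)+

lemma scale_add: "scale c (f + g) = scale c f + scale c g"
  and scale_add_left: "scale (c + d) f = scale c f + scale d f"
  and scale_diff: "scale c (f - g) = scale c f - scale c g"
  and scale_uminus: "scale c (- f) = - scale c f"
  by (rule poly_mapping_eqI; simp add: lookup_add lookup_minus algebra_simps)+

lemma scale_sum: "scale c (sum g A) = (\<Sum>a\<in>A. scale c (g a))"
  by (induction A rule: infinite_finite_induct) (simp_all add: scale_add)

lemma lin_superset: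
  assumes "finite A" "Poly_Mapping.keys f \<subseteq> A"
  shows "lin F f = (\<Sum>k\<in>A. scale (Poly_Mapping.lookup f k) (F k))"
  unfolding lin_def by (rule sum.mono_neutral_left) (use assms in \<open>auto simp: in_keys_iff\<close>)

lemma lin_zero [simp]: "lin F 0 = 0"
  by (simp add: lin_def)

lemma lin_add: "lin F (f + g) = lin F f + lin F g"
proof -
  let ?A = "Poly_Mapping.keys f \<union> Poly_Mapping.keys g"
  have "Poly_Mapping.keys (f + g) \<subseteq> ?A" by (rule keys_add)
  then show ?thesis
    by (simp add: lin_superset[of ?A] lookup_add scale_add_left sum.distrib)
qed

lemma lin_single [simp]: "lin F (Poly_Mapping.single k c) = scale c (F k)"
  by (simp add: lin_def)

lemma lin_scale: "lin F (scale c f) = scale c (lin F f)"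
proof -
  have "Poly_Mapping.keys (scale c f) \<subseteq> Poly_Mapping.keys f" by (auto simp: in_keys_iff)
  then show ?thesis
    by (simp add: lin_superset[of "Poly_Mapping.keys f"] scale_sum)
qed

lemma lin_uminus: "lin F (- f) = - lin F f"
  using lin_add[of F f "- f"] by (simp add: eq_neg_iff_add_eq_0 add.commute)

lemma lin_diff: "lin F (f - g) = lin F f - lin F g"
  using lin_add[of F f "- g"] by (simp add: lin_uminus)

lemma pm_induct [case_names zero add]:
  fixes f :: "'k \<Rightarrow>\<^sub>0 complex"
  assumes "P 0" "\<And>k c f. P f \<Longrightarrow> P (Poly_Mapping.single k c + f)"
  shows "P f"
proof (induction f rule: update_induct)
  case const
  then show ?case by (rule assms(1))
next
  case (update f a b)
  have "Poly_Mapping.update a b f = Poly_Mapping.single a b + f"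
    by (rule poly_mapping_eqI)
       (use update in \<open>auto simp: lookup_update lookup_add lookup_single when_def in_keys_iff\<close>)
  then show ?case using assms(2) update by simp
qed

lemma torus_mult_add_left: "torus_mult \<theta> (f + f') g = torus_mult \<theta> f g + torus_mult \<theta> f' g"
  by (simp add: torus_mult_def lin_add)

lemma lin_fun_add: "lin (\<lambda>k. F k + G k) f = lin F f + lin G f"
  by (simp add: lin_def scale_add sum.distrib)

lemma torus_mult_add_right: "torus_mult \<theta> f (g + g') = torus_mult \<theta> f g + torus_mult \<theta> f g'"
proof -
  have "torus_mult \<theta> f (g + g') = lin (\<lambda>k. (\<lambda>(m, n). lin (\<lambda>(m', n'). scale (cis (\<theta> * of_int (n * m'))) (torus_monom (m + m') (n + n'))) g) k
     + (\<lambda>(m, n). lin (\<lambda>(m', n'). scale (cis (\<theta> * of_int (n * m'))) (torus_monom (m + m') (n + n'))) g') k) f"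
    unfolding torus_mult_def by (rule arg_cong[where f="\<lambda>F. lin F f"]) (auto simp: lin_add fun_eq_iff)
  then show ?thesis unfolding torus_mult_def lin_fun_add .
qed

lemma torus_mult_zero [simp]: "torus_mult \<theta> 0 g = 0" "torus_mult \<theta> f 0 = 0"
  using torus_mult_add_right[of \<theta> f 0 0] by (simp_all add: torus_mult_def)

lemma torus_mult_single [simp]:
  "torus_mult \<theta> (Poly_Mapping.single (m, n) c) (Poly_Mapping.single (m', n') d) =
     Poly_Mapping.single (m + m', n + n') (c * d * cis (\<theta> * of_int (n * m')))"
  by (simp add: torus_mult_def torus_monom_def mult_ac)

lemma torus_mult_diff_left: "torus_mult \<theta> (f - f') g = torus_mult \<theta> f g - torus_mult \<theta> f' g"
  using torus_mult_add_left[of \<theta> "f - f'" f' g] by (simp add: algebra_simps)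

lemma torus_mult_diff_right: "torus_mult \<theta> f (g - g') = torus_mult \<theta> f g - torus_mult \<theta> f g'"
  using torus_mult_add_right[of \<theta> f "g - g'" g'] by (simp add: algebra_simps)

lemma torus_mult_scale_left: "torus_mult \<theta> (scale c f) g = scale c (torus_mult \<theta> f g)"
  by (simp add: torus_mult_def lin_scale)

lemma torus_mult_scale_right: "torus_mult \<theta> f (scale c g) = scale c (torus_mult \<theta> f g)"
proof (induction f rule: pm_induct)
  case (add k d f)
  have "torus_mult \<theta> (Poly_Mapping.single k d) (scale c g) = scale c (torus_mult \<theta> (Poly_Mapping.single k d) g)"
  proof (induction g rule: pm_induct)
    case (add k' d' g)
    then show ?case
      by (cases k; cases k') (simp add: torus_mult_add_right scale_add mult_ac)
  qed simp
  then show ?case using add by (simp add: torus_mult_add_left scale_add)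
qed simp

lemma torus_mult_assoc: "torus_mult \<theta> (torus_mult \<theta> f g) h = torus_mult \<theta> f (torus_mult \<theta> g h)"
proof (induction f rule: pm_induct)
  case (add k c f)
  have "torus_mult \<theta> (torus_mult \<theta> (Poly_Mapping.single k c) g) h =
        torus_mult \<theta> (Poly_Mapping.single k c) (torus_mult \<theta> g h)"
  proof (induction g rule: pm_induct)
    case (add l d g)
    have "torus_mult \<theta> (torus_mult \<theta> (Poly_Mapping.single k c) (Poly_Mapping.single l d)) h =
          torus_mult \<theta> (Poly_Mapping.single k c) (torus_mult \<theta> (Poly_Mapping.single l d) h)"
    proof (induction h rule: pm_induct)
      case (add j e h)
      then show ?case
        by (cases k; cases l; cases j)
           (simp add: torus_mult_add_left torus_mult_add_right algebra_simps flip: cis_mult)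
    qed simp
    then show ?case using add by (simp add: torus_mult_add_left torus_mult_add_right)
  qed simp
  then show ?case using add by (simp add: torus_mult_add_left)
qed simp

lemma torus_mult_one [simp]: "torus_mult \<theta> (torus_monom 0 0) f = f" "torus_mult \<theta> f (torus_monom 0 0) = f"
proof (induction f rule: pm_induct)
  case (add k c f)
  {
    case 1
    then show ?case using add(1) by (cases k) (simp add: torus_mult_add_right torus_monom_def)
  next
    case 2
    then show ?case using add(2) by (cases k) (simp add: torus_mult_add_left torus_monom_def)
  }
qed simp_all

lemma twist_simps [simp]:
  "twist_u \<theta> 0 = 0" "twist_v \<theta> 0 = 0"
  "twist_u \<theta> (Poly_Mapping.single (m, n) c) = Poly_Mapping.single (m, n) (c * cis (- \<theta> * of_int n))"
  "twist_v \<theta> (Poly_Mapping.single (m, n) c) = Poly_Mapping.single (m, n) (c * cis (\<theta> * of_int m))"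
  by (simp_all add: twist_u_def twist_v_def torus_monom_def)

lemma twist_add:
  "twist_u \<theta> (f + g) = twist_u \<theta> f + twist_u \<theta> g" "twist_v \<theta> (f + g) = twist_v \<theta> f + twist_v \<theta> g"
  "twist_u \<theta> (f - g) = twist_u \<theta> f - twist_u \<theta> g" "twist_v \<theta> (f - g) = twist_v \<theta> f - twist_v \<theta> g"
  "twist_u \<theta> (scale c f) = scale c (twist_u \<theta> f)" "twist_v \<theta> (scale c f) = scale c (twist_v \<theta> f)"
  by (simp_all add: twist_u_def twist_v_def lin_add lin_diff lin_scale)

lemma cis_diff_eq: "cis (a - b) = cis a * cis (- b)"
  by (simp add: cis_mult)

lemma twist_u_mult: "twist_u \<theta> (torus_mult \<theta> f g) = torus_mult \<theta> (twist_u \<theta> f) (twist_u \<theta> g)"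
proof (induction f rule: pm_induct)
  case (add k c f)
  have "twist_u \<theta> (torus_mult \<theta> (Poly_Mapping.single k c) g) =
        torus_mult \<theta> (twist_u \<theta> (Poly_Mapping.single k c)) (twist_u \<theta> g)"
  proof (induction g rule: pm_induct)
    case (add l d g)
    then show ?case
      by (cases k; cases l) (simp add: torus_mult_add_right twist_add algebra_simps cis_diff_eq flip: cis_mult)
  qed simp
  then show ?case using add by (simp add: torus_mult_add_left twist_add)
qed simp

lemma twist_v_mult: "twist_v \<theta> (torus_mult \<theta> f g) = torus_mult \<theta> (twist_v \<theta> f) (twist_v \<theta> g)"
proof (induction f rule: pm_induct)
  case (add k c f)
  have "twist_v \<theta> (torus_mult \<theta> (Poly_Mapping.single k c) g) =
        torus_mult \<theta> (twist_v \<theta> (Poly_Mapping.single k c)) (twist_v \<theta> g)"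
  proof (induction g rule: pm_induct)
    case (add l d g)
    then show ?case
      by (cases k; cases l) (simp add: torus_mult_add_right twist_add algebra_simps cis_diff_eq flip: cis_mult)
  qed simp
  then show ?case using add by (simp add: torus_mult_add_left twist_add)
qed simp

lemma twist_commute: "twist_u \<theta> (twist_v \<theta> f) = twist_v \<theta> (twist_u \<theta> f)"
proof (induction f rule: pm_induct)
  case (add k c f)
  then show ?case by (cases k) (simp add: twist_add mult_ac)
qed simp

lemma twist_one [simp]: "twist_u \<theta> (torus_monom 0 0) = torus_monom 0 0" "twist_v \<theta> (torus_monom 0 0) = torus_monom 0 0"
  by (simp_all add: torus_monom_def)

lemma ring_nc_torus: "ring (nc_torus \<theta>)"
proof (rule ringI)
  show "abelian_group (nc_torus \<theta>)"
    by (rule abelian_groupI) (auto simp: nc_torus_def algebra_simps intro: exI[of _ "- x" for x])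
  show "Group.monoid (nc_torus \<theta>)"
    by (rule monoidI) (auto simp: nc_torus_def torus_mult_assoc)
qed (auto simp: nc_torus_def torus_mult_add_left torus_mult_add_right)

lemma torus_wedge_assoc:
  "torus_wedge \<theta> (torus_wedge \<theta> x y) z = torus_wedge \<theta> x (torus_wedge \<theta> y z)"
  by (cases x; cases y; cases z)
     (simp add: torus_mult_add_left torus_mult_add_right torus_mult_diff_left torus_mult_diff_right
       twist_add twist_u_mult twist_v_mult torus_mult_assoc torus_mult_scale_left torus_mult_scale_right
       scale_add twist_commute algebra_simps)

lemma ring_torus_calculus: "ring (torus_calculus \<theta>)"
proof (rule ringI)
  show "abelian_group (torus_calculus \<theta>)"
  proof (rule abelian_groupI)
    show "\<exists>y\<in>carrier (torus_calculus \<theta>). y \<oplus>\<^bsub>torus_calculus \<theta>\<^esub> x = \<zero>\<^bsub>torus_calculus \<theta>\<^esub>" for x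
      by (rule bexI[of _ "- x"]) (simp_all add: torus_calculus_def)
  qed (simp_all add: torus_calculus_def add_ac)
  show "Group.monoid (torus_calculus \<theta>)"
    by (rule monoidI) (auto simp: torus_calculus_def torus_wedge_assoc)
qed (auto simp: torus_calculus_def torus_mult_add_left torus_mult_add_right scale_add twist_add algebra_simps)

lemma torus_calculus_relations:
  fixes \<theta> :: real
  defines "w \<equiv> torus_wedge \<theta>" and "e \<equiv> emb (torus_calculus \<theta>)"
  shows "w torus_du (e torus_u) = w (e torus_u) torus_du"
    and "w torus_dv (e torus_v) = w (e torus_v) torus_dv"
    and "w torus_dv (e torus_u) = w (e (scale (cis \<theta>) torus_u)) torus_dv"
    and "w torus_du (e torus_v) = w (e (scale (cis (- \<theta>)) torus_v)) torus_du"
    and "w torus_du torus_du = 0" and "w torus_dv torus_dv = 0"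
    and "w torus_dv torus_du = - w (e (scale (cis \<theta>) (torus_monom 0 0))) (w torus_du torus_dv)"
    and "torus_d \<theta> (e torus_u) = torus_du" and "torus_d \<theta> (e torus_v) = torus_dv"
  by (simp_all add: w_def e_def torus_calculus_def torus_monom_def diff_u_def diff_v_def zero_prod_def)

text \<open>
  \<^const>\<open>nc_torus\<close> is the complex algebra presented by invertible generators \<open>u\<close>, \<open>v\<close> and the
  relation \<open>vu = exp (\<i>\<theta>) uv\<close>: it is initial among the complex algebras with such elements.
  The scalar embedding of a complex algebra is given here as a central ring homomorphism \<open>s\<close>.
\<close>

definition zpow :: "'c::ring_1 \<Rightarrow> 'c \<Rightarrow> int \<Rightarrow> 'c" where
  "zpow x y k = (if k \<ge> 0 then x ^ nat k else y ^ nat (- k))"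

lemma zpow_0 [simp]: "zpow x y 0 = 1"
  by (simp add: zpow_def)

lemma zpow_step:
  assumes "x * y = 1" "y * x = 1"
  shows "zpow x y (k + 1) = zpow x y k * x" "zpow x y (k - 1) = zpow x y k * y"
proof -
  have p: "zpow x y (k + 1) = zpow x y k * x" for k
  proof (cases "k \<ge> 0")
    case True
    then show ?thesis by (simp add: zpow_def nat_add_distrib power_commutes)
  next
    case False
    then have "nat (- k) = Suc (nat (- (k + 1)))" by linarith
    then have "zpow x y k * x = y ^ nat (- (k + 1)) * (y * x)"
      using False by (simp only: zpow_def if_False power_Suc2 mult.assoc)
    then show ?thesis
      using False assms by (simp add: zpow_def)
  qed
  then show "zpow x y (k + 1) = zpow x y k * x" .
  have "zpow x y k * y = zpow x y (k - 1) * (x * y)" using p[of "k - 1"] by (simp add: mult.assoc)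
  then show "zpow x y (k - 1) = zpow x y k * y" using assms by simp
qed

lemma zpow_add:
  assumes "x * y = 1" "y * x = 1"
  shows "zpow x y (j + k) = zpow x y j * zpow x y k"
proof (induction k rule: int_induct[where k = 0])
  case (step1 k)
  then show ?case using zpow_step(1)[OF assms, of "j + k"] zpow_step(1)[OF assms, of k]
    by (simp add: mult.assoc add.assoc)
next
  case (step2 k)
  then show ?case using zpow_step(2)[OF assms, of "j + k"] zpow_step(2)[OF assms, of k]
    by (simp add: mult.assoc algebra_simps)
qed simp

lemma nc_torus_universal:
  fixes s :: "complex \<Rightarrow> 'c::ring_1" and \<theta> :: real
  assumes s: "s 1 = 1" "\<And>a b. s (a + b) = s a + s b" "\<And>a b. s (a * b) = s a * s b"
    and central: "\<And>a x. s a * x = x * s a"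
    and units: "U * U' = 1" "U' * U = 1" "V * V' = 1" "V' * V = 1"
    and rel: "V * U = s (cis \<theta>) * U * V"
  shows "\<exists>!h. (\<forall>f g. h (f + g) = h f + h g) \<and> (\<forall>f g. h (torus_mult \<theta> f g) = h f * h g) \<and>
    (\<forall>c. h (scale c (torus_monom 0 0)) = s c) \<and> h torus_u = U \<and> h torus_v = V"
proof -
  have s0: "s 0 = 0" using s(2)[of 0 0] by simp
  have s_left: "x * (s a * y) = s a * (x * y)" for x y a
    using central[of a x] by (simp flip: mult.assoc)
  have s_cis: "s (cis a) * (s (cis b) * x) = s (cis (a + b)) * x" for a b x
    by (simp add: s(3) flip: cis_mult mult.assoc)
  let ?U = "zpow U U'" and ?V = "zpow V V'"
  note sl = s_left[of U] s_left[of U'] s_left[of V] s_left[of V'] s_left[of "?U k" for k]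
    s_left[of "?V k" for k]
  have VU': "V * U' = s (cis (- \<theta>)) * (U' * V)"
  proof -
    have "U' * (V * U) * U' = s (cis \<theta>) * (V * U')"
    proof -
      have "U' * (V * U) * U' = s (cis \<theta>) * ((U' * U) * (V * U'))"
        unfolding rel by (simp add: mult.assoc sl)
      then show ?thesis by (simp add: units)
    qed
    moreover have "U' * (V * U) * U' = U' * V" using units by (simp add: mult.assoc)
    ultimately have "s (cis (- \<theta>)) * (U' * V) = s (cis (- \<theta>)) * (s (cis \<theta>) * (V * U'))" by simp
    then show ?thesis by (simp only: s_cis) (simp add: s(1))
  qed
  have V: "V * ?U k = s (cis (\<theta> * of_int k)) * (?U k * V)" for k
  proof (induction k rule: int_induct[where k = 0])
    case (step1 k)
    have "V * ?U (k + 1) = (V * ?U k) * U"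
      by (simp only: zpow_step[OF units(1,2)] mult.assoc)
    also have "\<dots> = s (cis (\<theta> * of_int k)) * (?U k * (V * U))"
      by (simp only: step1(2) mult.assoc)
    also have "\<dots> = s (cis (\<theta> * of_int k)) * (s (cis \<theta>) * (?U k * (U * V)))"
      by (simp add: rel sl mult.assoc)
    finally show ?case
      by (simp add: s_cis zpow_step[OF units(1,2)] mult.assoc distrib_left)
  next
    case (step2 k)
    have "V * ?U (k - 1) = (V * ?U k) * U'"
      by (simp only: zpow_step[OF units(1,2)] mult.assoc)
    also have "\<dots> = s (cis (\<theta> * of_int k)) * (?U k * (V * U'))"
      by (simp only: step2(2) mult.assoc)
    also have "\<dots> = s (cis (\<theta> * of_int k)) * (s (cis (- \<theta>)) * (?U k * (U' * V)))"
      by (simp add: VU' sl mult.assoc)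
    finally show ?case
      by (simp add: s_cis zpow_step[OF units(1,2)] mult.assoc right_diff_distrib)
  qed (simp add: s(1))
  have V': "V' * ?U k = s (cis (- (\<theta> * of_int k))) * (?U k * V')" for k
  proof -
    have "?U k * V' = V' * (V * ?U k) * V'" using units by (simp flip: mult.assoc)
    also have "\<dots> = s (cis (\<theta> * of_int k)) * (V' * ?U k * (V * V'))"
      unfolding V by (simp add: sl mult.assoc)
    finally have "s (cis (- (\<theta> * of_int k))) * (?U k * V') =
        s (cis (- (\<theta> * of_int k))) * (s (cis (\<theta> * of_int k)) * (V' * ?U k))"
      by (simp add: units)
    then show ?thesis by (simp only: s_cis) (simp add: s(1))
  qed
  have VU: "?V n * ?U m = s (cis (\<theta> * of_int (n * m))) * (?U m * ?V n)" for n m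
  proof (induction n rule: int_induct[where k = 0])
    case (step1 n)
    have "?V (n + 1) * ?U m = ?V n * (V * ?U m)"
      by (simp add: zpow_step[OF units(3,4)] mult.assoc)
    also have "\<dots> = s (cis (\<theta> * of_int m)) * (?V n * ?U m * V)"
      by (simp add: V sl mult.assoc)
    also have "\<dots> = s (cis (\<theta> * of_int m + \<theta> * of_int (n * m))) * (?U m * ?V (n + 1))"
      by (simp add: step1(2) s_cis zpow_step[OF units(3,4)] mult.assoc)
    finally show ?case by (simp add: algebra_simps)
  next
    case (step2 n)
    have "?V (n - 1) * ?U m = ?V n * (V' * ?U m)"
      by (simp add: zpow_step[OF units(3,4)] mult.assoc)
    also have "\<dots> = s (cis (- (\<theta> * of_int m))) * (?V n * ?U m * V')"
      by (simp add: V' sl mult.assoc)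
    also have "\<dots> = s (cis (- (\<theta> * of_int m) + \<theta> * of_int (n * m))) * (?U m * ?V (n - 1))"
      by (simp add: step2(2) s_cis zpow_step[OF units(3,4)] mult.assoc)
    finally show ?case by (simp add: algebra_simps)
  qed (simp add: s(1))
  define h where "h f = (\<Sum>k\<in>Poly_Mapping.keys f. s (Poly_Mapping.lookup f k) * (?U (fst k) * ?V (snd k)))" for f :: torus
  have h_superset: "h f = (\<Sum>k\<in>A. s (Poly_Mapping.lookup f k) * (?U (fst k) * ?V (snd k)))"
    if "finite A" "Poly_Mapping.keys f \<subseteq> A" for f A
    unfolding h_def by (rule sum.mono_neutral_left) (use that in \<open>auto simp: in_keys_iff s0\<close>)
  have h_add: "h (f + g) = h f + h g" for f g
  proof -
    let ?A = "Poly_Mapping.keys f \<union> Poly_Mapping.keys g"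
    have "Poly_Mapping.keys (f + g) \<subseteq> ?A" by (rule keys_add)
    then show ?thesis
      by (simp add: h_superset[of ?A] lookup_add s(2) distrib_right sum.distrib)
  qed
  have h_single: "h (Poly_Mapping.single (m, n) c) = s c * (?U m * ?V n)" for m n c
    by (simp add: h_def s0)
  have h_0: "h 0 = 0" by (simp add: h_def)
  have h_mult: "h (torus_mult \<theta> f g) = h f * h g" for f g
  proof (induction f rule: pm_induct)
    case (add k c f)
    have "h (torus_mult \<theta> (Poly_Mapping.single k c) g) = h (Poly_Mapping.single k c) * h g"
    proof (induction g rule: pm_induct)
      case (add l d g)
      obtain m n m' n' where k: "k = (m, n)" "l = (m', n')" by (cases k; cases l)
      have "h (Poly_Mapping.single k c) * h (Poly_Mapping.single l d) =
          s c * (s d * (?U m * (?V n * ?U m') * ?V n'))"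
        by (simp add: k h_single sl mult.assoc)
      also have "\<dots> = h (torus_mult \<theta> (Poly_Mapping.single k c) (Poly_Mapping.single l d))"
        by (simp add: k VU h_single sl s(3) mult.assoc zpow_add[OF units(1,2)] zpow_add[OF units(3,4)])
      finally show ?case using add by (simp add: torus_mult_add_right h_add distrib_left)
    qed (simp add: h_0)
    then show ?case using add by (simp add: torus_mult_add_left h_add distrib_right)
  qed (simp add: h_0)
  show ?thesis
  proof (rule ex1I[of _ h])
    show "(\<forall>f g. h (f + g) = h f + h g) \<and> (\<forall>f g. h (torus_mult \<theta> f g) = h f * h g) \<and>
        (\<forall>c. h (scale c (torus_monom 0 0)) = s c) \<and> h torus_u = U \<and> h torus_v = V"
      using zpow_step(1)[OF units(1,2), of 0] zpow_step(1)[OF units(3,4), of 0]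
      by (simp add: h_add h_mult torus_monom_def h_single s(1))
  next
    fix h' assume "(\<forall>f g. h' (f + g) = h' f + h' g) \<and> (\<forall>f g. h' (torus_mult \<theta> f g) = h' f * h' g) \<and>
        (\<forall>c. h' (scale c (torus_monom 0 0)) = s c) \<and> h' torus_u = U \<and> h' torus_v = V"
    then have add: "h' (f + g) = h' f + h' g" and mult: "h' (torus_mult \<theta> f g) = h' f * h' g"
      and sc: "h' (Poly_Mapping.single (0, 0) c) = s c"
      and uv: "h' (Poly_Mapping.single (1, 0) 1) = U" "h' (Poly_Mapping.single (0, 1) 1) = V" for f g c
      by (auto simp: torus_monom_def)
    have zero: "h' 0 = 0" using add[of 0 0] by simp
    have u': "h' (Poly_Mapping.single (- 1, 0) 1) = U'"
    proof -
      have "U * h' (Poly_Mapping.single (- 1, 0) 1) = 1"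
        using mult[of "Poly_Mapping.single (1, 0) 1" "Poly_Mapping.single (- 1, 0) 1"] by (simp add: uv sc s(1))
      then have "U' * (U * h' (Poly_Mapping.single (- 1, 0) 1)) = U'" by simp
      then show ?thesis using units(2) by (simp flip: mult.assoc)
    qed
    have v': "h' (Poly_Mapping.single (0, - 1) 1) = V'"
    proof -
      have "V * h' (Poly_Mapping.single (0, - 1) 1) = 1"
        using mult[of "Poly_Mapping.single (0, 1) 1" "Poly_Mapping.single (0, - 1) 1"] by (simp add: uv sc s(1))
      then have "V' * (V * h' (Poly_Mapping.single (0, - 1) 1)) = V'" by simp
      then show ?thesis using units(4) by (simp flip: mult.assoc)
    qed
    have upow: "h' (Poly_Mapping.single (k, 0) 1) = ?U k" for k
    proof (induction k rule: int_induct[where k = 0])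
      case (step1 k)
      then show ?case using mult[of "Poly_Mapping.single (k, 0) 1" "Poly_Mapping.single (1, 0) 1"]
        by (simp add: zpow_step[OF units(1,2)] uv)
    next
      case (step2 k)
      then show ?case using mult[of "Poly_Mapping.single (k, 0) 1" "Poly_Mapping.single (- 1, 0) 1"]
        by (simp add: zpow_step[OF units(1,2)] u')
    qed (simp add: sc s(1))
    have vpow: "h' (Poly_Mapping.single (0, k) 1) = ?V k" for k
    proof (induction k rule: int_induct[where k = 0])
      case (step1 k)
      then show ?case using mult[of "Poly_Mapping.single (0, k) 1" "Poly_Mapping.single (0, 1) 1"]
        by (simp add: zpow_step[OF units(3,4)] uv)
    next
      case (step2 k)
      then show ?case using mult[of "Poly_Mapping.single (0, k) 1" "Poly_Mapping.single (0, - 1) 1"]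
        by (simp add: zpow_step[OF units(3,4)] v')
    qed (simp add: sc s(1))
    have single: "h' (Poly_Mapping.single (m, n) c) = s c * (?U m * ?V n)" for m n c
      using mult[of "Poly_Mapping.single (0, 0) c" "Poly_Mapping.single (m, n) 1"]
        mult[of "Poly_Mapping.single (m, 0) 1" "Poly_Mapping.single (0, n) 1"]
      by (simp add: sc upow vpow)
    show "h' = h"
    proof
      fix f show "h' f = h f"
      proof (induction f rule: pm_induct)
        case (add k c f)
        then show ?case
          using \<open>\<And>f g. h' (f + g) = h' f + h' g\<close> by (cases k) (simp add: h_add single h_single)
      qed (simp add: zero h_0)
    qed
  qed
qed


section \<open>Existence of the connection\<close>

lemma ring_circle_algebra: "ring circle_algebra"
proof (rule ringI)
  show "abelian_group circle_algebra"
    by (rule abelian_groupI) (auto simp: circle_algebra_def algebra_simps intro: exI[of _ "- x" for x])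
  show "Group.monoid circle_algebra"
    by (rule monoidI) (auto simp: circle_algebra_def algebra_simps)
qed (auto simp: circle_algebra_def algebra_simps)

lemma torus_calculus_simps [simp]:
  "carrier (torus_calculus \<theta>) = UNIV" "monoid.mult (torus_calculus \<theta>) = torus_wedge \<theta>"
  "\<one>\<^bsub>torus_calculus \<theta>\<^esub> = (torus_monom 0 0, 0, 0, 0)" "add (torus_calculus \<theta>) = (+)"
  "\<zero>\<^bsub>torus_calculus \<theta>\<^esub> = 0"
  "grade (torus_calculus \<theta>) = torus_grade" "emb (torus_calculus \<theta>) a = (a, 0, 0, 0)"
  "dif (torus_calculus \<theta>) = torus_d \<theta>"
  by (simp_all add: torus_calculus_def)

lemma circle_calculus_simps [simp]:
  "carrier circle_calculus = UNIV" "(a, b) \<otimes>\<^bsub>circle_calculus\<^esub> (a', b') = (a * a', a * b' + b * a')"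
  "\<one>\<^bsub>circle_calculus\<^esub> = (1, 0)" "add circle_calculus = (+)" "\<zero>\<^bsub>circle_calculus\<^esub> = 0"
  "grade circle_calculus = circle_grade" "emb circle_calculus c = (c, 0)"
  "dif circle_calculus (a, b) = (0, circle_diff a)"
  by (simp_all add: circle_calculus_def)

lemma nc_torus_simps [simp]:
  "carrier (nc_torus \<theta>) = UNIV" "monoid.mult (nc_torus \<theta>) = torus_mult \<theta>"
  "\<one>\<^bsub>nc_torus \<theta>\<^esub> = torus_monom 0 0" "add (nc_torus \<theta>) = (+)" "\<zero>\<^bsub>nc_torus \<theta>\<^esub> = 0"
  by (simp_all add: nc_torus_def)

lemma circle_algebra_simps [simp]:
  "carrier circle_algebra = UNIV" "monoid.mult circle_algebra = (*)"
  "\<one>\<^bsub>circle_algebra\<^esub> = 1" "add circle_algebra = (+)" "\<zero>\<^bsub>circle_algebra\<^esub> = 0"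
  by (simp_all add: circle_algebra_def)

lemma Forms_simps [simp]:
  "carrier (Forms \<Omega> n) = grade \<Omega> n" "monoid.mult (Forms \<Omega> n) = add \<Omega>" "one (Forms \<Omega> n) = \<zero>\<^bsub>\<Omega>\<^esub>"
  "lact (Forms \<Omega> n) a w = emb \<Omega> a \<otimes>\<^bsub>\<Omega>\<^esub> w" "ract (Forms \<Omega> n) w a = w \<otimes>\<^bsub>\<Omega>\<^esub> emb \<Omega> a"
  by (simp_all add: Forms_def)

lemma torus_E_simps [simp]:
  "carrier (torus_E \<theta>) = UNIV" "monoid.mult (torus_E \<theta>) = (+)" "one (torus_E \<theta>) = 0"
  "lact (torus_E \<theta>) b (f, h) = (torus_mult \<theta> (eval_u b) f, torus_mult \<theta> (eval_v b) h)"
  "ract (torus_E \<theta>) (f, h) k = (torus_mult \<theta> f k, torus_mult \<theta> h k)"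
  by (simp_all add: torus_E_def)

lemma torus_wedge_add: "torus_wedge \<theta> (x + y) z = torus_wedge \<theta> x z + torus_wedge \<theta> y z"
    "torus_wedge \<theta> x (y + z) = torus_wedge \<theta> x y + torus_wedge \<theta> x z"
  using ring.ring_simprules(13)[OF ring_torus_calculus, of x \<theta> y z]
    ring.ring_simprules(23)[OF ring_torus_calculus, of y \<theta> z x] by simp_all

lemma torus_wedge_zero [simp]: "torus_wedge \<theta> 0 z = 0" "torus_wedge \<theta> z 0 = 0"
  using torus_wedge_add(1)[of \<theta> 0 0 z] torus_wedge_add(2)[of \<theta> z 0 0] by simp_all

lemma torus_wedge_one [simp]: "torus_wedge \<theta> (torus_monom 0 0, 0, 0, 0) x = x"
    "torus_wedge \<theta> x (torus_monom 0 0, 0, 0, 0) = x"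
  by (cases x; simp)+

lemma torus_grade_wedge: "x \<in> torus_grade n \<Longrightarrow> y \<in> torus_grade m \<Longrightarrow> torus_wedge \<theta> x y \<in> torus_grade (n + m)"
  by (auto simp: torus_grade_def zero_prod_def split: if_splits)

lemma torus_grade_emb [simp]: "(a, 0, 0, 0) \<in> torus_grade 0"
  by (simp add: torus_grade_def)

lemma torus_grade_add: "x \<in> torus_grade n \<Longrightarrow> y \<in> torus_grade n \<Longrightarrow> x + y \<in> torus_grade n"
  and torus_grade_uminus: "x \<in> torus_grade n \<Longrightarrow> - x \<in> torus_grade n"
  and torus_grade_zero [simp]: "0 \<in> torus_grade n"
  by (auto simp: torus_grade_def zero_prod_def split: if_splits)

lemma circle_grade_mult: "x \<in> circle_grade n \<Longrightarrow> y \<in> circle_grade m \<Longrightarrow> x \<otimes>\<^bsub>circle_calculus\<^esub> y \<in> circle_grade (n + m)"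
  by (auto simp: circle_grade_def zero_prod_def split: if_splits)

lemma circle_grade_emb [simp]: "(a, 0) \<in> circle_grade 0"
  by (simp add: circle_grade_def)

lemma circle_grade_add: "x \<in> circle_grade n \<Longrightarrow> y \<in> circle_grade n \<Longrightarrow> x + y \<in> circle_grade n"
  and circle_grade_uminus: "x \<in> circle_grade n \<Longrightarrow> - x \<in> circle_grade n"
  and circle_grade_zero [simp]: "0 \<in> circle_grade n"
  by (auto simp: circle_grade_def zero_prod_def split: if_splits)

lemma bimodule_torus_forms: "bimodule (nc_torus \<theta>) (nc_torus \<theta>) (Forms (torus_calculus \<theta>) n)"
proof (rule bimodule.intro)
  show "comm_group (Forms (torus_calculus \<theta>) n)"
  proof (rule comm_groupI)
    show "\<exists>y\<in>carrier (Forms (torus_calculus \<theta>) n). y \<otimes>\<^bsub>Forms (torus_calculus \<theta>) n\<^esub> x = \<one>\<^bsub>Forms (torus_calculus \<theta>) n\<^esub>"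
      if "x \<in> carrier (Forms (torus_calculus \<theta>) n)" for x
      by (rule bexI[of _ "- x"]) (use that in \<open>simp_all add: torus_grade_uminus\<close>)
  qed (simp_all add: torus_grade_add add_ac)
next
  fix a b :: torus and x
  show "lact (Forms (torus_calculus \<theta>) n) (a \<oplus>\<^bsub>nc_torus \<theta>\<^esub> b) x =
     lact (Forms (torus_calculus \<theta>) n) a x \<otimes>\<^bsub>Forms (torus_calculus \<theta>) n\<^esub> lact (Forms (torus_calculus \<theta>) n) b x"
    using torus_wedge_add(1)[of \<theta> "(a,0,0,0)" "(b,0,0,0)" x] by simp
  show "ract (Forms (torus_calculus \<theta>) n) x (a \<oplus>\<^bsub>nc_torus \<theta>\<^esub> b) =
     ract (Forms (torus_calculus \<theta>) n) x a \<otimes>\<^bsub>Forms (torus_calculus \<theta>) n\<^esub> ract (Forms (torus_calculus \<theta>) n) x b"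
    using torus_wedge_add(2)[of \<theta> x "(a,0,0,0)" "(b,0,0,0)"] by simp
  show "lact (Forms (torus_calculus \<theta>) n) (a \<otimes>\<^bsub>nc_torus \<theta>\<^esub> b) x =
     lact (Forms (torus_calculus \<theta>) n) a (lact (Forms (torus_calculus \<theta>) n) b x)"
    using torus_wedge_assoc[of \<theta> "(a,0,0,0)" "(b,0,0,0)" x] by simp
  show "ract (Forms (torus_calculus \<theta>) n) x (a \<otimes>\<^bsub>nc_torus \<theta>\<^esub> b) =
     ract (Forms (torus_calculus \<theta>) n) (ract (Forms (torus_calculus \<theta>) n) x a) b"
    using torus_wedge_assoc[of \<theta> x "(a,0,0,0)" "(b,0,0,0)"] by simp
next
  fix a x assume "x \<in> carrier (Forms (torus_calculus \<theta>) n)"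
  then show "lact (Forms (torus_calculus \<theta>) n) a x \<in> carrier (Forms (torus_calculus \<theta>) n)"
    "ract (Forms (torus_calculus \<theta>) n) x a \<in> carrier (Forms (torus_calculus \<theta>) n)"
    using torus_grade_wedge[OF torus_grade_emb, of x n] torus_grade_wedge[OF _ torus_grade_emb, of x n] by simp_all
qed (simp_all add: ring_nc_torus torus_wedge_add torus_wedge_assoc)

lemma circle_mult_add:
  "(x + y) \<otimes>\<^bsub>circle_calculus\<^esub> z = (x \<otimes>\<^bsub>circle_calculus\<^esub> z) + (y \<otimes>\<^bsub>circle_calculus\<^esub> z)"
  "z \<otimes>\<^bsub>circle_calculus\<^esub> (x + y) = (z \<otimes>\<^bsub>circle_calculus\<^esub> x) + (z \<otimes>\<^bsub>circle_calculus\<^esub> y)"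
  "(x \<otimes>\<^bsub>circle_calculus\<^esub> y) \<otimes>\<^bsub>circle_calculus\<^esub> z = x \<otimes>\<^bsub>circle_calculus\<^esub> (y \<otimes>\<^bsub>circle_calculus\<^esub> z)"
  by (cases x; cases y; cases z; simp add: algebra_simps)+

lemma bimodule_circle_forms: "bimodule circle_algebra circle_algebra (Forms circle_calculus n)"
proof (rule bimodule.intro)
  show "comm_group (Forms circle_calculus n)"
  proof (rule comm_groupI)
    show "\<exists>y\<in>carrier (Forms circle_calculus n). y \<otimes>\<^bsub>Forms circle_calculus n\<^esub> x = \<one>\<^bsub>Forms circle_calculus n\<^esub>"
      if "x \<in> carrier (Forms circle_calculus n)" for x
      by (rule bexI[of _ "- x"]) (use that in \<open>simp_all add: circle_grade_uminus\<close>)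
  qed (simp_all add: circle_grade_add add_ac)
next
  fix a x assume "x \<in> carrier (Forms circle_calculus n)"
  then show "lact (Forms circle_calculus n) a x \<in> carrier (Forms circle_calculus n)"
    "ract (Forms circle_calculus n) x a \<in> carrier (Forms circle_calculus n)"
    using circle_grade_mult[OF circle_grade_emb, of x n] circle_grade_mult[OF _ circle_grade_emb, of x n] by simp_all
next
  fix a b :: circle and x
  show "lact (Forms circle_calculus n) (a \<oplus>\<^bsub>circle_algebra\<^esub> b) x =
     lact (Forms circle_calculus n) a x \<otimes>\<^bsub>Forms circle_calculus n\<^esub> lact (Forms circle_calculus n) b x"
   "ract (Forms circle_calculus n) x (a \<oplus>\<^bsub>circle_algebra\<^esub> b) =
     ract (Forms circle_calculus n) x a \<otimes>\<^bsub>Forms circle_calculus n\<^esub> ract (Forms circle_calculus n) x b"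
   "lact (Forms circle_calculus n) (a \<otimes>\<^bsub>circle_algebra\<^esub> b) x =
     lact (Forms circle_calculus n) a (lact (Forms circle_calculus n) b x)"
   "ract (Forms circle_calculus n) x (a \<otimes>\<^bsub>circle_algebra\<^esub> b) =
     ract (Forms circle_calculus n) (ract (Forms circle_calculus n) x a) b"
    by (cases x; simp add: algebra_simps)+
next
  fix x show "lact (Forms circle_calculus n) \<one>\<^bsub>circle_algebra\<^esub> x = x"
    "ract (Forms circle_calculus n) x \<one>\<^bsub>circle_algebra\<^esub> = x"
    by (cases x; simp)+
qed (simp_all add: ring_circle_algebra circle_mult_add)

lemma eval_add: "eval_u (a + b) = eval_u a + eval_u b" "eval_v (a + b) = eval_v a + eval_v b"
  by (simp_all add: eval_u_def eval_v_def lin_add)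

lemma eval_single [simp]: "eval_u (Poly_Mapping.single k c) = Poly_Mapping.single (k, 0) c"
  "eval_v (Poly_Mapping.single k c) = Poly_Mapping.single (0, k) c"
  "eval_u 0 = 0" "eval_v 0 = 0"
  by (simp_all add: eval_u_def eval_v_def torus_monom_def)

lemma eval_one [simp]: "eval_u 1 = torus_monom 0 0" "eval_v 1 = torus_monom 0 0"
  by (simp_all add: torus_monom_def flip: single_one)

lemma eval_mult: "eval_u (a * b) = torus_mult \<theta> (eval_u a) (eval_u b)"
  "eval_v (a * b) = torus_mult \<theta> (eval_v a) (eval_v b)"
proof (induction a rule: pm_induct)
  case (add k c a)
  have "eval_u (Poly_Mapping.single k c * b) = torus_mult \<theta> (eval_u (Poly_Mapping.single k c)) (eval_u b)
     \<and> eval_v (Poly_Mapping.single k c * b) = torus_mult \<theta> (eval_v (Poly_Mapping.single k c)) (eval_v b)"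
    by (induction b rule: pm_induct)
       (simp_all add: eval_add torus_mult_add_right distrib_left mult_single)
  note s = this
  {
    case 1
    then show ?case using add(1) s by (simp add: distrib_right eval_add torus_mult_add_left)
  next
    case 2
    then show ?case using add(2) s by (simp add: distrib_right eval_add torus_mult_add_left)
  }
qed simp_all

lemma bimodule_torus_E: "bimodule circle_algebra (nc_torus \<theta>) (torus_E \<theta>)"
proof (rule bimodule.intro)
  show "comm_group (torus_E \<theta>)"
  proof (rule comm_groupI)
    show "\<exists>y\<in>carrier (torus_E \<theta>). y \<otimes>\<^bsub>torus_E \<theta>\<^esub> x = \<one>\<^bsub>torus_E \<theta>\<^esub>" for x
      by (rule bexI[of _ "- x"]) simp_all
  qed (simp_all add: add_ac)
qed (auto simp: ring_nc_torus ring_circle_algebra torus_mult_add_left torus_mult_add_right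
    torus_mult_assoc eval_add eval_mult[of _ _ \<theta>])

lemma tc_E_forms: "tensor_context circle_algebra (nc_torus \<theta>) (nc_torus \<theta>) (torus_E \<theta>) (Forms (torus_calculus \<theta>) n)"
  by (intro tensor_context.intro bimodule_torus_E bimodule_torus_forms)

lemma tc_forms_E: "tensor_context circle_algebra circle_algebra (nc_torus \<theta>) (Forms circle_calculus n) (torus_E \<theta>)"
  by (intro tensor_context.intro bimodule_torus_E bimodule_circle_forms)

lemma torus_diff_add: "diff_u \<theta> (f + g) = diff_u \<theta> f + diff_u \<theta> g" "diff_v (f + g) = diff_v f + diff_v g"
  "circle_diff (a + b) = circle_diff a + circle_diff b"
  "diff_u \<theta> 0 = 0" "diff_v 0 = 0" "circle_diff 0 = 0"
  by (simp_all add: diff_u_def diff_v_def circle_diff_def lin_add)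

lemma torus_diff_single [simp]:
  "diff_u \<theta> (Poly_Mapping.single (m, n) c) = Poly_Mapping.single (m - 1, n) (c * (of_int m * cis (- \<theta> * of_int n)))"
  "diff_v (Poly_Mapping.single (m, n) c) = Poly_Mapping.single (m, n - 1) (c * of_int n)"
  "circle_diff (Poly_Mapping.single k c) = Poly_Mapping.single (k - 1) (c * of_int k)"
  by (simp_all add: diff_u_def diff_v_def circle_diff_def torus_monom_def)

lemma cis_cancel: "cis x * (cis (- x) * y) = y" "cis (- x) * (cis x * y) = y"
  by (simp_all add: cis_mult flip: mult.assoc)

lemma torus_diff_mult:
  "diff_u \<theta> (torus_mult \<theta> f g) = torus_mult \<theta> (diff_u \<theta> f) (twist_u \<theta> g) + torus_mult \<theta> f (diff_u \<theta> g)"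
  "diff_v (torus_mult \<theta> f g) = torus_mult \<theta> (diff_v f) (twist_v \<theta> g) + torus_mult \<theta> f (diff_v g)"
proof (induction f rule: pm_induct)
  case (add k c f)
  have "diff_u \<theta> (torus_mult \<theta> (Poly_Mapping.single k c) g) = torus_mult \<theta> (diff_u \<theta> (Poly_Mapping.single k c)) (twist_u \<theta> g) + torus_mult \<theta> (Poly_Mapping.single k c) (diff_u \<theta> g) \<and>
    diff_v (torus_mult \<theta> (Poly_Mapping.single k c) g) = torus_mult \<theta> (diff_v (Poly_Mapping.single k c)) (twist_v \<theta> g) + torus_mult \<theta> (Poly_Mapping.single k c) (diff_v g)"
  proof (induction g rule: pm_induct)
    case (add l d g)
    obtain m n m' n' where k: "k = (m, n)" "l = (m', n')" by (cases k; cases l)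
    have u: "diff_u \<theta> (torus_mult \<theta> (Poly_Mapping.single k c) (Poly_Mapping.single l d)) =
       torus_mult \<theta> (diff_u \<theta> (Poly_Mapping.single k c)) (twist_u \<theta> (Poly_Mapping.single l d)) +
       torus_mult \<theta> (Poly_Mapping.single k c) (diff_u \<theta> (Poly_Mapping.single l d))"
      by (simp add: k cis_diff_eq algebra_simps flip: cis_mult single_add)
    have v: "diff_v (torus_mult \<theta> (Poly_Mapping.single k c) (Poly_Mapping.single l d)) =
       torus_mult \<theta> (diff_v (Poly_Mapping.single k c)) (twist_v \<theta> (Poly_Mapping.single l d)) +
       torus_mult \<theta> (Poly_Mapping.single k c) (diff_v (Poly_Mapping.single l d))"
      by (simp add: k cis_diff_eq cis_cancel algebra_simps flip: cis_mult single_add)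
    show ?case using add u v by (simp add: torus_mult_add_right twist_add torus_diff_add)
  qed (simp add: torus_diff_add)
  note s = this
  {
    case 1
    show ?case using s add(1) by (simp add: torus_mult_add_left torus_diff_add)
  next
    case 2
    show ?case using s add(2) by (simp add: torus_mult_add_left torus_diff_add)
  }
qed (simp_all add: torus_diff_add)

lemma torus_diff_comm: "diff_u \<theta> (diff_v f) = scale (cis \<theta>) (diff_v (diff_u \<theta> f))"
proof (induction f rule: pm_induct)
  case (add k c f)
  then show ?case
    by (cases k) (simp add: torus_diff_add scale_add algebra_simps cis_diff_eq flip: cis_mult)
qed (simp add: torus_diff_add)


text \<open>The maps of differential graded algebras with \<open>t \<mapsto> u\<close> and \<open>t \<mapsto> v\<close>\<close>

definition dga_u :: "circle_form \<Rightarrow> torus_form" where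
  "dga_u x = (eval_u (fst x), eval_u (snd x), 0, 0)"

definition dga_v :: "circle_form \<Rightarrow> torus_form" where
  "dga_v x = (eval_v (fst x), 0, eval_v (snd x), 0)"

lemma twist_eval [simp]: "twist_u \<theta> (eval_u a) = eval_u a" "twist_v \<theta> (eval_v a) = eval_v a"
  by (induction a rule: pm_induct) (simp_all add: eval_add twist_add)

lemma torus_diff_eval [simp]: "diff_u \<theta> (eval_u a) = eval_u (circle_diff a)" "diff_v (eval_v a) = eval_v (circle_diff a)"
  "diff_u \<theta> (eval_v a) = 0" "diff_v (eval_u a) = 0"
  by (induction a rule: pm_induct) (simp_all add: eval_add torus_diff_add)

lemma dga_mult: assumes "x \<in> circle_grade n" "y \<in> circle_grade m"
  shows "dga_u (x \<otimes>\<^bsub>circle_calculus\<^esub> y) = torus_wedge \<theta> (dga_u x) (dga_u y)"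
  "dga_v (x \<otimes>\<^bsub>circle_calculus\<^esub> y) = torus_wedge \<theta> (dga_v x) (dga_v y)"
  by (cases x; cases y; simp add: dga_u_def dga_v_def eval_add eval_mult[of _ _ \<theta>])+

lemma dga_add: "dga_u (x + y) = dga_u x + dga_u y" "dga_v (x + y) = dga_v x + dga_v y"
  by (simp_all add: dga_u_def dga_v_def eval_add)

lemma dga_grade: "x \<in> circle_grade n \<Longrightarrow> dga_u x \<in> torus_grade n" "x \<in> circle_grade n \<Longrightarrow> dga_v x \<in> torus_grade n"
  by (auto simp: dga_u_def dga_v_def circle_grade_def torus_grade_def zero_prod_def split: if_splits)

context
  fixes \<theta> :: real
begin

private abbreviation (input) "A \<equiv> nc_torus \<theta>"
private abbreviation (input) "OA \<equiv> torus_calculus \<theta>"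
private abbreviation (input) "B \<equiv> circle_algebra"
private abbreviation (input) "OB \<equiv> circle_calculus"
private abbreviation (input) "E \<equiv> torus_E \<theta>"
private abbreviation (input) "T n \<equiv> tensor_group E A (Forms OA n)"
private abbreviation (input) "W \<equiv> torus_wedge \<theta>"
private abbreviation (input) "i a \<equiv> (a, 0, 0, 0) :: torus_form"

text \<open>\<open>(1 \<oplus> 0) \<otimes> x + (0 \<oplus> 1) \<otimes> y\<close>\<close>

definition "torus_tensor n x y = pure_tensor E A (Forms OA n) (torus_monom 0 0, 0) x \<otimes>\<^bsub>T n\<^esub>
    pure_tensor E A (Forms OA n) (0, torus_monom 0 0) y"

lemma cgT: "comm_group (T n)" by (rule tensor_context.comm_group_TG[OF tc_E_forms])

lemma pureT: "x \<in> torus_grade n \<Longrightarrow> pure_tensor E A (Forms OA n) e x \<in> carrier (T n)"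
  by (rule tensor_context.pure_closed[OF tc_E_forms]) simp_all

lemma torus_tensor_closed: "x \<in> torus_grade n \<Longrightarrow> y \<in> torus_grade n \<Longrightarrow> torus_tensor n x y \<in> carrier (T n)"
  unfolding torus_tensor_def using pureT cgT by (simp add: comm_group_def group_def monoid.m_closed)

lemma torus_tensor_add:
  assumes "x \<in> torus_grade n" "y \<in> torus_grade n" "x' \<in> torus_grade n" "y' \<in> torus_grade n"
  shows "torus_tensor n (x + x') (y + y') = torus_tensor n x y \<otimes>\<^bsub>T n\<^esub> torus_tensor n x' y'"
proof -
  interpret T: comm_group "T n" by (rule cgT)
  have "pure_tensor E A (Forms OA n) e (w + w') = pure_tensor E A (Forms OA n) e w \<otimes>\<^bsub>T n\<^esub> pure_tensor E A (Forms OA n) e w'"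
    if "w \<in> torus_grade n" "w' \<in> torus_grade n" for w w' e
    using tensor_context.pure_add_right[OF tc_E_forms, of e \<theta> w n w'] that by simp
  then show ?thesis
    using assms pureT by (simp add: torus_tensor_def T.m_ac)
qed

lemma torus_tensor_zero: "torus_tensor n 0 0 = \<one>\<^bsub>T n\<^esub>"
proof -
  interpret T: comm_group "T n" by (rule cgT)
  have "torus_tensor n 0 0 \<otimes>\<^bsub>T n\<^esub> torus_tensor n 0 0 = torus_tensor n 0 0" using torus_tensor_add[of 0 n 0 0 0] by simp
  then show ?thesis using torus_tensor_closed[of 0 n 0] by simp
qed

lemma torus_tensor_uminus: "x \<in> torus_grade n \<Longrightarrow> y \<in> torus_grade n \<Longrightarrow> inv\<^bsub>T n\<^esub> torus_tensor n x y = torus_tensor n (- x) (- y)"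
proof -
  interpret T: comm_group "T n" by (rule cgT)
  assume a: "x \<in> torus_grade n" "y \<in> torus_grade n"
  then have "torus_tensor n (- x) (- y) \<otimes>\<^bsub>T n\<^esub> torus_tensor n x y = \<one>\<^bsub>T n\<^esub>"
    using torus_tensor_add[of "- x" n "- y" x y] by (simp add: torus_grade_uminus torus_tensor_zero)
  then show ?thesis using a torus_tensor_closed T.inv_equality torus_grade_uminus by simp
qed

lemma pure_eq_torus_tensor:
  assumes "x \<in> torus_grade n"
  shows "pure_tensor E A (Forms OA n) (f, h) x = torus_tensor n (W (i f) x) (W (i h) x)"
proof -
  have "pure_tensor E A (Forms OA n) (f, h) x =
      pure_tensor E A (Forms OA n) (f, 0) x \<otimes>\<^bsub>T n\<^esub> pure_tensor E A (Forms OA n) (0, h) x"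
    using tensor_context.pure_add_left[OF tc_E_forms, of "(f, 0)" \<theta> "(0, h)" x n] assms by simp
  then show ?thesis
    using tensor_context.pure_balanced[OF tc_E_forms, of "(torus_monom 0 0, 0)" \<theta> f x n] assms
      tensor_context.pure_balanced[OF tc_E_forms, of "(0, torus_monom 0 0)" \<theta> h x n]
    by (simp add: torus_tensor_def)
qed

lemma emb_zero_tuple: "(0, 0, 0, 0) = (0 :: torus_form)"
  by (simp add: zero_prod_def)

lemma pure_e1: "x \<in> torus_grade n \<Longrightarrow> pure_tensor E A (Forms OA n) (torus_monom 0 0, 0) x = torus_tensor n x 0"
  using pure_eq_torus_tensor[of x n "torus_monom 0 0" 0] unfolding emb_zero_tuple by simp

lemma pure_e2: "x \<in> torus_grade n \<Longrightarrow> pure_tensor E A (Forms OA n) (0, torus_monom 0 0) x = torus_tensor n 0 x"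
  using pure_eq_torus_tensor[of x n 0 "torus_monom 0 0"] unfolding emb_zero_tuple by simp

text \<open>\<open>G\<close> is biadditive and balanced, as a map \<open>A \<times> \<Omega>\<^sup>n \<rightarrow> \<Omega>\<^sup>m\<close>.\<close>

definition "torus_bal n m G \<longleftrightarrow>
  (\<forall>f. \<forall>w\<in>torus_grade n. G f w \<in> torus_grade m) \<and>
  (\<forall>f g. \<forall>w\<in>torus_grade n. G (f + g) w = G f w + G g w) \<and>
  (\<forall>f. \<forall>w\<in>torus_grade n. \<forall>w'\<in>torus_grade n. G f (w + w') = G f w + G f w') \<and>
  (\<forall>f s. \<forall>w\<in>torus_grade n. G (torus_mult \<theta> f s) w = G f (W (i s) w))"

lemma balancedI:
  assumes F: "\<And>f h w. w \<in> torus_grade n \<Longrightarrow> F (f, h) w = torus_tensor m (G f w) (G' h w)"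
    and G: "torus_bal n m G" and G': "torus_bal n m G'"
  shows "balanced B A A E (Forms OA n) (T m) F"
proof -
  have ig: "w \<in> torus_grade n \<Longrightarrow> W (i s) w \<in> torus_grade n" for s w
    using torus_grade_wedge[OF torus_grade_emb, of w n] by simp
  show ?thesis
  proof (rule balanced.intro[OF tc_E_forms], rule balanced_axioms.intro, rule cgT)
    fix e e' x x' s
    show "e \<in> carrier E \<Longrightarrow> x \<in> carrier (Forms OA n) \<Longrightarrow> F e x \<in> carrier (T m)"
      using G G' unfolding torus_bal_def by (cases e) (simp add: F torus_tensor_closed)
    show "e \<in> carrier E \<Longrightarrow> e' \<in> carrier E \<Longrightarrow> x \<in> carrier (Forms OA n) \<Longrightarrow>
        F (e \<otimes>\<^bsub>E\<^esub> e') x = F e x \<otimes>\<^bsub>T m\<^esub> F e' x"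
      using G G' unfolding torus_bal_def by (cases e; cases e') (simp add: F torus_tensor_add)
    show "e \<in> carrier E \<Longrightarrow> x \<in> carrier (Forms OA n) \<Longrightarrow> x' \<in> carrier (Forms OA n) \<Longrightarrow>
        F e (x \<otimes>\<^bsub>Forms OA n\<^esub> x') = F e x \<otimes>\<^bsub>T m\<^esub> F e x'"
      using G G' unfolding torus_bal_def by (cases e) (simp add: F torus_tensor_add torus_grade_add)
    show "e \<in> carrier E \<Longrightarrow> s \<in> carrier A \<Longrightarrow> x \<in> carrier (Forms OA n) \<Longrightarrow>
        F (ract E e s) x = F e (lact (Forms OA n) s x)"
      using G G' unfolding torus_bal_def by (cases e) (simp add: F ig)
  qed
qed

lemma torus_bal_zero: assumes "torus_bal n m G" "w \<in> torus_grade n" shows "G 0 w = 0"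
proof -
  have "G (0 + 0) w = G 0 w + G 0 w" using assms unfolding torus_bal_def by blast
  then show ?thesis by simp
qed

lemma lift_torus_tensor:
  assumes F: "\<And>f h w. w \<in> torus_grade n \<Longrightarrow> F (f, h) w = torus_tensor m (G f w) (G' h w)"
    and G: "torus_bal n m G" and G': "torus_bal n m G'"
    and x: "x \<in> torus_grade n" "y \<in> torus_grade n"
  shows "tensor_lift (T m) F (torus_tensor n x y) = torus_tensor m (G (torus_monom 0 0) x) (G' (torus_monom 0 0) y)"
proof -
  note b = balancedI[OF F G G']
  have "tensor_lift (T m) F (torus_tensor n x y) = F (torus_monom 0 0, 0) x \<otimes>\<^bsub>T m\<^esub> F (0, torus_monom 0 0) y"
    unfolding torus_tensor_def
    using hom_mult[OF balanced.lift_hom[OF b] pureT[OF x(1)] pureT[OF x(2)]]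
      balanced.lift_pure[OF b] x by simp
  also have "\<dots> = torus_tensor m (G (torus_monom 0 0) x) (G' (torus_monom 0 0) y)"
    using G G' x torus_bal_zero[OF G] torus_bal_zero[OF G'] torus_tensor_add[of "G (torus_monom 0 0) x" m 0 0 "G' (torus_monom 0 0) y"]
    unfolding torus_bal_def by (simp add: F)
  finally show ?thesis .
qed

lemma bal_wedge:
  assumes "a \<in> torus_grade k" "c \<in> torus_grade l" "m = k + n + l"
  shows "torus_bal n m (\<lambda>f w. W (W a (W (i f) w)) c)"
  unfolding torus_bal_def
proof (intro conjI allI ballI)
  fix f :: torus and w assume w: "w \<in> torus_grade n"
  have "W (i f) w \<in> torus_grade n" using torus_grade_wedge[OF torus_grade_emb w] by simp
  then show "W (W a (W (i f) w)) c \<in> torus_grade m"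
    using torus_grade_wedge[OF torus_grade_wedge[OF assms(1)] assms(2)] assms(3) by simp
next
  fix f g w
  have "W (i (f + g)) w = W (i f) w + W (i g) w"
    using torus_wedge_add(1)[of \<theta> "i f" "i g" w] by simp
  then show "W (W a (W (i (f + g)) w)) c = W (W a (W (i f) w)) c + W (W a (W (i g) w)) c"
    by (simp add: torus_wedge_add)
next
  fix f s w
  show "W (W a (W (i (torus_mult \<theta> f s)) w)) c = W (W a (W (i f) (W (i s) w))) c"
    using torus_wedge_assoc[of \<theta> "i f" "i s" w] by simp
qed (simp add: torus_wedge_add)

lemma wedge_torus_tensor:
  assumes "x \<in> torus_grade n" "y \<in> torus_grade n" "w \<in> torus_grade m" "k = n + m"
  shows "wedge A OA E k (torus_tensor n x y) w = torus_tensor k (W x w) (W y w)"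
proof -
  have g: "W w' w \<in> torus_grade k" if "w' \<in> torus_grade n" for w'
    using torus_grade_wedge[OF that assms(3)] assms(4) by simp
  have F: "pure_tensor E A (Forms OA k) (f, h) (w' \<otimes>\<^bsub>OA\<^esub> w) =
      torus_tensor k (W (W (i (torus_monom 0 0)) (W (i f) w')) w) (W (W (i (torus_monom 0 0)) (W (i h) w')) w)"
    if "w' \<in> torus_grade n" for f h w'
    using pure_eq_torus_tensor[OF g[OF that], of f h] by (simp add: torus_wedge_assoc del: torus_wedge.simps)
  have "torus_bal n k (\<lambda>f w'. W (W (i (torus_monom 0 0)) (W (i f) w')) w)"
    by (rule bal_wedge[OF torus_grade_emb assms(3)]) (simp add: assms(4))
  note L = lift_torus_tensor[OF F this this assms(1,2)]
  show ?thesis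
    unfolding wedge_def tensor_lift_tensor using L by (simp only: torus_wedge_one)
qed


lemma lact_torus_tensor:
  assumes "x \<in> torus_grade n" "y \<in> torus_grade n"
  shows "lact (EForms A OA E n) b (torus_tensor n x y) = torus_tensor n (W (i (eval_u b)) x) (W (i (eval_v b)) y)"
proof -
  have "lact (EForms A OA E n) b (torus_tensor n x y) =
     lact (EForms A OA E n) b (pure_tensor E A (Forms OA n) (torus_monom 0 0, 0) x) \<otimes>\<^bsub>T n\<^esub>
     lact (EForms A OA E n) b (pure_tensor E A (Forms OA n) (0, torus_monom 0 0) y)"
    unfolding torus_tensor_def by (rule hom_mult[OF tensor_context.lact_hom[OF tc_E_forms]]) (use pureT assms in simp_all)
  also have "\<dots> = torus_tensor n (W (i (eval_u b)) x) 0 \<otimes>\<^bsub>T n\<^esub> torus_tensor n 0 (W (i (eval_v b)) y)"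
    using tensor_context.lact_pure[OF tc_E_forms[of \<theta> n], of b] assms
      pure_eq_torus_tensor[of x n "eval_u b" 0] pure_eq_torus_tensor[of y n 0 "eval_v b"]
    by (simp add: emb_zero_tuple)
  also have "\<dots> = torus_tensor n (W (i (eval_u b)) x) (W (i (eval_v b)) y)"
    using torus_tensor_add[of "W (i (eval_u b)) x" n 0 0 "W (i (eval_v b)) y"]
      torus_grade_wedge[OF torus_grade_emb assms(1)] torus_grade_wedge[OF torus_grade_emb assms(2)] by simp
  finally show ?thesis .
qed

lemma ract_torus_tensor:
  assumes "x \<in> torus_grade n" "y \<in> torus_grade n"
  shows "ract (EForms A OA E n) (torus_tensor n x y) a = torus_tensor n (W x (i a)) (W y (i a))"
proof -
  have "ract (EForms A OA E n) (torus_tensor n x y) a =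
     ract (EForms A OA E n) (pure_tensor E A (Forms OA n) (torus_monom 0 0, 0) x) a \<otimes>\<^bsub>T n\<^esub>
     ract (EForms A OA E n) (pure_tensor E A (Forms OA n) (0, torus_monom 0 0) y) a"
    unfolding torus_tensor_def by (rule hom_mult[OF tensor_context.ract_hom[OF tc_E_forms]]) (use pureT assms in simp_all)
  also have "\<dots> = torus_tensor n (W x (i a)) (W y (i a))"
    using tensor_context.ract_pure[OF tc_E_forms[of \<theta> n], of a] assms
    by (simp add: torus_tensor_def)
  finally show ?thesis .
qed

definition "torus_sigma n t = tensor_lift (T n)
   (\<lambda>\<xi> e. torus_tensor n (W (dga_u \<xi>) (i (fst e))) (W (dga_v \<xi>) (i (snd e)))) t"

lemma torus_sigma_balanced: "balanced B B A (Forms OB n) E (T n)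
   (\<lambda>\<xi> e. torus_tensor n (W (dga_u \<xi>) (i (fst e))) (W (dga_v \<xi>) (i (snd e))))"
proof -
  have g: "W (dga_u \<xi>) (i f) \<in> torus_grade n" "W (dga_v \<xi>) (i f) \<in> torus_grade n"
    if "\<xi> \<in> circle_grade n" for \<xi> f
    using torus_grade_wedge[OF dga_grade(1)[OF that] torus_grade_emb]
      torus_grade_wedge[OF dga_grade(2)[OF that] torus_grade_emb] by simp_all
  have ia: "i (f + f') = i f + i f'" for f f' :: torus by simp
  have im: "i (torus_mult \<theta> f f') = W (i f) (i f')" for f f' by simp
  show ?thesis
  proof (rule balanced.intro[OF tc_forms_E], rule balanced_axioms.intro, rule cgT)
    fix \<xi> \<xi>' e e' b
    show "\<xi> \<in> carrier (Forms OB n) \<Longrightarrow> torus_tensor n (W (dga_u \<xi>) (i (fst e))) (W (dga_v \<xi>) (i (snd e))) \<in> carrier (T n)"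
      by (simp add: torus_tensor_closed g del: torus_wedge.simps)
    show "\<xi> \<in> carrier (Forms OB n) \<Longrightarrow> \<xi>' \<in> carrier (Forms OB n) \<Longrightarrow>
      torus_tensor n (W (dga_u (\<xi> \<otimes>\<^bsub>Forms OB n\<^esub> \<xi>')) (i (fst e))) (W (dga_v (\<xi> \<otimes>\<^bsub>Forms OB n\<^esub> \<xi>')) (i (snd e))) =
      torus_tensor n (W (dga_u \<xi>) (i (fst e))) (W (dga_v \<xi>) (i (snd e))) \<otimes>\<^bsub>T n\<^esub>
      torus_tensor n (W (dga_u \<xi>') (i (fst e))) (W (dga_v \<xi>') (i (snd e)))"
      by (simp add: torus_tensor_add g dga_add torus_wedge_add del: torus_wedge.simps)
    show "\<xi> \<in> carrier (Forms OB n) \<Longrightarrow>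
      torus_tensor n (W (dga_u \<xi>) (i (fst (e \<otimes>\<^bsub>E\<^esub> e')))) (W (dga_v \<xi>) (i (snd (e \<otimes>\<^bsub>E\<^esub> e')))) =
      torus_tensor n (W (dga_u \<xi>) (i (fst e))) (W (dga_v \<xi>) (i (snd e))) \<otimes>\<^bsub>T n\<^esub>
      torus_tensor n (W (dga_u \<xi>) (i (fst e'))) (W (dga_v \<xi>) (i (snd e')))"
      by (simp add: torus_tensor_add g ia torus_wedge_add del: torus_wedge.simps add_Pair)
    have d: "dga_u (b, 0) = i (eval_u b)" "dga_v (b, 0) = i (eval_v b)" by (simp_all add: dga_u_def dga_v_def)
    assume "\<xi> \<in> carrier (Forms OB n)"
    then have \<xi>: "\<xi> \<in> circle_grade n" by simp
    show "torus_tensor n (W (dga_u (ract (Forms OB n) \<xi> b)) (i (fst e))) (W (dga_v (ract (Forms OB n) \<xi> b)) (i (snd e))) =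
      torus_tensor n (W (dga_u \<xi>) (i (fst (lact E b e)))) (W (dga_v \<xi>) (i (snd (lact E b e))))"
      using dga_mult[OF \<xi> circle_grade_emb, of b \<theta>]
      by (cases e) (simp add: d im torus_wedge_assoc del: torus_wedge.simps)
  qed
qed

lemma torus_sigma_hom: "torus_sigma n \<in> hom (tensor_group (Forms OB n) B E) (T n)"
  unfolding torus_sigma_def by (rule balanced.lift_hom[OF torus_sigma_balanced])

lemma torus_sigma_pure: "\<xi> \<in> circle_grade n \<Longrightarrow>
   torus_sigma n (pure_tensor (Forms OB n) B E \<xi> (f, h)) = torus_tensor n (W (dga_u \<xi>) (i f)) (W (dga_v \<xi>) (i h))"
  unfolding torus_sigma_def by (subst balanced.lift_pure[OF torus_sigma_balanced]) simp_all

lemma torus_sigma_bimod_hom: "torus_sigma n \<in> bimod_hom B A (FormsE B OB E n) (EForms A OA E n)"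
  unfolding bimod_hom_def
proof (intro CollectI conjI ballI)
  show "torus_sigma n \<in> hom (FormsE B OB E n) (EForms A OA E n)" using torus_sigma_hom by simp
next
  interpret FE: tensor_context B B A "Forms OB n" E by (rule tc_forms_E)
  interpret EF: tensor_context B A A E "Forms OA n" by (rule tc_E_forms)
  have g: "W (dga_u \<xi>) (i f) \<in> torus_grade n" "W (dga_v \<xi>) (i f) \<in> torus_grade n"
    if "\<xi> \<in> circle_grade n" for \<xi> f
    using torus_grade_wedge[OF dga_grade(1)[OF that] torus_grade_emb]
      torus_grade_wedge[OF dga_grade(2)[OF that] torus_grade_emb] by simp_all
  have gT: "group (T n)" using cgT by (simp add: comm_group_def)
  have im: "i (torus_mult \<theta> f f') = W (i f) (i f')" for f f' by simp
  fix t assume t: "t \<in> carrier (FormsE B OB E n)"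
  show "torus_sigma n (lact (FormsE B OB E n) b t) = lact (EForms A OA E n) b (torus_sigma n t)" if "b \<in> carrier B" for b
  proof (rule FE.tensor_hom_ext[OF gT])
    show "(\<lambda>t. torus_sigma n (lact (FormsE B OB E n) b t)) \<in> hom FE.TG (T n)"
      using hom_compose[OF FE.lact_hom[of b] torus_sigma_hom] by (simp add: o_def)
    show "(\<lambda>t. lact (EForms A OA E n) b (torus_sigma n t)) \<in> hom FE.TG (T n)"
      using hom_compose[OF torus_sigma_hom EF.lact_hom[of b]] by (simp add: o_def)
    fix \<xi> e assume \<xi>: "\<xi> \<in> carrier (Forms OB n)" "e \<in> carrier E"
    have d: "dga_u (b, 0) = i (eval_u b)" "dga_v (b, 0) = i (eval_v b)" by (simp_all add: dga_u_def dga_v_def)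
    have bx: "(b, 0) \<otimes>\<^bsub>circle_calculus\<^esub> \<xi> \<in> circle_grade n"
      using circle_grade_mult[OF circle_grade_emb, of \<xi> n b] \<xi> by simp
    obtain f h where e: "e = (f, h)" by (cases e)
    show "torus_sigma n (lact (FormsE B OB E n) b (pure_tensor (Forms OB n) B E \<xi> e)) =
      lact (EForms A OA E n) b (torus_sigma n (pure_tensor (Forms OB n) B E \<xi> e))"
      using \<xi> bx dga_mult[OF circle_grade_emb, of \<xi> n b \<theta>]
      by (simp add: FE.lact_pure e torus_sigma_pure lact_torus_tensor g d torus_wedge_assoc del: torus_wedge.simps circle_calculus_simps(2))
  qed (use t in simp)
  show "torus_sigma n (ract (FormsE B OB E n) t a) = ract (EForms A OA E n) (torus_sigma n t) a" if "a \<in> carrier A" for a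
  proof (rule FE.tensor_hom_ext[OF gT])
    show "(\<lambda>t. torus_sigma n (ract (FormsE B OB E n) t a)) \<in> hom FE.TG (T n)"
      using hom_compose[OF FE.ract_hom[of a] torus_sigma_hom] by (simp add: o_def)
    show "(\<lambda>t. ract (EForms A OA E n) (torus_sigma n t) a) \<in> hom FE.TG (T n)"
      using hom_compose[OF torus_sigma_hom EF.ract_hom[of a]] by (simp add: o_def)
    fix \<xi> e assume \<xi>: "\<xi> \<in> carrier (Forms OB n)" "e \<in> carrier E"
    obtain f h where e: "e = (f, h)" by (cases e)
    show "torus_sigma n (ract (FormsE B OB E n) (pure_tensor (Forms OB n) B E \<xi> e) a) =
      ract (EForms A OA E n) (torus_sigma n (pure_tensor (Forms OB n) B E \<xi> e)) a"
      using \<xi>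
      by (simp add: FE.ract_pure e torus_sigma_pure ract_torus_tensor g im torus_wedge_assoc del: torus_wedge.simps)
  qed (use t in simp)
qed

lemma torus_sigma_zero: "t \<in> carrier (FormsE B OB E 0) \<Longrightarrow> torus_sigma 0 t = sigma_zero B OB A OA E t"
proof -
  interpret FE: tensor_context B B A "Forms OB 0" E by (rule tc_forms_E)
  have eq: "pure_tensor E A (Forms OA 0) (lact E (inv_into (carrier B) (emb OB) \<xi>) e) \<one>\<^bsub>OA\<^esub> =
     torus_tensor 0 (W (dga_u \<xi>) (i (fst e))) (W (dga_v \<xi>) (i (snd e)))" if \<xi>: "\<xi> \<in> circle_grade 0" for \<xi> e
  proof -
    obtain b where b: "\<xi> = (b, 0)" using \<xi> by (auto simp: circle_grade_def)
    have "inj (emb OB)" by (auto simp: inj_def)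
    then have "inv_into (carrier B) (emb OB) \<xi> = b"
      using inv_into_f_f[of "emb OB" UNIV b] by (simp add: b)
    then show ?thesis
      using pure_eq_torus_tensor[of "(torus_monom 0 0, 0, 0, 0)" 0] by (cases e) (simp add: b dga_u_def dga_v_def)
  qed
  have bal: "balanced B B A (Forms OB 0) E (T 0) (\<lambda>\<xi> e. pure_tensor E A (Forms OA 0) (lact E (inv_into (carrier B) (emb OB) \<xi>) e) \<one>\<^bsub>OA\<^esub>)"
  proof -
    interpret s: balanced B B A "Forms OB 0" E "T 0" "(\<lambda>\<xi> e. torus_tensor 0 (W (dga_u \<xi>) (i (fst e))) (W (dga_v \<xi>) (i (snd e))))"
      by (rule torus_sigma_balanced)
    show ?thesis
      apply (rule balanced.intro[OF tc_forms_E], rule balanced_axioms.intro, rule cgT)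
      using s.f_closed s.f_add_left s.f_add_right s.f_balanced FE.M.ract_closed FE.M_mult_closed
      by (simp_all only: eq Forms_simps(1) circle_calculus_simps(6))
  qed
  assume t: "t \<in> carrier (FormsE B OB E 0)"
  have gT: "group (T 0)" using cgT by (simp add: comm_group_def)
  show ?thesis
    unfolding sigma_zero_def tensor_lift_tensor
    by (rule FE.tensor_hom_ext[OF gT torus_sigma_hom balanced.lift_hom[OF bal]])
       (use t in \<open>simp_all only: balanced.lift_pure[OF bal] torus_sigma_def balanced.lift_pure[OF torus_sigma_balanced] eq Forms_simps(1) circle_calculus_simps(6) carrier_tensor\<close>)
qed

lemma torus_sigma_mult:
  assumes "\<xi> \<in> circle_grade n" "\<zeta> \<in> circle_grade m"
  shows "torus_sigma (n + m) (pure_tensor (Forms OB (n + m)) B E (\<xi> \<otimes>\<^bsub>OB\<^esub> \<zeta>) e) =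
    tensor_lift (EForms A OA E (n + m))
      (\<lambda>e' \<omega>. wedge A OA E (n + m) (torus_sigma n (pure_tensor (Forms OB n) B E \<xi> e')) \<omega>)
      (torus_sigma m (pure_tensor (Forms OB m) B E \<zeta> e))"
proof -
  obtain f h where e: "e = (f, h)" by (cases e)
  have g: "W (dga_u \<xi>) (i f) \<in> torus_grade n" "W (dga_v \<xi>) (i f) \<in> torus_grade n"
    if "\<xi> \<in> circle_grade n" for \<xi> f n
    using torus_grade_wedge[OF dga_grade(1)[OF that] torus_grade_emb]
      torus_grade_wedge[OF dga_grade(2)[OF that] torus_grade_emb] by simp_all
  let ?o = "i (torus_monom 0 0)"
  have F: "wedge A OA E (n + m) (torus_sigma n (pure_tensor (Forms OB n) B E \<xi> (f, h))) \<omega> =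
      torus_tensor (n + m) (W (W (dga_u \<xi>) (W (i f) \<omega>)) ?o) (W (W (dga_v \<xi>) (W (i h) \<omega>)) ?o)"
    if "\<omega> \<in> torus_grade m" for f h \<omega>
    using wedge_torus_tensor[OF g(1)[OF assms(1)] g(2)[OF assms(1)] that refl]
    by (simp add: torus_sigma_pure assms torus_wedge_assoc del: torus_wedge.simps)
  note L = lift_torus_tensor[OF F bal_wedge[OF dga_grade(1)[OF assms(1)] torus_grade_emb]
      bal_wedge[OF dga_grade(2)[OF assms(1)] torus_grade_emb] g(1)[OF assms(2)] g(2)[OF assms(2)], of f h]
  have "tensor_lift (EForms A OA E (n + m))
      (\<lambda>e' \<omega>. wedge A OA E (n + m) (torus_sigma n (pure_tensor (Forms OB n) B E \<xi> e')) \<omega>)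
      (torus_sigma m (pure_tensor (Forms OB m) B E \<zeta> e)) = torus_tensor (n + m) (W (dga_u \<xi>) (W (dga_u \<zeta>) (i f))) (W (dga_v \<xi>) (W (dga_v \<zeta>) (i h)))"
    unfolding tensor_lift_tensor e torus_sigma_pure[OF assms(2)]
    by (subst L) (simp_all only: torus_wedge_one add_0_right)
  also have "\<dots> = torus_sigma (n + m) (pure_tensor (Forms OB (n + m)) B E (\<xi> \<otimes>\<^bsub>OB\<^esub> \<zeta>) e)"
    unfolding e torus_sigma_pure[OF circle_grade_mult[OF assms]] dga_mult[OF assms, of \<theta>] torus_wedge_assoc ..
  finally show ?thesis by simp
qed

lemma extendable_torus_sigma: "extendable B OB A OA E (torus_sigma 1)"
  unfolding extendable_def
  by (rule exI[of _ torus_sigma]) (use torus_sigma_bimod_hom torus_sigma_zero torus_sigma_mult in \<open>simp del: One_nat_def\<close>)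

definition "torus_nabla e = torus_tensor 1 (torus_d \<theta> (i (fst e))) (torus_d \<theta> (i (snd e)))"

lemma torus_d_grade: "x \<in> torus_grade n \<Longrightarrow> torus_d \<theta> x \<in> torus_grade (Suc n)"
  by (auto simp: torus_grade_def zero_prod_def torus_diff_add split: if_splits)

lemma torus_d_emb: "torus_d \<theta> (i f) \<in> torus_grade 1"
  using torus_d_grade[OF torus_grade_emb, of f] by simp

lemma torus_d_add: "torus_d \<theta> (x + y) = torus_d \<theta> x + torus_d \<theta> y"
  by (cases x; cases y) (simp add: torus_diff_add scale_add)

lemma torus_d_leibniz: "torus_d \<theta> (W (i f) x) = W (torus_d \<theta> (i f)) x + W (i f) (torus_d \<theta> x)"
  by (cases x) (simp add: torus_diff_mult torus_diff_add torus_mult_scale_right torus_mult_scale_left scale_add scale_diff torus_mult_diff_right algebra_simps)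

lemma torus_d_d: "torus_d \<theta> (torus_d \<theta> x) = 0"
  by (cases x) (simp add: torus_diff_comm torus_diff_add zero_prod_def)

lemma torus_nabla_right_connection: "right_connection A OA E torus_nabla"
  unfolding right_connection_def
proof (intro conjI ballI)
  show "torus_nabla \<in> hom E (EForms A OA E 1)"
  proof (rule homI)
    fix e e'
    show "torus_nabla e \<in> carrier (EForms A OA E 1)" using torus_tensor_closed[OF torus_d_emb torus_d_emb] by (simp add: torus_nabla_def)
    have ia: "i (f + f') = i f + i f'" for f f' :: torus by simp
    show "torus_nabla (e \<otimes>\<^bsub>E\<^esub> e') = torus_nabla e \<otimes>\<^bsub>EForms A OA E 1\<^esub> torus_nabla e'"
      using torus_tensor_add[OF torus_d_emb torus_d_emb torus_d_emb torus_d_emb] unfolding torus_nabla_def torus_E_simps fst_add snd_add ia torus_d_add mult_tensor by simp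
  qed
next
  fix e :: "torus \<times> torus" and a
  obtain f h where e: "e = (f, h)" by (cases e)
  have im: "i (torus_mult \<theta> f f') = W (i f) (i f')" for f f' by simp
  have g: "W (torus_d \<theta> (i f)) (i a) \<in> torus_grade 1" for f
    using torus_grade_wedge[OF torus_d_emb torus_grade_emb] by simp
  have g': "W (i f) (torus_d \<theta> (i a)) \<in> torus_grade 1" for f
    using torus_grade_wedge[OF torus_grade_emb torus_d_emb] by simp
  show "torus_nabla (ract E e a) = ract (EForms A OA E 1) (torus_nabla e) a \<otimes>\<^bsub>EForms A OA E 1\<^esub>
      pure_tensor E A (Forms OA 1) e (dif OA (emb OA a))"
    unfolding torus_nabla_def e torus_E_simps fst_conv snd_conv ract_torus_tensor[OF torus_d_emb torus_d_emb] torus_calculus_simps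
      pure_eq_torus_tensor[OF torus_d_emb] mult_tensor torus_tensor_add[OF g g g' g', symmetric] im torus_d_leibniz ..
qed

lemma right_bimodule_connection_torus_nabla: "right_bimodule_connection B OB A OA E torus_nabla (torus_sigma 1)"
  unfolding right_bimodule_connection_def
proof (intro conjI ballI)
  fix b and e :: "torus \<times> torus"
  obtain f h where e: "e = (f, h)" by (cases e)
  have im: "i (torus_mult \<theta> f f') = W (i f) (i f')" for f f' by simp
  have g': "W (i f) (torus_d \<theta> (i a)) \<in> torus_grade 1" for f a
    using torus_grade_wedge[OF torus_grade_emb torus_d_emb] by simp
  have c: "dif OB (emb OB b) \<in> circle_grade 1" by (simp add: circle_grade_def)
  have du: "dga_u (dif OB (emb OB b)) = torus_d \<theta> (i (eval_u b))"
    "dga_v (dif OB (emb OB b)) = torus_d \<theta> (i (eval_v b))"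
    by (simp_all add: dga_u_def dga_v_def torus_diff_add)
  have gd: "torus_d \<theta> (W (i f) (i f')) \<in> torus_grade 1" for f f'
    using torus_d_emb[of "torus_mult \<theta> f f'"] by simp
  have l: "W (torus_d \<theta> (i x)) (i y) = torus_d \<theta> (W (i x) (i y)) + - W (i x) (torus_d \<theta> (i y))" for x y
    unfolding torus_d_leibniz by simp
  show "torus_sigma 1 (pure_tensor (Forms OB 1) B E (dif OB (emb OB b)) e) =
      torus_nabla (lact E b e) \<otimes>\<^bsub>EForms A OA E 1\<^esub> inv\<^bsub>EForms A OA E 1\<^esub> lact (EForms A OA E 1) b (torus_nabla e)"
    unfolding e torus_sigma_pure[OF c] du torus_nabla_def torus_E_simps fst_conv snd_conv lact_torus_tensor[OF torus_d_emb torus_d_emb] inv_tensor mult_tensor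
      torus_tensor_uminus[OF g' g'] im torus_tensor_add[OF gd gd torus_grade_uminus[OF g'] torus_grade_uminus[OF g'], symmetric] l ..
qed (simp_all add: bimodule_torus_E torus_nabla_right_connection torus_sigma_bimod_hom del: One_nat_def)

lemma zero_curvature_torus_nabla: "zero_curvature A OA E torus_nabla"
  unfolding zero_curvature_def
proof
  fix e :: "torus \<times> torus"
  obtain f h where e: "e = (f, h)" by (cases e)
  have F: "wedge A OA E 2 (torus_nabla (f', h')) \<omega> \<otimes>\<^bsub>EForms A OA E 2\<^esub> pure_tensor E A (Forms OA 2) (f', h') (dif OA \<omega>) =
     torus_tensor 2 (torus_d \<theta> (W (i f') \<omega>)) (torus_d \<theta> (W (i h') \<omega>))" if w: "\<omega> \<in> torus_grade 1" for f' h' \<omega>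
  proof -
    have dw: "torus_d \<theta> \<omega> \<in> torus_grade 2" using torus_d_grade[OF w] by (simp add: numeral_2_eq_2)
    have g: "W (torus_d \<theta> (i a)) \<omega> \<in> torus_grade 2" for a
      using torus_grade_wedge[OF torus_d_emb w] by (simp add: numeral_2_eq_2)
    have g': "W (i a) (torus_d \<theta> \<omega>) \<in> torus_grade 2" for a
      using torus_grade_wedge[OF torus_grade_emb dw] by (simp add: numeral_2_eq_2)
    show ?thesis
      unfolding torus_nabla_def fst_conv snd_conv wedge_torus_tensor[OF torus_d_emb torus_d_emb w nat_1_add_1[symmetric]] torus_calculus_simps
        pure_eq_torus_tensor[OF dw] mult_tensor torus_tensor_add[OF g g g' g', symmetric] torus_d_leibniz ..
  qed
  have ia: "i (f + f') = i f + i f'" for f f' :: torus by simp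
  have im: "i (torus_mult \<theta> f f') = W (i f) (i f')" for f f' by simp
  have b: "torus_bal 1 2 (\<lambda>f \<omega>. torus_d \<theta> (W (i f) \<omega>))"
    unfolding torus_bal_def
  proof (intro conjI allI ballI)
    fix f w assume w: "w \<in> torus_grade 1"
    show "torus_d \<theta> (W (i f) w) \<in> torus_grade 2"
      using torus_d_grade[OF torus_grade_wedge[OF torus_grade_emb w]] by (simp add: numeral_2_eq_2)
  qed (simp_all only: ia im torus_d_add torus_wedge_add torus_wedge_assoc)
  show "curvature A OA E torus_nabla e = \<one>\<^bsub>EForms A OA E 2\<^esub>"
    unfolding curvature_def tensor_lift_tensor e torus_nabla_def[of "(f, h)"] fst_conv snd_conv
    by (subst lift_torus_tensor[OF F b b torus_d_emb torus_d_emb]) (simp_all only: torus_wedge_one torus_d_d torus_tensor_zero one_tensor)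
qed

lemma torus_connection_formulas:
  "torus_nabla (f, 0) = pure_tensor E A (Forms OA 1) (\<one>\<^bsub>A\<^esub>, 0) (dif OA (emb OA f))"
  "torus_nabla (0, f) = pure_tensor E A (Forms OA 1) (0, \<one>\<^bsub>A\<^esub>) (dif OA (emb OA f))"
  "torus_sigma 1 (pure_tensor (Forms OB 1) B E circle_dt (f, 0)) =
     pure_tensor E A (Forms OA 1) (\<one>\<^bsub>A\<^esub>, 0) (torus_du \<otimes>\<^bsub>OA\<^esub> emb OA f)"
  "torus_sigma 1 (pure_tensor (Forms OB 1) B E circle_dt (0, f)) =
     pure_tensor E A (Forms OA 1) (0, \<one>\<^bsub>A\<^esub>) (torus_dv \<otimes>\<^bsub>OA\<^esub> emb OA f)"
proof -
  have d0: "torus_d \<theta> 0 = 0" by (simp add: zero_prod_def torus_diff_add)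
  have c: "circle_dt \<in> circle_grade 1" by (simp add: circle_grade_def)
  have d: "dga_u circle_dt = torus_du" "dga_v circle_dt = torus_dv"
    by (simp_all add: dga_u_def dga_v_def)
  have g: "W torus_du (i f) \<in> torus_grade 1" "W torus_dv (i f) \<in> torus_grade 1"
    by (simp_all add: torus_grade_def)
  show "torus_nabla (f, 0) = pure_tensor E A (Forms OA 1) (\<one>\<^bsub>A\<^esub>, 0) (dif OA (emb OA f))"
  "torus_nabla (0, f) = pure_tensor E A (Forms OA 1) (0, \<one>\<^bsub>A\<^esub>) (dif OA (emb OA f))"
    unfolding nc_torus_simps torus_calculus_simps pure_e1[OF torus_d_emb] pure_e2[OF torus_d_emb] torus_nabla_def fst_conv snd_conv emb_zero_tuple d0
    by (rule refl)+
  show "torus_sigma 1 (pure_tensor (Forms OB 1) B E circle_dt (f, 0)) =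
     pure_tensor E A (Forms OA 1) (\<one>\<^bsub>A\<^esub>, 0) (torus_du \<otimes>\<^bsub>OA\<^esub> emb OA f)"
  "torus_sigma 1 (pure_tensor (Forms OB 1) B E circle_dt (0, f)) =
     pure_tensor E A (Forms OA 1) (0, \<one>\<^bsub>A\<^esub>) (torus_dv \<otimes>\<^bsub>OA\<^esub> emb OA f)"
    unfolding nc_torus_simps torus_calculus_simps pure_e1[OF g(1)] pure_e2[OF g(2)] torus_sigma_pure[OF c] d emb_zero_tuple torus_wedge_zero
    by (rule refl)+
qed

lemma torus_connection_exists:
  "\<exists>nabla \<sigma>. right_bimodule_connection B OB A OA E nabla \<sigma> \<and> zero_curvature A OA E nabla \<and>
     extendable B OB A OA E \<sigma> \<and>
     (\<forall>f. nabla (f, 0) = pure_tensor E A (Forms OA 1) (\<one>\<^bsub>A\<^esub>, 0) (dif OA (emb OA f))) \<and>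
     (\<forall>h. nabla (0, h) = pure_tensor E A (Forms OA 1) (0, \<one>\<^bsub>A\<^esub>) (dif OA (emb OA h))) \<and>
     (\<forall>f. \<sigma> (pure_tensor (Forms OB 1) B E circle_dt (f, 0)) =
        pure_tensor E A (Forms OA 1) (\<one>\<^bsub>A\<^esub>, 0) (torus_du \<otimes>\<^bsub>OA\<^esub> emb OA f)) \<and>
     (\<forall>h. \<sigma> (pure_tensor (Forms OB 1) B E circle_dt (0, h)) =
        pure_tensor E A (Forms OA 1) (0, \<one>\<^bsub>A\<^esub>) (torus_dv \<otimes>\<^bsub>OA\<^esub> emb OA h))"
  using right_bimodule_connection_torus_nabla zero_curvature_torus_nabla extendable_torus_sigma
    torus_connection_formulas by blast

end

end

theory Submission
  imports Defs
begin

text \<open>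
  The maps of differential graded algebras \<open>\<Omega>\<^sub>B \<rightarrow> \<Omega>\<^sub>A\<close> with \<open>t \<mapsto> u\<close> and \<open>t \<mapsto> v\<close> describe \<open>\<sigma>\<^sub>E\<close>: under
  \<open>E \<otimes>\<^sub>A \<Omega>\<^sup>n\<^sub>A \<cong> \<Omega>\<^sup>n\<^sub>A \<oplus> \<Omega>\<^sup>n\<^sub>A\<close> the form \<open>dt\<close> acts as left multiplication by \<open>(du, dv)\<close>. So
  \<open>M\<^bsub>1,q\<^esub> = (du \<and> \<Omega>\<^sup>q\<^sub>A) \<oplus> (dv \<and> \<Omega>\<^sup>q\<^sub>A)\<close>, while \<open>M\<^bsub>0,q\<^esub>\<close> is the quotient of \<open>\<Omega>\<^sup>q\<^sub>A \<oplus> \<Omega>\<^sup>q\<^sub>A\<close> by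
  \<open>(du \<and> \<Omega>\<^sup>q\<^sup>-\<^sup>1\<^sub>A) \<oplus> (dv \<and> \<Omega>\<^sup>q\<^sup>-\<^sup>1\<^sub>A)\<close>. Every element of \<open>\<Omega>\<^sup>1\<^sub>B \<otimes>\<^sub>B M\<^bsub>0,q\<^esub>\<close> has the form \<open>dt \<otimes> m\<close>, and
  injectivity of \<open>g\<close> is the exactness of left multiplication by \<open>du\<close> and by \<open>dv\<close> on \<open>\<Omega>\<^sub>A\<close>. For
  \<open>p = 0\<close> there is nothing to do and for \<open>p \<ge> 2\<close> both sides vanish.
\<close>

section \<open>Subquotients of bimodules\<close>

text \<open>\<open>subquotient\<close> makes sense for arbitrary sets; these conditions are what
  turns \<open>H/D\<close> into a bimodule.\<close>

locale bimodule_pair = bimodule L R M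
  for L :: "('l, 'x) ring_scheme" and R :: "('r, 'y) ring_scheme"
    and M :: "('l, 'm, 'r, 'z) bimod_scheme" +
  fixes H D :: "'m set"
  assumes H: "subgroup H M" and D: "subgroup D M" and DH: "D \<subseteq> H"
    and lact_H: "\<And>l x. l \<in> carrier L \<Longrightarrow> x \<in> H \<Longrightarrow> lact M l x \<in> H"
    and ract_H: "\<And>x r. x \<in> H \<Longrightarrow> r \<in> carrier R \<Longrightarrow> ract M x r \<in> H"
    and lact_D: "\<And>l x. l \<in> carrier L \<Longrightarrow> x \<in> D \<Longrightarrow> lact M l x \<in> D"
    and ract_D: "\<And>x r. x \<in> D \<Longrightarrow> r \<in> carrier R \<Longrightarrow> ract M x r \<in> D"
begin

sublocale G: comm_group M by (rule comm_group_M)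

abbreviation "Q \<equiv> subquotient M H D"

lemma H_closed: "x \<in> H \<Longrightarrow> x \<in> carrier M"
  using H by (rule subgroup.mem_carrier)

lemma rcoset_eq_iff:
  assumes "x \<in> carrier M" "y \<in> carrier M"
  shows "D #>\<^bsub>M\<^esub> x = D #>\<^bsub>M\<^esub> y \<longleftrightarrow> x \<otimes>\<^bsub>M\<^esub> inv\<^bsub>M\<^esub> y \<in> D"
proof
  assume "D #>\<^bsub>M\<^esub> x = D #>\<^bsub>M\<^esub> y"
  then have "x \<in> D #>\<^bsub>M\<^esub> y" using G.rcos_self[OF assms(1) D] by simp
  then show "x \<otimes>\<^bsub>M\<^esub> inv\<^bsub>M\<^esub> y \<in> D"
    using subgroup.rcos_module_imp[OF D G.is_group assms(2)] by simp
next
  assume "x \<otimes>\<^bsub>M\<^esub> inv\<^bsub>M\<^esub> y \<in> D"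
  then have "x \<in> D #>\<^bsub>M\<^esub> y"
    using subgroup.rcos_module_rev[OF D G.is_group assms(2,1)] by simp
  then show "D #>\<^bsub>M\<^esub> x = D #>\<^bsub>M\<^esub> y"
    using G.repr_independence[OF _ assms(2) D] by simp
qed

lemma carrier_Q: "carrier Q = (\<lambda>x. D #>\<^bsub>M\<^esub> x) ` H"
  by (auto simp: subquotient_def monoid.defs FactGroup_def RCOSETS_def r_coset_def)

lemma one_Q: "\<one>\<^bsub>Q\<^esub> = D #>\<^bsub>M\<^esub> \<one>\<^bsub>M\<^esub>"
  using subgroup.subset[OF D] by (simp add: subquotient_def monoid.defs FactGroup_def G.coset_mult_one)

text \<open>The quotient is formed in \<open>M\<close> with carrier \<open>H\<close>, but the
  product of two cosets as sets does not see the carrier, so the rule for cosets of \<open>D\<close>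
  in all of \<open>M\<close> applies.\<close>

lemma mult_Q:
  assumes "x \<in> H" "y \<in> H"
  shows "(D #>\<^bsub>M\<^esub> x) \<otimes>\<^bsub>Q\<^esub> (D #>\<^bsub>M\<^esub> y) = D #>\<^bsub>M\<^esub> (x \<otimes>\<^bsub>M\<^esub> y)"
proof -
  have "D \<lhd> M" by (rule G.subgroup_imp_normal[OF D])
  from normal.rcos_sum[OF this H_closed[OF assms(1)] H_closed[OF assms(2)]] show ?thesis
    by (simp add: subquotient_def monoid.defs FactGroup_def set_mult_def)
qed

text \<open>The action is defined as a union over the representatives of a coset. It collapses to a
  single coset because \<open>D\<close> is stable: representatives differ by an element of
  \<open>D\<close>.\<close>

lemma lact_Q:
  assumes "l \<in> carrier L" "x \<in> H"
  shows "lact Q l (D #>\<^bsub>M\<^esub> x) = D #>\<^bsub>M\<^esub> lact M l x"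
proof -
  have eq: "D #>\<^bsub>M\<^esub> lact M l y = D #>\<^bsub>M\<^esub> lact M l x" if y: "y \<in> D #>\<^bsub>M\<^esub> x" for y
  proof -
    obtain d where d: "d \<in> D" "y = d \<otimes>\<^bsub>M\<^esub> x" using y by (auto simp: r_coset_def)
    have c: "d \<in> carrier M" "x \<in> carrier M" using d DH H_closed assms by auto
    have "lact M l y = lact M l d \<otimes>\<^bsub>M\<^esub> lact M l x" using d c assms by (simp add: lact_add)
    then have "lact M l y \<in> D #>\<^bsub>M\<^esub> lact M l x" using lact_D[OF assms(1) d(1)] by (auto simp: r_coset_def)
    then show ?thesis using G.repr_independence[OF _ lact_closed[OF assms(1) c(2)] D] by simp
  qed
  have "x \<in> D #>\<^bsub>M\<^esub> x" using G.rcos_self[OF H_closed D] assms by simp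
  then have "(\<Union>y\<in>D #>\<^bsub>M\<^esub> x. D #>\<^bsub>M\<^esub> lact M l y) = D #>\<^bsub>M\<^esub> lact M l x"
    using eq by blast
  then show ?thesis
    by (simp add: subquotient_def monoid.defs)
qed

lemma ract_Q:
  assumes "r \<in> carrier R" "x \<in> H"
  shows "ract Q (D #>\<^bsub>M\<^esub> x) r = D #>\<^bsub>M\<^esub> ract M x r"
proof -
  have eq: "D #>\<^bsub>M\<^esub> ract M y r = D #>\<^bsub>M\<^esub> ract M x r" if y: "y \<in> D #>\<^bsub>M\<^esub> x" for y
  proof -
    obtain d where d: "d \<in> D" "y = d \<otimes>\<^bsub>M\<^esub> x" using y by (auto simp: r_coset_def)
    have c: "d \<in> carrier M" "x \<in> carrier M" using d DH H_closed assms by auto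
    have "ract M y r = ract M d r \<otimes>\<^bsub>M\<^esub> ract M x r" using d c assms by (simp add: ract_add)
    then have "ract M y r \<in> D #>\<^bsub>M\<^esub> ract M x r" using ract_D[OF d(1) assms(1)] by (auto simp: r_coset_def)
    then show ?thesis using G.repr_independence[OF _ ract_closed[OF c(2) assms(1)] D] by simp
  qed
  have "x \<in> D #>\<^bsub>M\<^esub> x" using G.rcos_self[OF H_closed D] assms by simp
  then have "(\<Union>y\<in>D #>\<^bsub>M\<^esub> x. D #>\<^bsub>M\<^esub> ract M y r) = D #>\<^bsub>M\<^esub> ract M x r"
    using eq by blast
  then show ?thesis
    by (simp add: subquotient_def monoid.defs)
qed

lemma bimodule_Q: "bimodule L R Q"
proof -
  interpret L: ring L by (rule ring_L)
  interpret R: ring R by (rule ring_R)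
  have "comm_group (M\<lparr>carrier := H\<rparr>)"
    by (rule group.group_comm_groupI[OF subgroup.subgroup_is_group[OF H G.is_group]])
       (simp add: G.m_comm H_closed)
  from comm_group.abelian_FactGroup[OF this G.subgroup_incl[OF D H DH]] have "comm_group Q"
    by (rule comm_group_cong) (simp_all add: subquotient_def monoid.defs)
  moreover have "x \<otimes>\<^bsub>M\<^esub> y \<in> H" if "x \<in> H" "y \<in> H" for x y
    using H that by (rule subgroup.m_closed)
  ultimately show ?thesis
    by (intro bimodule.intro ring_L ring_R)
       (auto simp: carrier_Q mult_Q lact_Q ract_Q lact_H ract_H H_closed lact_add ract_add
          add_lact add_ract mult_lact mult_ract one_lact one_ract lact_ract)
qed

end


section \<open>Coordinates on \<open>E \<otimes>\<^sub>A \<Omega>\<^sup>n\<^sub>A\<close>\<close>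

text \<open>Forms are handled through associativity and degree from here on; component formulas are
  unfolded only where they are really needed.\<close>

declare torus_wedge.simps [simp del] circle_calculus_simps(2) [simp del]

lemma torus_wedge_uminus: "torus_wedge \<theta> (- x) y = - torus_wedge \<theta> x y" "torus_wedge \<theta> x (- y) = - torus_wedge \<theta> x y"
  using torus_wedge_add(1)[of \<theta> "- x" x y] torus_wedge_add(2)[of \<theta> x "- y" y]
  by (simp_all add: eq_neg_iff_add_eq_0)

lemma torus_emb_mult: "(torus_mult \<theta> f g, 0, 0, 0) = torus_wedge \<theta> (f, 0, 0, 0) (g, 0, 0, 0)"
  by (simp add: torus_wedge.simps)

lemma dga_emb: "dga_u (b, 0) = (eval_u b, 0, 0, 0)" "dga_v (b, 0) = (eval_v b, 0, 0, 0)"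
  by (simp_all add: dga_u_def dga_v_def)

lemma dga_zero: "dga_u 0 = 0" "dga_v 0 = 0"
  by (simp_all add: dga_u_def dga_v_def zero_prod_def)

lemma torus_grade_emb_wedge:
  "x \<in> torus_grade n \<Longrightarrow> torus_wedge \<theta> (a, 0, 0, 0) x \<in> torus_grade n"
  "x \<in> torus_grade n \<Longrightarrow> torus_wedge \<theta> x (a, 0, 0, 0) \<in> torus_grade n"
  using torus_grade_wedge[OF torus_grade_emb, of x n] torus_grade_wedge[OF _ torus_grade_emb, of x n] by simp_all

text \<open>\<open>E\<close> is free as a right \<open>A\<close>-module on \<open>(1, 0)\<close> and
  \<open>(0, 1)\<close>, so coefficients can be moved across the tensor sign; the resulting
  expressions are closed under the group operations.\<close>

lemma torus_tensor_surj:
  assumes "t \<in> carrier (tensor_group (torus_E \<theta>) (nc_torus \<theta>) (Forms (torus_calculus \<theta>) n))"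
  shows "\<exists>x\<in>torus_grade n. \<exists>y\<in>torus_grade n. t = torus_tensor \<theta> n x y"
  using assms
proof (induction t rule: tensor_context.tensor_induct[OF tc_E_forms, consumes 1, case_names pure mult inv one])
  case (pure e w)
  then have w: "torus_wedge \<theta> (a, 0, 0, 0) w \<in> torus_grade n" for a
    by (simp add: torus_grade_emb_wedge)
  show ?case
    using pure pure_eq_torus_tensor[of w n \<theta> "fst e" "snd e"] w[of "fst e"] w[of "snd e"] by auto
next
  case (mult t t')
  then obtain x y x' y' where
    "x \<in> torus_grade n" "y \<in> torus_grade n" "t = torus_tensor \<theta> n x y"
    "x' \<in> torus_grade n" "y' \<in> torus_grade n" "t' = torus_tensor \<theta> n x' y'"
    by blast
  then show ?case
    by (intro bexI[of _ "x + x'"] bexI[of _ "y + y'"]) (simp_all add: torus_tensor_add torus_grade_add)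
next
  case (inv t)
  then obtain x y where "x \<in> torus_grade n" "y \<in> torus_grade n" "t = torus_tensor \<theta> n x y"
    by blast
  then show ?case
    by (intro bexI[of _ "- x"] bexI[of _ "- y"]) (simp_all add: torus_tensor_uminus torus_grade_uminus)
next
  case one
  show ?case
    unfolding torus_tensor_zero[symmetric] by (intro bexI[of _ 0] refl torus_grade_zero)
qed

text \<open>Multiplying a form by both components of \<open>e\<close> is biadditive and balanced, so
  it descends to the tensor product, where it recovers the coordinates of a
  \<open>torus_tensor\<close>.\<close>

lemma torus_tensor_inject:
  assumes "x \<in> torus_grade n" "y \<in> torus_grade n" "x' \<in> torus_grade n" "y' \<in> torus_grade n"
  shows "torus_tensor \<theta> n x y = torus_tensor \<theta> n x' y' \<longleftrightarrow> x = x' \<and> y = y'"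
proof -
  \<comment> \<open>The target is the additive group of all pairs of forms, in the multiplicative
    notation that \<open>tensor_lift\<close> expects.\<close>
  let ?P = "\<lparr>carrier = UNIV, monoid.mult = (+), one = 0\<rparr> :: (torus_form \<times> torus_form) monoid"
  let ?f = "\<lambda>e w. (torus_wedge \<theta> (fst e, 0, 0, 0) w, torus_wedge \<theta> (snd e, 0, 0, 0) w)"
  have cg: "comm_group ?P"
  proof (rule comm_groupI)
    show "\<exists>y\<in>carrier ?P. y \<otimes>\<^bsub>?P\<^esub> x = \<one>\<^bsub>?P\<^esub>" for x
      by (rule bexI[of _ "- x"]) simp_all
  qed (simp_all add: add_ac)
  have add: "(f + g, 0, 0, 0) = (f, 0, 0, 0) + ((g, 0, 0, 0) :: torus_form)" for f g :: torus
    by simp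
  interpret balanced circle_algebra "nc_torus \<theta>" "nc_torus \<theta>" "torus_E \<theta>" "Forms (torus_calculus \<theta>) n" ?P ?f
  proof (rule balanced.intro[OF tc_E_forms], rule balanced_axioms.intro, rule cg)
    fix e s w
    show "?f (ract (torus_E \<theta>) e s) w = ?f e (lact (Forms (torus_calculus \<theta>) n) s w)"
      by (cases e) (simp add: torus_emb_mult torus_wedge_assoc)
  qed (simp_all add: add torus_wedge_add plus_prod_def[where 'a = torus_form and 'b = torus_form] del: add_Pair)
  have lift: "tensor_lift ?P ?f (torus_tensor \<theta> n x y) = (x, y)" if "x \<in> torus_grade n" "y \<in> torus_grade n" for x y
    unfolding torus_tensor_def
    using that by (simp add: lift_pure pure_closed emb_zero_tuple)
  show ?thesis
  proof
    assume "torus_tensor \<theta> n x y = torus_tensor \<theta> n x' y'"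
    then have "(x, y) = (x', y')"
      using lift[OF assms(1,2)] lift[OF assms(3,4)] by (simp only:)
    then show "x = x' \<and> y = y'" by simp
  qed simp
qed

text \<open>A generator of the left \<open>B\<close>-module \<open>\<Omega>\<^sup>p\<^sub>B\<close>, with the degenerate choice \<open>0\<close> for \<open>p \<ge> 2\<close>.\<close>

definition circle_gen :: "nat \<Rightarrow> circle_form" where
  "circle_gen p = (if p = 0 then (1, 0) else if p = 1 then circle_dt else 0)"

lemma circle_gen_grade [simp]: "circle_gen p \<in> circle_grade p"
  by (simp add: circle_gen_def circle_grade_def)

lemma circle_grade_gen:
  assumes "\<xi> \<in> circle_grade p"
  obtains b where "\<xi> = circle_gen p \<otimes>\<^bsub>circle_calculus\<^esub> (b, 0)"
\<comment> \<open>In degrees 0 and 1 one component of \<open>\<xi>\<close> vanishes, so the sum is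
  the coefficient in both cases; from degree 2 on \<open>\<xi>\<close> is zero and any coefficient
  will do.\<close>
proof (rule that[of "fst \<xi> + snd \<xi>"])
  show "\<xi> = circle_gen p \<otimes>\<^bsub>circle_calculus\<^esub> (fst \<xi> + snd \<xi>, 0)"
    using assms by (auto simp: circle_gen_def circle_grade_def zero_prod_def circle_calculus_simps(2) split: if_splits)
qed

text \<open>At \<open>p = 1\<close> this is \<open>dt \<and> dt = 0\<close>, in agreement with the
  degenerate generator.\<close>

lemma circle_gen_Suc: "circle_gen (Suc p) = circle_gen p \<otimes>\<^bsub>circle_calculus\<^esub> circle_dt"
  by (simp add: circle_gen_def zero_prod_def circle_calculus_simps(2))

lemma circle_scalar_comm: "(b, 0) \<otimes>\<^bsub>circle_calculus\<^esub> \<xi> = \<xi> \<otimes>\<^bsub>circle_calculus\<^esub> (b, 0)"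
  by (cases \<xi>) (simp add: circle_calculus_simps(2) mult.commute)

text \<open>Scalars commute with forms in the classical calculus, and the multiplicative maps
  \<open>dga_u\<close> and \<open>dga_v\<close> carry this over: powers of \<open>u\<close> commute
  with \<open>du\<close>, powers of \<open>v\<close> with \<open>dv\<close>.\<close>

lemma dga_scalar_comm:
  assumes "\<xi> \<in> circle_grade p"
  shows "torus_wedge \<theta> (eval_u b, 0, 0, 0) (torus_wedge \<theta> (dga_u \<xi>) x) = torus_wedge \<theta> (dga_u \<xi>) (torus_wedge \<theta> (eval_u b, 0, 0, 0) x)"
    "torus_wedge \<theta> (eval_v b, 0, 0, 0) (torus_wedge \<theta> (dga_v \<xi>) x) = torus_wedge \<theta> (dga_v \<xi>) (torus_wedge \<theta> (eval_v b, 0, 0, 0) x)"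
  using dga_mult[OF circle_grade_emb assms, of b \<theta>] dga_mult[OF assms circle_grade_emb, of b \<theta>]
  by (simp_all add: dga_emb circle_scalar_comm flip: torus_wedge_assoc)

text \<open>The numerator and denominator of \<open>M\<^bsub>p,q\<^esub>\<close> in the coordinates \<open>(x, y)\<close> of \<^const>\<open>torus_tensor\<close>.\<close>

definition num_pairs :: "real \<Rightarrow> nat \<Rightarrow> nat \<Rightarrow> (torus_form \<times> torus_form) set" where
  "num_pairs \<theta> p q = {(torus_wedge \<theta> (dga_u (circle_gen p)) x, torus_wedge \<theta> (dga_v (circle_gen p)) y) | x y.
     x \<in> torus_grade q \<and> y \<in> torus_grade q}"

definition den_pairs :: "real \<Rightarrow> nat \<Rightarrow> nat \<Rightarrow> (torus_form \<times> torus_form) set" where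
  "den_pairs \<theta> p q = (if q = 0 then {0} else num_pairs \<theta> (p + 1) (q - 1))"

text \<open>\<open>S\<close> is the set of coordinates of a sub-bimodule of \<open>E \<otimes>\<^sub>A \<Omega>\<^sup>n\<^sub>A\<close>.\<close>

definition sub_pairs :: "real \<Rightarrow> nat \<Rightarrow> (torus_form \<times> torus_form) set \<Rightarrow> bool" where
  "sub_pairs \<theta> n S \<longleftrightarrow> S \<subseteq> torus_grade n \<times> torus_grade n \<and> 0 \<in> S \<and> (\<forall>a\<in>S. - a \<in> S) \<and> (\<forall>a\<in>S. \<forall>b\<in>S. a + b \<in> S) \<and>
     (\<forall>(x, y)\<in>S. \<forall>b. (torus_wedge \<theta> (eval_u b, 0, 0, 0) x, torus_wedge \<theta> (eval_v b, 0, 0, 0) y) \<in> S) \<and>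
     (\<forall>(x, y)\<in>S. \<forall>a. (torus_wedge \<theta> x (a, 0, 0, 0), torus_wedge \<theta> y (a, 0, 0, 0)) \<in> S)"

section \<open>Numerators and denominators in coordinates\<close>

lemma num_pairsI:
  "x \<in> torus_grade q \<Longrightarrow> y \<in> torus_grade q \<Longrightarrow>
    (torus_wedge \<theta> (dga_u (circle_gen p)) x, torus_wedge \<theta> (dga_v (circle_gen p)) y) \<in> num_pairs \<theta> p q"
  unfolding num_pairs_def by blast

text \<open>This justifies defining \<open>num_pairs\<close> by the generator alone: the scalar
  coefficient of a \<open>p\<close>-form is absorbed into \<open>x\<close> and
  \<open>y\<close>.\<close>

lemma wedge_gen_in_num_pairs:
  assumes "\<xi> \<in> circle_grade p" "x \<in> torus_grade q" "y \<in> torus_grade q"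
  shows "(torus_wedge \<theta> (dga_u \<xi>) x, torus_wedge \<theta> (dga_v \<xi>) y) \<in> num_pairs \<theta> p q"
proof -
  obtain b where "\<xi> = circle_gen p \<otimes>\<^bsub>circle_calculus\<^esub> (b, 0)"
    using circle_grade_gen[OF assms(1)] .
  then show ?thesis
    using assms dga_mult[OF circle_gen_grade[of p] circle_grade_emb, of b \<theta>]
    by (simp add: dga_emb torus_wedge_assoc num_pairsI torus_grade_emb_wedge)
qed

text \<open>Stability under the left action of \<open>B\<close> holds because that action moves past
  the generator by \<open>dga_scalar_comm\<close>; on the right it is associativity.\<close>

lemma sub_num_pairs: "sub_pairs \<theta> (p + q) (num_pairs \<theta> p q)"
  unfolding sub_pairs_def
proof (intro conjI ballI)
  show "num_pairs \<theta> p q \<subseteq> torus_grade (p + q) \<times> torus_grade (p + q)"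
    by (auto simp: num_pairs_def intro!: torus_grade_wedge dga_grade)
  show "0 \<in> num_pairs \<theta> p q"
    unfolding num_pairs_def zero_prod_def[where 'a = torus_form and 'b = torus_form]
    by (intro CollectI exI[of _ 0]) simp
  fix a assume "a \<in> num_pairs \<theta> p q"
  then obtain x y where a: "a = (torus_wedge \<theta> (dga_u (circle_gen p)) x, torus_wedge \<theta> (dga_v (circle_gen p)) y)"
    "x \<in> torus_grade q" "y \<in> torus_grade q" unfolding num_pairs_def by blast
  show "- a \<in> num_pairs \<theta> p q"
    using a wedge_gen_in_num_pairs[of "circle_gen p" p "- x" q "- y"]
    by (simp add: torus_wedge_uminus torus_grade_uminus)
  show "case a of (x, y) \<Rightarrow> \<forall>b. (torus_wedge \<theta> (eval_u b, 0, 0, 0) x, torus_wedge \<theta> (eval_v b, 0, 0, 0) y) \<in> num_pairs \<theta> p q"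
    using a by (simp add: dga_scalar_comm[OF circle_gen_grade] wedge_gen_in_num_pairs torus_grade_emb_wedge)
  show "case a of (x, y) \<Rightarrow> \<forall>a. (torus_wedge \<theta> x (a, 0, 0, 0), torus_wedge \<theta> y (a, 0, 0, 0)) \<in> num_pairs \<theta> p q"
    using a by (simp add: torus_wedge_assoc wedge_gen_in_num_pairs torus_grade_emb_wedge)
  fix b assume "b \<in> num_pairs \<theta> p q"
  then obtain x' y' where b: "b = (torus_wedge \<theta> (dga_u (circle_gen p)) x', torus_wedge \<theta> (dga_v (circle_gen p)) y')"
    "x' \<in> torus_grade q" "y' \<in> torus_grade q" unfolding num_pairs_def by blast
  show "a + b \<in> num_pairs \<theta> p q"
    using a b by (simp add: wedge_gen_in_num_pairs torus_grade_add flip: torus_wedge_add)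
qed

lemma sub_den_pairs: "sub_pairs \<theta> (p + q) (den_pairs \<theta> p q)"
proof (cases q)
  case 0
  then show ?thesis by (auto simp: sub_pairs_def den_pairs_def zero_prod_def[where 'a = torus_form and 'b = torus_form])
next
  case (Suc r)
  then show ?thesis using sub_num_pairs[of \<theta> "p + 1" r] by (simp add: den_pairs_def)
qed

lemma num_pairs_0: "num_pairs \<theta> 0 q = torus_grade q \<times> torus_grade q"
  by (auto simp: num_pairs_def circle_gen_def dga_emb)

text \<open>The product of \<open>\<xi>\<close> and the generator of degree \<open>p\<close> is a
  form of degree \<open>r + p\<close>, to which \<open>wedge_gen_in_num_pairs\<close>
  applies.\<close>

lemma wedge_num_pairs:
  assumes "\<xi> \<in> circle_grade r" "(x, y) \<in> num_pairs \<theta> p q"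
  shows "(torus_wedge \<theta> (dga_u \<xi>) x, torus_wedge \<theta> (dga_v \<xi>) y) \<in> num_pairs \<theta> (r + p) q"
proof -
  obtain x' y' where "x = torus_wedge \<theta> (dga_u (circle_gen p)) x'" "y = torus_wedge \<theta> (dga_v (circle_gen p)) y'"
    "x' \<in> torus_grade q" "y' \<in> torus_grade q" using assms(2) unfolding num_pairs_def by blast
  then show ?thesis
    using wedge_gen_in_num_pairs[OF circle_grade_mult[OF assms(1) circle_gen_grade[of p]], of x' q y' \<theta>]
    by (simp add: dga_mult[OF assms(1) circle_gen_grade, where \<theta> = \<theta>] torus_wedge_assoc)
qed

text \<open>For \<open>p = 0\<close> this yields the independence of representatives behind the map
  \<open>g\<close>.\<close>

lemma wedge_den_pairs:
  assumes "\<xi> \<in> circle_grade r" "(x, y) \<in> den_pairs \<theta> p q"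
  shows "(torus_wedge \<theta> (dga_u \<xi>) x, torus_wedge \<theta> (dga_v \<xi>) y) \<in> den_pairs \<theta> (r + p) q"
  using assms wedge_num_pairs[OF assms(1), of x y \<theta> "Suc p"]
  by (auto simp: den_pairs_def zero_prod_def[where 'a = torus_form and 'b = torus_form] split: if_splits)

text \<open>The generator of degree \<open>p + 1\<close> is the generator of degree \<open>p\<close>
  times \<open>dt\<close>, and the image of \<open>dt\<close> can be absorbed into the right factor,
  raising its degree from \<open>q - 1\<close> to \<open>q\<close>.\<close>

lemma den_pairs_subset: "den_pairs \<theta> p q \<subseteq> num_pairs \<theta> p q"
proof (cases q)
  case 0
  then show ?thesis using sub_num_pairs[of \<theta> p q] by (simp add: den_pairs_def sub_pairs_def)
next
  case (Suc r)
  have dt: "circle_dt \<in> circle_grade 1" by (simp add: circle_grade_def)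
  have "torus_wedge \<theta> (dga_u circle_dt) x \<in> torus_grade q" "torus_wedge \<theta> (dga_v circle_dt) y \<in> torus_grade q"
    if "x \<in> torus_grade r" "y \<in> torus_grade r" for x y
    using torus_grade_wedge[OF dga_grade(1)[OF dt] that(1)] torus_grade_wedge[OF dga_grade(2)[OF dt] that(2)] Suc by simp_all
  then show ?thesis
    unfolding den_pairs_def Suc num_pairs_def[of _ "p + 1"]
    by (clarsimp simp: circle_gen_Suc dga_mult[OF circle_gen_grade dt, where \<theta> = \<theta>] torus_wedge_assoc num_pairsI simp del: split_paired_Ex split_paired_All)
qed

section \<open>Exactness of left multiplication by \<open>du\<close> and \<open>dv\<close>\<close>

lemma twist_inverse: "twist_u (- \<theta>) (twist_u \<theta> f) = f" "twist_v (- \<theta>) (twist_v \<theta> f) = f"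
proof (induction f rule: pm_induct)
  case (add k c f)
  {
    case 1
    then show ?case using add(1) by (cases k) (simp add: twist_add cis_mult mult.assoc)
  next
    case 2
    then show ?case using add(2) by (cases k) (simp add: twist_add cis_mult mult.assoc)
  }
qed simp_all

text \<open>The twists multiply monomials by phases and are inverted by changing the sign of
  \<open>\<theta>\<close>. Coefficients can therefore be pulled through \<open>du\<close> and
  \<open>dv\<close> in either direction.\<close>

lemma twist_surj: "\<exists>g. twist_u \<theta> g = f" "\<exists>g. twist_v \<theta> g = f"
  using twist_inverse[of "- \<theta>" f] by (metis minus_minus)+

lemma twist_eq_0 [simp]: "twist_u \<theta> f = 0 \<longleftrightarrow> f = 0" "twist_v \<theta> f = 0 \<longleftrightarrow> f = 0"
  by (metis twist_inverse twist_simps(1,2))+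

lemma torus_grade_2: "torus_grade 2 = {(0, 0, 0, f) | f. True}"
  by (simp add: torus_grade_def)

text \<open>In components, \<open>du \<and> (a, b, c, f)\<close> is
  \<open>(0, twist_u a, 0, twist_u c)\<close> with bijective twists, so kernel and image can be
  compared degree by degree. The separate clause for \<open>q = 0\<close>, where
  \<open>q - 1\<close> truncates, matches the zero denominator in \<open>den_pairs\<close>.\<close>

lemma wedge_du_exact:
  assumes "x \<in> torus_grade q" "torus_wedge \<theta> torus_du x = 0"
  shows "if q = 0 then x = 0 else x \<in> torus_wedge \<theta> torus_du ` torus_grade (q - 1)"
proof -
  consider "q = 0" | "q = 1" | "q = 2" | "q \<ge> 3" by linarith
  then show ?thesis
  proof cases
    case 1
    then show ?thesis using assms by (auto simp: torus_grade_def torus_wedge.simps zero_prod_def)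
  next
    case 2
    then obtain b where "x = (0, b, 0, 0)"
      using assms by (auto simp: torus_grade_def torus_wedge.simps zero_prod_def)
    moreover obtain b' where "twist_u \<theta> b' = b" using twist_surj(1) by blast
    ultimately have "x = torus_wedge \<theta> torus_du (b', 0, 0, 0)" by (simp add: torus_wedge.simps)
    then show ?thesis using 2 by simp
  next
    case 3
    then obtain f where "x = (0, 0, 0, f)" using assms by (auto simp: torus_grade_2)
    moreover obtain f' where "twist_u \<theta> f' = f" using twist_surj(1) by blast
    ultimately have "x = torus_wedge \<theta> torus_du (0, 0, f', 0)" by (simp add: torus_wedge.simps)
    then show ?thesis using 3 by (simp add: torus_grade_def)
  next
    case 4
    then have "x = 0" using assms by (simp add: torus_grade_def)
    then show ?thesis
      using 4 imageI[OF torus_grade_zero, of "torus_wedge \<theta> torus_du" "q - 1"] by simp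
  qed
qed

text \<open>Here the components are \<open>(0, 0, twist_v a, - cis \<theta> twist_v b)\<close>:
  interchanging \<open>dv\<close> and \<open>du\<close> contributes an invertible factor.\<close>

lemma wedge_dv_exact:
  assumes "x \<in> torus_grade q" "torus_wedge \<theta> torus_dv x = 0"
  shows "if q = 0 then x = 0 else x \<in> torus_wedge \<theta> torus_dv ` torus_grade (q - 1)"
proof -
  have scale_zero: "scale (cis \<theta>) f = 0 \<Longrightarrow> f = 0" for f :: torus
    using scale_simps(4)[of "cis (- \<theta>)" "cis \<theta>" f] by (simp add: cis_mult)
  consider "q = 0" | "q = 1" | "q = 2" | "q \<ge> 3" by linarith
  then show ?thesis
  proof cases
    case 1
    then show ?thesis using assms by (auto simp: torus_grade_def torus_wedge.simps zero_prod_def)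
  next
    case 2
    then obtain c where "x = (0, 0, c, 0)"
      using assms by (auto simp: torus_grade_def torus_wedge.simps zero_prod_def dest!: scale_zero)
    moreover obtain c' where "twist_v \<theta> c' = c" using twist_surj(2) by blast
    ultimately have "x = torus_wedge \<theta> torus_dv (c', 0, 0, 0)" by (simp add: torus_wedge.simps)
    then show ?thesis using 2 by simp
  next
    case 3
    then obtain f where "x = (0, 0, 0, f)" using assms by (auto simp: torus_grade_2)
    \<comment> \<open>The factor \<open>- cis (- \<theta>)\<close> cancels the
      \<open>- cis \<theta>\<close> produced by \<open>dv \<and> du\<close>.\<close>
    moreover obtain f' where "twist_v \<theta> f' = - scale (cis (- \<theta>)) f" using twist_surj(2) by blast
    ultimately have "x = torus_wedge \<theta> torus_dv (0, f', 0, 0)"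
      by (simp add: torus_wedge.simps scale_uminus cis_mult)
    then show ?thesis using 3 by (simp add: torus_grade_def)
  next
    case 4
    then have "x = 0" using assms by (simp add: torus_grade_def)
    then show ?thesis
      using 4 imageI[OF torus_grade_zero, of "torus_wedge \<theta> torus_dv" "q - 1"] by simp
  qed
qed

text \<open>For \<open>p = 0\<close> the generator is 1. For \<open>p = 1\<close> the denominator is
  zero, being built from the generator of degree 2, and the claim is exactness of \<open>du\<close>
  in the first coordinate and of \<open>dv\<close> in the second. From \<open>p = 2\<close> on the
  generator is 0 and the implication already fails for \<open>q = 0\<close>.\<close>

lemma den_pairs_exact:
  assumes "p \<le> 1" "x \<in> torus_grade q" "y \<in> torus_grade q"
    and "(torus_wedge \<theta> (dga_u (circle_gen p)) x, torus_wedge \<theta> (dga_v (circle_gen p)) y) \<in> den_pairs \<theta> p q"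
  shows "(x, y) \<in> den_pairs \<theta> 0 q"
proof (cases "p = 0")
  case True
  then show ?thesis using assms by (simp add: circle_gen_def dga_emb)
next
  case False
  then have p: "p = 1" using assms by simp
  have gen: "dga_u (circle_gen 1) = torus_du" "dga_v (circle_gen 1) = torus_dv"
    by (simp_all add: circle_gen_def dga_u_def dga_v_def)
  have "den_pairs \<theta> 1 q \<subseteq> {0}"
    by (auto simp: den_pairs_def num_pairs_def circle_gen_def dga_zero zero_prod_def[where 'a = torus_form and 'b = torus_form])
  then have "torus_wedge \<theta> torus_du x = 0" "torus_wedge \<theta> torus_dv y = 0"
    using assms(4) unfolding p gen by (auto simp: zero_prod_def[where 'a = torus_form and 'b = torus_form])
  from wedge_du_exact[OF assms(2) this(1)] wedge_dv_exact[OF assms(3) this(2)] show ?thesis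
    unfolding den_pairs_def num_pairs_def add_0 gen
    by (auto simp: zero_prod_def[where 'a = torus_form and 'b = torus_form] split: if_splits simp del: split_paired_Ex)
qed

section \<open>Sub-bimodules of the tensor product given by coordinates\<close>

definition tensor_image :: "real \<Rightarrow> nat \<Rightarrow> (torus_form \<times> torus_form) set \<Rightarrow> ((torus \<times> torus) \<times> torus_form \<Rightarrow>\<^sub>0 int) set set" where
  "tensor_image \<theta> n S = (\<lambda>(x, y). torus_tensor \<theta> n x y) ` S"

lemma sub_pairsD:
  assumes "sub_pairs \<theta> n S"
  shows "(x, y) \<in> S \<Longrightarrow> x \<in> torus_grade n" "(x, y) \<in> S \<Longrightarrow> y \<in> torus_grade n" "(0, 0) \<in> S"
    "(x, y) \<in> S \<Longrightarrow> (- x, - y) \<in> S" "(x, y) \<in> S \<Longrightarrow> (x', y') \<in> S \<Longrightarrow> (x + x', y + y') \<in> S"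
    "(x, y) \<in> S \<Longrightarrow> (torus_wedge \<theta> (eval_u b, 0, 0, 0) x, torus_wedge \<theta> (eval_v b, 0, 0, 0) y) \<in> S"
    "(x, y) \<in> S \<Longrightarrow> (torus_wedge \<theta> x (a, 0, 0, 0), torus_wedge \<theta> y (a, 0, 0, 0)) \<in> S"
proof -
  have S: "S \<subseteq> torus_grade n \<times> torus_grade n" "0 \<in> S" "\<And>a. a \<in> S \<Longrightarrow> - a \<in> S"
    "\<And>a b. a \<in> S \<Longrightarrow> b \<in> S \<Longrightarrow> a + b \<in> S"
    using assms unfolding sub_pairs_def by blast+
  show "(x, y) \<in> S \<Longrightarrow> x \<in> torus_grade n" "(x, y) \<in> S \<Longrightarrow> y \<in> torus_grade n"
    using S(1) by blast+
  show "(0, 0) \<in> S"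
    using S(2) by (simp add: zero_prod_def[where 'a = torus_form and 'b = torus_form])
  show "(x, y) \<in> S \<Longrightarrow> (- x, - y) \<in> S" "(x, y) \<in> S \<Longrightarrow> (x', y') \<in> S \<Longrightarrow> (x + x', y + y') \<in> S"
    using S(3)[of "(x, y)"] S(4)[of "(x, y)" "(x', y')"] by simp_all
  show "(x, y) \<in> S \<Longrightarrow> (torus_wedge \<theta> (eval_u b, 0, 0, 0) x, torus_wedge \<theta> (eval_v b, 0, 0, 0) y) \<in> S"
    "(x, y) \<in> S \<Longrightarrow> (torus_wedge \<theta> x (a, 0, 0, 0), torus_wedge \<theta> y (a, 0, 0, 0)) \<in> S"
    using assms unfolding sub_pairs_def by blast+
qed

lemma tensor_imageI: "(x, y) \<in> S \<Longrightarrow> torus_tensor \<theta> n x y \<in> tensor_image \<theta> n S"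
  unfolding tensor_image_def by force

lemma tensor_imageE:
  assumes "t \<in> tensor_image \<theta> n S"
  obtains x y where "(x, y) \<in> S" "t = torus_tensor \<theta> n x y"
  using assms that unfolding tensor_image_def by auto

lemma subgroup_tensor_image:
  assumes "sub_pairs \<theta> n S"
  shows "subgroup (tensor_image \<theta> n S) (EForms (nc_torus \<theta>) (torus_calculus \<theta>) (torus_E \<theta>) n)"
proof (rule group.subgroupI)
  note D = sub_pairsD[OF assms]
  show "Group.group (EForms (nc_torus \<theta>) (torus_calculus \<theta>) (torus_E \<theta>) n)"
    using bimodule.comm_group_M[OF tensor_context.bimodule_tensor[OF tc_E_forms]] by (simp add: comm_group_def)
  show "tensor_image \<theta> n S \<subseteq> carrier (EForms (nc_torus \<theta>) (torus_calculus \<theta>) (torus_E \<theta>) n)"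
    by (auto elim!: tensor_imageE intro!: torus_tensor_closed dest: D(1,2))
  show "tensor_image \<theta> n S \<noteq> {}"
    using tensor_imageI[OF D(3)] by blast
  fix t assume "t \<in> tensor_image \<theta> n S"
  then obtain x y where t: "(x, y) \<in> S" "t = torus_tensor \<theta> n x y" by (rule tensor_imageE)
  show "inv\<^bsub>EForms (nc_torus \<theta>) (torus_calculus \<theta>) (torus_E \<theta>) n\<^esub> t \<in> tensor_image \<theta> n S"
    using t(1) by (simp add: t(2) torus_tensor_uminus D tensor_imageI)
  fix t' assume "t' \<in> tensor_image \<theta> n S"
  then obtain x' y' where t': "(x', y') \<in> S" "t' = torus_tensor \<theta> n x' y'" by (rule tensor_imageE)
  show "t \<otimes>\<^bsub>EForms (nc_torus \<theta>) (torus_calculus \<theta>) (torus_E \<theta>) n\<^esub> t' \<in> tensor_image \<theta> n S"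
    using tensor_imageI[OF D(5)[OF t(1) t'(1)], of \<theta> n] D(1,2)[OF t(1)] D(1,2)[OF t'(1)]
    by (simp add: t(2) t'(2) torus_tensor_add)
qed

text \<open>\<open>torus_tensor\<close> is additive and both actions are componentwise in its
  coordinates, so closure of the pairs transfers to closure in the tensor product.\<close>

lemma bimodule_pair_tensor_image:
  assumes "sub_pairs \<theta> n S" "sub_pairs \<theta> n S'" "S' \<subseteq> S"
  shows "bimodule_pair circle_algebra (nc_torus \<theta>) (EForms (nc_torus \<theta>) (torus_calculus \<theta>) (torus_E \<theta>) n)
    (tensor_image \<theta> n S) (tensor_image \<theta> n S')"
proof -
  have "lact (EForms (nc_torus \<theta>) (torus_calculus \<theta>) (torus_E \<theta>) n) b t \<in> tensor_image \<theta> n S"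
    "ract (EForms (nc_torus \<theta>) (torus_calculus \<theta>) (torus_E \<theta>) n) t a \<in> tensor_image \<theta> n S"
    if S: "sub_pairs \<theta> n S" and t: "t \<in> tensor_image \<theta> n S" for S t a b
  proof -
    obtain x y where "(x, y) \<in> S" "t = torus_tensor \<theta> n x y" using t by (rule tensor_imageE)
    then show "lact (EForms (nc_torus \<theta>) (torus_calculus \<theta>) (torus_E \<theta>) n) b t \<in> tensor_image \<theta> n S"
      "ract (EForms (nc_torus \<theta>) (torus_calculus \<theta>) (torus_E \<theta>) n) t a \<in> tensor_image \<theta> n S"
      using sub_pairsD(1,2,6,7)[OF S, of x y] by (simp_all add: lact_torus_tensor ract_torus_tensor tensor_imageI)
  qed
  then show ?thesis
    using assms
    by (intro bimodule_pair.intro tensor_context.bimodule_tensor[OF tc_E_forms] bimodule_pair_axioms.intro subgroup_tensor_image)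
       (auto simp: tensor_image_def)
qed

section \<open>Values and uniqueness of \<open>\<sigma>\<close>\<close>

text \<open>On a pure tensor the scalar coefficient of \<open>\<xi>\<close> moves into
  \<open>f\<close> and \<open>h\<close>; since the generator is the same for all tensors, sums of
  such values keep this form. From degree 2 on the generator is 0, so \<open>torus_sigma\<close>
  vanishes there.\<close>

lemma torus_sigma_range:
  assumes "t \<in> carrier (FormsE circle_algebra circle_calculus (torus_E \<theta>) p)"
  shows "\<exists>f h. torus_sigma \<theta> p t = torus_tensor \<theta> p
    (torus_wedge \<theta> (dga_u (circle_gen p)) (f, 0, 0, 0)) (torus_wedge \<theta> (dga_v (circle_gen p)) (h, 0, 0, 0))"
  using assms unfolding carrier_tensor
proof (induction t rule: tensor_context.tensor_induct[OF tc_forms_E[where \<theta> = \<theta>], consumes 1, case_names pure mult inv one])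
  case (pure \<xi> e)
  obtain f h where e: "e = (f, h)" by (cases e)
  obtain b where "\<xi> = circle_gen p \<otimes>\<^bsub>circle_calculus\<^esub> (b, 0)"
    using pure circle_grade_gen[of \<xi> p] by auto
  then have "torus_sigma \<theta> p (pure_tensor (Forms circle_calculus p) circle_algebra (torus_E \<theta>) \<xi> e) = torus_tensor \<theta> p
    (torus_wedge \<theta> (dga_u (circle_gen p)) (torus_mult \<theta> (eval_u b) f, 0, 0, 0))
    (torus_wedge \<theta> (dga_v (circle_gen p)) (torus_mult \<theta> (eval_v b) h, 0, 0, 0))"
    using pure by (simp add: e torus_sigma_pure dga_mult[OF circle_gen_grade circle_grade_emb, where \<theta> = \<theta>] dga_emb
      torus_wedge_assoc torus_emb_mult)
  then show ?case by blast
next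
  have g: "torus_wedge \<theta> (dga_u (circle_gen p)) (f, 0, 0, 0) \<in> torus_grade p"
    "torus_wedge \<theta> (dga_v (circle_gen p)) (f, 0, 0, 0) \<in> torus_grade p" for f
    by (simp_all add: torus_grade_emb_wedge dga_grade)
  have hom: "group_hom (tensor_group (Forms circle_calculus p) circle_algebra (torus_E \<theta>))
      (tensor_group (torus_E \<theta>) (nc_torus \<theta>) (Forms (torus_calculus \<theta>) p)) (torus_sigma \<theta> p)"
    using torus_sigma_hom[of \<theta> p] cgT[of \<theta> p] tensor_context.comm_group_TG[OF tc_forms_E[where \<theta> = \<theta>]]
    by (simp add: group_hom_def group_hom_axioms_def comm_group_def)
  {
    case (mult t t')
    then obtain f h f' h' where "torus_sigma \<theta> p t = torus_tensor \<theta> p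
      (torus_wedge \<theta> (dga_u (circle_gen p)) (f, 0, 0, 0)) (torus_wedge \<theta> (dga_v (circle_gen p)) (h, 0, 0, 0))"
      "torus_sigma \<theta> p t' = torus_tensor \<theta> p
      (torus_wedge \<theta> (dga_u (circle_gen p)) (f', 0, 0, 0)) (torus_wedge \<theta> (dga_v (circle_gen p)) (h', 0, 0, 0))"
      by blast
    then show ?case
      using mult(1,2) g
      by - (rule exI[of _ "f + f'"], rule exI[of _ "h + h'"],
         simp add: group_hom.hom_mult[OF hom] flip: torus_tensor_add torus_wedge_add)
  next
    case (inv t)
    then obtain f h where "torus_sigma \<theta> p t = torus_tensor \<theta> p
      (torus_wedge \<theta> (dga_u (circle_gen p)) (f, 0, 0, 0)) (torus_wedge \<theta> (dga_v (circle_gen p)) (h, 0, 0, 0))"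
      by blast
    then show ?case
      using inv(1) g
      by - (rule exI[of _ "- f"], rule exI[of _ "- h"],
         simp add: group_hom.hom_inv[OF hom] torus_tensor_uminus flip: torus_wedge_uminus(2))
  next
    case one
    show ?case
      by (intro exI[of _ 0]) (simp add: group_hom.hom_one[OF hom] emb_zero_tuple torus_tensor_zero)
  }
qed

text \<open>The tensors \<open>dt \<otimes> (f, 0)\<close> and \<open>dt \<otimes> (0, h)\<close>
  generate the domain under addition and the left action of \<open>B\<close>, so prescribed values
  on them determine \<open>\<sigma>\<close>.\<close>

lemma bimod_hom_eq_torus_sigma:
  assumes hom: "\<sigma> \<in> bimod_hom circle_algebra (nc_torus \<theta>) (FormsE circle_algebra circle_calculus (torus_E \<theta>) 1)
      (EForms (nc_torus \<theta>) (torus_calculus \<theta>) (torus_E \<theta>) 1)"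
    and u: "\<And>f. \<sigma> (pure_tensor (Forms circle_calculus 1) circle_algebra (torus_E \<theta>) circle_dt (f, 0)) =
       torus_sigma \<theta> 1 (pure_tensor (Forms circle_calculus 1) circle_algebra (torus_E \<theta>) circle_dt (f, 0))"
    and v: "\<And>h. \<sigma> (pure_tensor (Forms circle_calculus 1) circle_algebra (torus_E \<theta>) circle_dt (0, h)) =
       torus_sigma \<theta> 1 (pure_tensor (Forms circle_calculus 1) circle_algebra (torus_E \<theta>) circle_dt (0, h))"
    and t: "t \<in> carrier (FormsE circle_algebra circle_calculus (torus_E \<theta>) 1)"
  shows "\<sigma> t = torus_sigma \<theta> 1 t"
proof -
  let ?T = "tensor_group (torus_E \<theta>) (nc_torus \<theta>) (Forms (torus_calculus \<theta>) 1)"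
  interpret FE: tensor_context circle_algebra circle_algebra "nc_torus \<theta>" "Forms circle_calculus 1" "torus_E \<theta>"
    by (rule tc_forms_E)
  have gT: "Group.group ?T" using cgT by (simp add: comm_group_def)
  have h: "\<sigma> \<in> hom FE.TG ?T" "torus_sigma \<theta> 1 \<in> hom FE.TG ?T"
    using hom torus_sigma_hom by (simp_all add: bimod_hom_def)
  show ?thesis
  proof (rule FE.tensor_hom_ext[OF gT h])
    fix \<xi> and e :: "torus \<times> torus"
    assume "\<xi> \<in> carrier (Forms circle_calculus 1)"
    then obtain b where b: "\<xi> = (0, b)" by (auto simp: circle_grade_def)
    obtain f h where e: "e = (f, h)" by (cases e)
    have dt: "circle_dt \<in> circle_grade 1" by (simp add: circle_grade_def)
    let ?p = "pure_tensor (Forms circle_calculus 1) circle_algebra (torus_E \<theta>)"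
    have pc: "?p circle_dt e \<in> carrier FE.TG" for e using dt by (intro FE.pure_closed) simp_all
    have eq: "?p \<xi> e = lact (FormsE circle_algebra circle_calculus (torus_E \<theta>) 1) b (?p circle_dt e)"
      using FE.lact_pure[of b circle_dt e] dt by (simp add: b circle_calculus_simps(2))
    have add: "?p circle_dt e = ?p circle_dt (f, 0) \<otimes>\<^bsub>FE.TG\<^esub> ?p circle_dt (0, h)"
      using FE.pure_add_right[of circle_dt "(f, 0)" "(0, h)"] dt by (simp add: e)
    have "\<sigma> (?p circle_dt e) = torus_sigma \<theta> 1 (?p circle_dt e)"
      unfolding add hom_mult[OF h(1) pc pc] hom_mult[OF h(2) pc pc] u v ..
    then show "\<sigma> (?p \<xi> e) = torus_sigma \<theta> 1 (?p \<xi> e)"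
      unfolding eq using hom torus_sigma_bimod_hom[of \<theta> 1] pc by (simp add: bimod_hom_def)
  qed (use t in simp)
qed

section \<open>The bimodules \<open>M\<^bsub>p,q\<^esub>\<close> of the torus\<close>

text \<open>A bimodule map is constrained only on its carrier, so agreement with
  \<open>torus_sigma\<close> is assumed only there.\<close>

context
  fixes \<theta> :: real
    and \<sigma> :: "(circle_form \<times> (torus \<times> torus) \<Rightarrow>\<^sub>0 int) set \<Rightarrow> ((torus \<times> torus) \<times> torus_form \<Rightarrow>\<^sub>0 int) set"
  assumes sigma: "\<And>t. t \<in> carrier (FormsE circle_algebra circle_calculus (torus_E \<theta>) 1) \<Longrightarrow> \<sigma> t = torus_sigma \<theta> 1 t"
begin

private abbreviation (input) "A \<equiv> nc_torus \<theta>"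
private abbreviation (input) "OA \<equiv> torus_calculus \<theta>"
private abbreviation (input) "B \<equiv> circle_algebra"
private abbreviation (input) "OB \<equiv> circle_calculus"
private abbreviation (input) "E \<equiv> torus_E \<theta>"
private abbreviation (input) "W \<equiv> torus_wedge \<theta>"
private abbreviation (input) "i a \<equiv> (a, 0, 0, 0) :: torus_form"
private abbreviation (input) "M \<equiv> M_bimod B OB A OA E \<sigma>"
private abbreviation (input) "cls0 q x y \<equiv> M_class B OB A OA E \<sigma> 0 q (torus_tensor \<theta> q x y)"
private abbreviation (input) "cls p q x y \<equiv> M_class B OB A OA E \<sigma> p q (torus_tensor \<theta> (p + q) x y)"

text \<open>The three cases of \<open>sigma_ext\<close> become one formula: the canonical map in
  degree 0, the assumption on \<open>\<sigma>\<close> in degree 1, and zero on both sides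
  afterwards.\<close>

lemma sigma_ext_eq_torus_sigma:
  assumes t: "t \<in> carrier (FormsE B OB E p)"
  shows "sigma_ext B OB A OA E \<sigma> p t = torus_sigma \<theta> p t"
proof -
  consider "p = 0" | "p = 1" | "p \<ge> 2" by linarith
  then show ?thesis
  proof cases
    case 1
    then show ?thesis using t torus_sigma_zero[of t \<theta>] by (simp add: sigma_ext_def)
  next
    case 2
    then show ?thesis using t sigma[of t] by (simp add: sigma_ext_def)
  next
    case 3
    then show ?thesis using torus_sigma_range[OF t] by (auto simp: sigma_ext_def circle_gen_def dga_zero torus_tensor_zero)
  qed
qed

lemma wedge_gen_emb_grade:
  "W (dga_u (circle_gen p)) (i f) \<in> torus_grade p" "W (dga_v (circle_gen p)) (i f) \<in> torus_grade p"
  by (simp_all add: torus_grade_emb_wedge dga_grade)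

lemma sigma_wedge_eq:
  assumes "\<xi> \<in> circle_grade p" "\<eta> \<in> torus_grade q"
  shows "sigma_wedge B OB A OA E \<sigma> p q \<xi> (f, h) \<eta> =
    torus_tensor \<theta> (p + q) (W (dga_u \<xi>) (W (i f) \<eta>)) (W (dga_v \<xi>) (W (i h) \<eta>))"
proof -
  have "pure_tensor (Forms OB p) B E \<xi> (f, h) \<in> carrier (FormsE B OB E p)"
    using tensor_context.pure_closed[OF tc_forms_E[where \<theta> = \<theta>]] assms(1) by simp
  then show ?thesis
    using assms
    by (simp add: sigma_wedge_def sigma_ext_eq_torus_sigma torus_sigma_pure wedge_torus_tensor[OF _ _ _ refl]
      torus_grade_emb_wedge dga_grade torus_wedge_assoc)
qed

text \<open>The right-hand side is a subgroup containing every generator of \<open>M_num\<close>;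
  conversely each of its elements is a sum of two generators.\<close>

lemma M_num_eq: "M_num B OB A OA E \<sigma> p q = tensor_image \<theta> (p + q) (num_pairs \<theta> p q)"
proof
  note S = sub_num_pairs[of \<theta> p q]
  have gp: "Group.group (EForms A OA E (p + q))"
    using bimodule.comm_group_M[OF tensor_context.bimodule_tensor[OF tc_E_forms[where \<theta> = \<theta>]]] by (simp add: comm_group_def)
  show "M_num B OB A OA E \<sigma> p q \<subseteq> tensor_image \<theta> (p + q) (num_pairs \<theta> p q)"
    unfolding M_num_def
  proof (rule group.generate_subgroup_incl[OF gp _ subgroup_tensor_image[OF S]], clarify)
    fix t \<eta> assume t: "t \<in> carrier (FormsE B OB E p)" and "\<eta> \<in> grade OA q"
    then have \<eta>: "\<eta> \<in> torus_grade q" by simp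
    obtain f h where "torus_sigma \<theta> p t = torus_tensor \<theta> p (W (dga_u (circle_gen p)) (i f)) (W (dga_v (circle_gen p)) (i h))"
      using torus_sigma_range[OF t] by blast
    then have "wedge A OA E (p + q) (sigma_ext B OB A OA E \<sigma> p t) \<eta> =
        torus_tensor \<theta> (p + q) (W (dga_u (circle_gen p)) (W (i f) \<eta>)) (W (dga_v (circle_gen p)) (W (i h) \<eta>))"
      using wedge_torus_tensor[OF wedge_gen_emb_grade \<eta> refl] sigma_ext_eq_torus_sigma[OF t] by (simp add: torus_wedge_assoc)
    then show "wedge A OA E (p + q) (sigma_ext B OB A OA E \<sigma> p t) \<eta> \<in> tensor_image \<theta> (p + q) (num_pairs \<theta> p q)"
      using \<eta> by (simp add: tensor_imageI num_pairsI torus_grade_emb_wedge)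
  qed
  show "tensor_image \<theta> (p + q) (num_pairs \<theta> p q) \<subseteq> M_num B OB A OA E \<sigma> p q"
  proof
    fix t assume "t \<in> tensor_image \<theta> (p + q) (num_pairs \<theta> p q)"
    then obtain x y where xy: "x \<in> torus_grade q" "y \<in> torus_grade q"
      and t: "t = torus_tensor \<theta> (p + q) (W (dga_u (circle_gen p)) x) (W (dga_v (circle_gen p)) y)"
      unfolding tensor_image_def num_pairs_def by blast
    have sw: "sigma_wedge B OB A OA E \<sigma> p q (circle_gen p) e w \<in> M_num B OB A OA E \<sigma> p q" if "w \<in> torus_grade q" for e w
    proof -
      have "pure_tensor (Forms OB p) B E (circle_gen p) e \<in> carrier (FormsE B OB E p)"
        using tensor_context.pure_closed[OF tc_forms_E[where \<theta> = \<theta>]] by simp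
      then show ?thesis
        using that unfolding M_num_def sigma_wedge_def
        by - (rule generate.incl, rule CollectI, intro exI conjI, rule refl, simp_all)
    qed
    have "W (dga_u (circle_gen p)) x \<in> torus_grade (p + q)" "W (dga_v (circle_gen p)) y \<in> torus_grade (p + q)"
      using xy by (simp_all add: torus_grade_wedge dga_grade)
    \<comment> \<open>Both coordinates of one generator involve the same form \<open>\<eta>\<close>.
      Independent \<open>x\<close> and \<open>y\<close> are reached by one generator per coordinate,
      with \<open>e\<close> equal to \<open>(1, 0)\<close> and \<open>(0, 1)\<close>.\<close>
    then have "t = sigma_wedge B OB A OA E \<sigma> p q (circle_gen p) (torus_monom 0 0, 0) x
        \<otimes>\<^bsub>EForms A OA E (p + q)\<^esub> sigma_wedge B OB A OA E \<sigma> p q (circle_gen p) (0, torus_monom 0 0) y"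
      unfolding t sigma_wedge_eq[OF circle_gen_grade xy(1)] sigma_wedge_eq[OF circle_gen_grade xy(2)]
      by (simp add: emb_zero_tuple flip: torus_tensor_add)
    then show "t \<in> M_num B OB A OA E \<sigma> p q"
      using generate.eng[OF sw[OF xy(1), unfolded M_num_def] sw[OF xy(2), unfolded M_num_def]] by (simp add: M_num_def)
  qed
qed

lemma M_den_eq: "M_den B OB A OA E \<sigma> p q = tensor_image \<theta> (p + q) (den_pairs \<theta> p q)"
proof (cases q)
  case 0
  then show ?thesis
    by (simp add: M_den_def den_pairs_def tensor_image_def zero_prod_def[where 'a = torus_form and 'b = torus_form] torus_tensor_zero)
next
  case (Suc r)
  then show ?thesis using M_num_eq[of "p + 1" r] by (simp add: M_den_def den_pairs_def)
qed

section \<open>Calculus of classes in \<open>M p q\<close>\<close>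

lemma bimodule_pair_M:
  "bimodule_pair B A (EForms A OA E (p + q)) (M_num B OB A OA E \<sigma> p q) (M_den B OB A OA E \<sigma> p q)"
  unfolding M_num_eq M_den_eq
  by (rule bimodule_pair_tensor_image[OF sub_num_pairs sub_den_pairs den_pairs_subset])

lemma bimodule_M: "bimodule B A (M p q)"
  unfolding M_bimod_def by (rule bimodule_pair.bimodule_Q[OF bimodule_pair_M])

lemma carrier_M: "carrier (M p q) = {cls p q x y | x y. (x, y) \<in> num_pairs \<theta> p q}"
  unfolding M_bimod_def M_class_def bimodule_pair.carrier_Q[OF bimodule_pair_M]
  unfolding M_num_eq by (blast elim: tensor_imageE intro: tensor_imageI)

lemma M_num_I: "(x, y) \<in> num_pairs \<theta> p q \<Longrightarrow> torus_tensor \<theta> (p + q) x y \<in> M_num B OB A OA E \<sigma> p q"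
  by (simp add: M_num_eq tensor_imageI)

lemma cls_add:
  assumes "(x, y) \<in> num_pairs \<theta> p q" "(x', y') \<in> num_pairs \<theta> p q"
  shows "cls p q (x + x') (y + y') = cls p q x y \<otimes>\<^bsub>M p q\<^esub> cls p q x' y'"
  using bimodule_pair.mult_Q[OF bimodule_pair_M M_num_I[OF assms(1)] M_num_I[OF assms(2)]]
    sub_pairsD(1,2)[OF sub_num_pairs assms(1)] sub_pairsD(1,2)[OF sub_num_pairs assms(2)]
  by (simp add: M_bimod_def M_class_def torus_tensor_add)

lemma cls_zero: "cls p q 0 0 = \<one>\<^bsub>M p q\<^esub>"
  using bimodule_pair.one_Q[OF bimodule_pair_M[of p q]]
  by (simp add: M_bimod_def M_class_def torus_tensor_zero)

lemma lact_cls: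
  assumes "(x, y) \<in> num_pairs \<theta> p q"
  shows "lact (M p q) b (cls p q x y) = cls p q (W (i (eval_u b)) x) (W (i (eval_v b)) y)"
  using bimodule_pair.lact_Q[OF bimodule_pair_M _ M_num_I[OF assms], of b] sub_pairsD(1,2)[OF sub_num_pairs assms]
  by (simp add: M_bimod_def M_class_def lact_torus_tensor)

lemma ract_cls:
  assumes "(x, y) \<in> num_pairs \<theta> p q"
  shows "ract (M p q) (cls p q x y) a = cls p q (W x (i a)) (W y (i a))"
  using bimodule_pair.ract_Q[OF bimodule_pair_M _ M_num_I[OF assms], of a] sub_pairsD(1,2)[OF sub_num_pairs assms]
  by (simp add: M_bimod_def M_class_def ract_torus_tensor)

text \<open>Cosets agree when the difference lies in the denominator; as coordinates are unique by
  \<open>torus_tensor_inject\<close>, this becomes a condition on pairs of forms.\<close>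

lemma cls_eq_iff:
  assumes "(x, y) \<in> num_pairs \<theta> p q" "(x', y') \<in> num_pairs \<theta> p q"
  shows "cls p q x y = cls p q x' y' \<longleftrightarrow> (x - x', y - y') \<in> den_pairs \<theta> p q"
proof -
  note g = sub_pairsD(1,2)[OF sub_num_pairs assms(1)] sub_pairsD(1,2)[OF sub_num_pairs assms(2)]
  have d: "x - x' \<in> torus_grade (p + q)" "y - y' \<in> torus_grade (p + q)"
    using g torus_grade_add[OF g(1) torus_grade_uminus[OF g(3)]] torus_grade_add[OF g(2) torus_grade_uminus[OF g(4)]] by simp_all
  have c: "torus_tensor \<theta> (p + q) x y \<in> carrier (EForms A OA E (p + q))"
    "torus_tensor \<theta> (p + q) x' y' \<in> carrier (EForms A OA E (p + q))"
    using g by (simp_all add: torus_tensor_closed)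
  have "torus_tensor \<theta> (p + q) x y \<otimes>\<^bsub>EForms A OA E (p + q)\<^esub> inv\<^bsub>EForms A OA E (p + q)\<^esub> torus_tensor \<theta> (p + q) x' y'
      = torus_tensor \<theta> (p + q) (x - x') (y - y')"
    using g torus_tensor_add[OF g(1,2) torus_grade_uminus[OF g(3)] torus_grade_uminus[OF g(4)]] by (simp add: torus_tensor_uminus)
  then have "cls p q x y = cls p q x' y' \<longleftrightarrow> torus_tensor \<theta> (p + q) (x - x') (y - y') \<in> M_den B OB A OA E \<sigma> p q"
    unfolding M_class_def bimodule_pair.rcoset_eq_iff[OF bimodule_pair_M c] by simp
  also have "\<dots> \<longleftrightarrow> (x - x', y - y') \<in> den_pairs \<theta> p q"
    unfolding M_den_eq
    using d torus_tensor_inject[of "x - x'" "p + q" "y - y'"] sub_pairsD(1,2)[OF sub_den_pairs]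
    by (auto elim!: tensor_imageE intro: tensor_imageI)
  finally show ?thesis .
qed

text \<open>
  The choice of \<open>(x, y)\<close> is immaterial, since \<open>\<xi>\<close> maps the denominator of \<open>M\<^bsub>0,q\<^esub>\<close> to that of \<open>M\<^bsub>p,q\<^esub>\<close>.
\<close>

definition M_act :: "nat \<Rightarrow> nat \<Rightarrow> circle_form \<Rightarrow> ((torus \<times> torus) \<times> torus_form \<Rightarrow>\<^sub>0 int) set set \<Rightarrow>
    ((torus \<times> torus) \<times> torus_form \<Rightarrow>\<^sub>0 int) set set" where
  "M_act p q \<xi> m = (SOME c. \<exists>x\<in>torus_grade q. \<exists>y\<in>torus_grade q.
     m = cls0 q x y \<and> c = cls p q (W (dga_u \<xi>) x) (W (dga_v \<xi>) y))"

lemma M_act_cls: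
  assumes \<xi>: "\<xi> \<in> circle_grade p" and xy: "x \<in> torus_grade q" "y \<in> torus_grade q"
  shows "M_act p q \<xi> (cls0 q x y) = cls p q (W (dga_u \<xi>) x) (W (dga_v \<xi>) y)"
proof -
  have "cls p q (W (dga_u \<xi>) x') (W (dga_v \<xi>) y') = cls p q (W (dga_u \<xi>) x) (W (dga_v \<xi>) y)"
    if "x' \<in> torus_grade q" "y' \<in> torus_grade q" "cls0 q x y = cls0 q x' y'" for x' y'
  proof -
    have "(x' - x, y' - y) \<in> den_pairs \<theta> 0 q"
      using cls_eq_iff[of x' y' 0 q x y] xy that by (simp add: num_pairs_0)
    from wedge_den_pairs[OF \<xi> this]
    have "(W (dga_u \<xi>) x' - W (dga_u \<xi>) x, W (dga_v \<xi>) y' - W (dga_v \<xi>) y) \<in> den_pairs \<theta> p q"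
      using torus_wedge_add(2)[of \<theta> _ _ "- _"] by (simp add: diff_conv_add_uminus torus_wedge_add torus_wedge_uminus del: add_uminus_conv_diff)
    then show ?thesis
      using cls_eq_iff wedge_gen_in_num_pairs[OF \<xi>] xy that(1,2) by blast
  qed
  then show ?thesis
    unfolding M_act_def using xy by (intro some_equality) blast+
qed

lemma carrier_M_0: "carrier (M 0 q) = {cls0 q x y | x y. x \<in> torus_grade q \<and> y \<in> torus_grade q}"
  unfolding carrier_M num_pairs_0 add_0 by blast

section \<open>The map \<open>g\<close> on the tensor product\<close>

lemma tensor_context_M: "tensor_context B B A (Forms OB p) (M 0 q)"
  by (intro tensor_context.intro bimodule_circle_forms bimodule_M)

text \<open>Balancedness is multiplicativity of \<open>dga_u\<close> and \<open>dga_v\<close>: a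
  scalar \<open>b\<close> to the right of \<open>\<xi>\<close> becomes left multiplication of the
  coordinates by \<open>eval_u b\<close> and \<open>eval_v b\<close>, which is the action of
  \<open>b\<close> on \<open>M 0 q\<close>.\<close>

lemma M_act_balanced: "balanced B B A (Forms OB p) (M 0 q) (M p q) (M_act p q)"
proof (rule balanced.intro[OF tensor_context_M], rule balanced_axioms.intro)
  show "comm_group (M p q)" by (rule bimodule.comm_group_M[OF bimodule_M])
  fix \<xi> m assume "\<xi> \<in> carrier (Forms OB p)" and m: "m \<in> carrier (M 0 q)"
  then have \<xi>: "\<xi> \<in> circle_grade p" by simp
  obtain x y where xy: "x \<in> torus_grade q" "y \<in> torus_grade q" "m = cls0 q x y"
    using m unfolding carrier_M_0 by blast
  note N = wedge_gen_in_num_pairs[OF _ xy(1,2), of _ p \<theta>]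
  show "M_act p q \<xi> m \<in> carrier (M p q)"
    unfolding xy(3) M_act_cls[OF \<xi> xy(1,2)] carrier_M using N[OF \<xi>] by blast
  show "M_act p q (\<xi> \<otimes>\<^bsub>Forms OB p\<^esub> \<xi>') m = M_act p q \<xi> m \<otimes>\<^bsub>M p q\<^esub> M_act p q \<xi>' m"
    if "\<xi>' \<in> carrier (Forms OB p)" for \<xi>'
    using that \<xi> cls_add[OF N[OF \<xi>] N[of \<xi>']]
    by (simp add: xy M_act_cls circle_grade_add dga_add torus_wedge_add)
  show "M_act p q \<xi> (m \<otimes>\<^bsub>M 0 q\<^esub> m') = M_act p q \<xi> m \<otimes>\<^bsub>M p q\<^esub> M_act p q \<xi> m'"
    if m': "m' \<in> carrier (M 0 q)" for m'
  proof -
    obtain x' y' where xy': "x' \<in> torus_grade q" "y' \<in> torus_grade q" "m' = cls0 q x' y'"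
      using m' unfolding carrier_M_0 by blast
    have "m \<otimes>\<^bsub>M 0 q\<^esub> m' = cls0 q (x + x') (y + y')"
      using cls_add[of x y 0 q x' y'] xy xy' by (simp add: num_pairs_0)
    then show ?thesis
      using cls_add[OF N[OF \<xi>] wedge_gen_in_num_pairs[OF \<xi> xy'(1,2), of \<theta>]]
      by (simp add: xy xy' M_act_cls[OF \<xi>] torus_grade_add torus_wedge_add)
  qed
  show "M_act p q (ract (Forms OB p) \<xi> b) m = M_act p q \<xi> (lact (M 0 q) b m)" for b
  proof -
    have "lact (M 0 q) b m = cls0 q (W (i (eval_u b)) x) (W (i (eval_v b)) y)"
      using lact_cls[of x y 0 q b] xy by (simp add: num_pairs_0)
    moreover have "\<xi> \<otimes>\<^bsub>OB\<^esub> (b, 0) \<in> circle_grade p"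
      using circle_grade_mult[OF \<xi> circle_grade_emb, of b] by simp
    ultimately show ?thesis
      using xy by (simp add: M_act_cls[OF \<xi>] M_act_cls torus_grade_emb_wedge
        dga_mult[OF \<xi> circle_grade_emb, where \<theta> = \<theta>] dga_emb torus_wedge_assoc)
  qed
qed

text \<open>The forms of degree \<open>p\<close> on the circle are a cyclic module, so scalars can
  be pushed into the right factor, and tensoring with the fixed generator is a homomorphism in
  \<open>m\<close>. Injectivity thus concerns a single \<open>m\<close> instead of sums of
  tensors.\<close>

lemma M_tensor_generator:
  assumes "t \<in> carrier (tensor (Forms OB p) B (M 0 q))"
  shows "\<exists>m\<in>carrier (M 0 q). t = pure_tensor (Forms OB p) B (M 0 q) (circle_gen p) m"
proof -
  interpret TC: tensor_context B B A "Forms OB p" "M 0 q" by (rule tensor_context_M)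
  interpret TG: comm_group TC.TG by (rule TC.comm_group_TG)
  interpret N: comm_group "M 0 q" by (rule bimodule.comm_group_M[OF bimodule_M])
  let ?p = "pure_tensor (Forms OB p) B (M 0 q) (circle_gen p)"
  have gen: "circle_gen p \<in> carrier (Forms OB p)" by simp
  interpret gen: group_hom "M 0 q" TC.TG ?p
    using TC.pure_closed[OF gen] TC.pure_add_right[OF gen] by unfold_locales (auto simp: hom_def)
  show ?thesis
    using assms unfolding carrier_tensor
  proof (induction t rule: TC.tensor_induct)
    case (pure \<xi> m)
    then obtain b where "\<xi> = ract (Forms OB p) (circle_gen p) b"
      using circle_grade_gen[of \<xi> p] by auto
    then have "pure_tensor (Forms OB p) B (M 0 q) \<xi> m = ?p (lact (M 0 q) b m)"
      using TC.pure_balanced[OF gen _ pure(2), of b] by simp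
    then show ?case using bimodule.lact_closed[OF bimodule_M _ pure(2), of b] by auto
  next
    case (mult t t')
    then show ?case by (metis gen.hom_mult N.m_closed)
  next
    case (inv t)
    then show ?case by (metis gen.hom_inv N.inv_closed)
  next
    case one
    then show ?case by (metis gen.hom_one N.one_closed)
  qed
qed

lemma M_act_iso:
  "tensor_lift (M p q) (M_act p q) \<in> bimod_iso B A (tensor (Forms OB p) B (M 0 q)) (M p q)"
proof -
  interpret TC: balanced B B A "Forms OB p" "M 0 q" "M p q" "M_act p q" by (rule M_act_balanced)
  interpret TG: comm_group TC.TG by (rule TC.comm_group_TG)
  interpret N: comm_group "M 0 q" by (rule bimodule.comm_group_M[OF bimodule_M])
  interpret Mpq: bimodule B A "M p q" by (rule bimodule_M)
  let ?g = "tensor_lift (M p q) (M_act p q)"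
  let ?p = "pure_tensor (Forms OB p) B (M 0 q)"
  have gen: "circle_gen p \<in> carrier (Forms OB p)" by simp
  note gp = bimodule.comm_group_M[OF bimodule_M[of p q], THEN comm_group.axioms(2)]
  have "?g (lact (tensor (Forms OB p) B (M 0 q)) b t) = lact (M p q) b (?g t)"
    if t: "t \<in> carrier TC.TG" for b t
  proof (rule TC.tensor_hom_ext[OF gp _ _ _ t])
    show "(\<lambda>t. ?g (lact (tensor (Forms OB p) B (M 0 q)) b t)) \<in> hom TC.TG (M p q)"
      using hom_compose[OF TC.lact_hom TC.lift_hom, of b] by (simp add: o_def)
    have "lact (M p q) b \<in> hom (M p q) (M p q)"
      using Mpq.lact_closed[of b] Mpq.lact_add[of b] by (simp add: hom_def)
    from hom_compose[OF TC.lift_hom this]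
    show "(\<lambda>t. lact (M p q) b (?g t)) \<in> hom TC.TG (M p q)" by (simp add: o_def)
    fix \<xi> m assume \<xi>: "\<xi> \<in> carrier (Forms OB p)" and m: "m \<in> carrier (M 0 q)"
    then obtain x y where xy: "x \<in> torus_grade q" "y \<in> torus_grade q" "m = cls0 q x y"
      unfolding carrier_M_0 by blast
    have c: "\<xi> \<in> circle_grade p" "(b, 0) \<otimes>\<^bsub>OB\<^esub> \<xi> \<in> circle_grade p"
      using \<xi> circle_grade_mult[OF circle_grade_emb, of \<xi> p b] by simp_all
    have "M_act p q ((b, 0) \<otimes>\<^bsub>OB\<^esub> \<xi>) m = lact (M p q) b (M_act p q \<xi> m)"
      using c xy wedge_gen_in_num_pairs[OF c(1) xy(1,2)]
      by (simp add: M_act_cls lact_cls dga_mult[OF circle_grade_emb c(1), where \<theta> = \<theta>] dga_emb torus_wedge_assoc)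
    then show "?g (lact (tensor (Forms OB p) B (M 0 q)) b (?p \<xi> m)) = lact (M p q) b (?g (?p \<xi> m))"
      using \<xi> m c by (simp add: TC.lact_pure TC.lift_pure)
  qed
  moreover have "?g (ract (tensor (Forms OB p) B (M 0 q)) t a) = ract (M p q) (?g t) a"
    if t: "t \<in> carrier TC.TG" for a t
  proof (rule TC.tensor_hom_ext[OF gp _ _ _ t])
    show "(\<lambda>t. ?g (ract (tensor (Forms OB p) B (M 0 q)) t a)) \<in> hom TC.TG (M p q)"
      using hom_compose[OF TC.ract_hom TC.lift_hom, of a] by (simp add: o_def)
    have "(\<lambda>m. ract (M p q) m a) \<in> hom (M p q) (M p q)"
      using Mpq.ract_closed[of _ a] Mpq.ract_add[of _ _ a] by (simp add: hom_def)
    from hom_compose[OF TC.lift_hom this]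
    show "(\<lambda>t. ract (M p q) (?g t) a) \<in> hom TC.TG (M p q)" by (simp add: o_def)
    fix \<xi> m assume \<xi>: "\<xi> \<in> carrier (Forms OB p)" and m: "m \<in> carrier (M 0 q)"
    then obtain x y where xy: "x \<in> torus_grade q" "y \<in> torus_grade q" "m = cls0 q x y"
      unfolding carrier_M_0 by blast
    have c: "\<xi> \<in> circle_grade p" using \<xi> by simp
    have r: "ract (M 0 q) m a = cls0 q (W x (i a)) (W y (i a))"
      using ract_cls[of x y 0 q a] xy by (simp add: num_pairs_0)
    have "M_act p q \<xi> (ract (M 0 q) m a) = ract (M p q) (M_act p q \<xi> m) a"
      unfolding r using c xy wedge_gen_in_num_pairs[OF c(1) xy(1,2)]
      by (simp add: M_act_cls ract_cls torus_wedge_assoc torus_grade_emb_wedge)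
    then show "?g (ract (tensor (Forms OB p) B (M 0 q)) (?p \<xi> m) a) = ract (M p q) (?g (?p \<xi> m)) a"
      using \<xi> m bimodule.ract_closed[OF bimodule_M m, of a] by (simp add: TC.ract_pure TC.lift_pure)
  qed
  ultimately have "?g \<in> bimod_hom B A (tensor (Forms OB p) B (M 0 q)) (M p q)"
    using TC.lift_hom by (simp add: bimod_hom_def)
  moreover have "inj_on ?g (carrier TC.TG)"
    unfolding TC.lift.inj_iff_trivial_ker
  proof
    show "kernel TC.TG (M p q) ?g \<subseteq> {\<one>\<^bsub>TC.TG\<^esub>}"
    proof
      fix t assume "t \<in> kernel TC.TG (M p q) ?g"
      then have t: "t \<in> carrier TC.TG" "?g t = \<one>\<^bsub>M p q\<^esub>" by (simp_all add: kernel_def)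
      then obtain m where m: "m \<in> carrier (M 0 q)" "t = ?p (circle_gen p) m"
        using M_tensor_generator[of t p q] by auto
      have "t = \<one>\<^bsub>TC.TG\<^esub>"
      \<comment> \<open>Up to degree 1 exactness forces \<open>m\<close> to be zero; above, the left
        factor of the tensor is zero.\<close>
      proof (cases "p \<le> 1")
        case True
        obtain x y where xy: "x \<in> torus_grade q" "y \<in> torus_grade q" "m = cls0 q x y"
          using m(1) unfolding carrier_M_0 by blast
        have "cls p q (W (dga_u (circle_gen p)) x) (W (dga_v (circle_gen p)) y) = cls p q 0 0"
          using t(2) TC.lift_pure[OF gen m(1)] xy by (simp add: m(2) M_act_cls cls_zero)
        then have "(W (dga_u (circle_gen p)) x, W (dga_v (circle_gen p)) y) \<in> den_pairs \<theta> p q"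
          using cls_eq_iff[OF num_pairsI[OF xy(1,2)] sub_pairsD(3)[OF sub_num_pairs]] by simp
        then have "(x, y) \<in> den_pairs \<theta> 0 q"
          using den_pairs_exact True xy by blast
        then have "m = cls0 q 0 0"
          using cls_eq_iff[of x y 0 q 0 0] xy by (simp add: num_pairs_0)
        then have "m = \<one>\<^bsub>M 0 q\<^esub>" using cls_zero[of 0 q] by simp
        \<comment> \<open>By additivity a tensor with zero right factor equals its own double, so it
          is zero.\<close>
        then show ?thesis
          using TC.pure_add_right[OF gen m(1) m(1)] TC.pure_closed[OF gen m(1)] m(2) by simp
      next
        case False
        \<comment> \<open>Addition of forms is meant: zero equals its own double, and additivity in
          the left factor finishes as in the other case.\<close>
        then have "circle_gen p \<otimes>\<^bsub>Forms OB p\<^esub> circle_gen p = circle_gen p" by (simp add: circle_gen_def)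
        then show ?thesis
          using TC.pure_add_left[OF gen gen m(1)] TC.pure_closed[OF gen m(1)] m(2) by simp
      qed
      then show "t \<in> {\<one>\<^bsub>TC.TG\<^esub>}" by simp
    qed
  qed (simp add: kernel_def)
  moreover have "?g ` carrier TC.TG = carrier (M p q)"
  proof
    show "?g ` carrier TC.TG \<subseteq> carrier (M p q)" using TC.lift.hom_closed by blast
    show "carrier (M p q) \<subseteq> ?g ` carrier TC.TG"
    proof
      fix c assume "c \<in> carrier (M p q)"
      then obtain x y where xy: "x \<in> torus_grade q" "y \<in> torus_grade q"
        "c = cls p q (W (dga_u (circle_gen p)) x) (W (dga_v (circle_gen p)) y)"
        unfolding carrier_M num_pairs_def by blast
      then have m: "cls0 q x y \<in> carrier (M 0 q)" unfolding carrier_M_0 by blast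
      then have "?g (?p (circle_gen p) (cls0 q x y)) = c"
        using TC.lift_pure[OF gen m] xy by (simp add: M_act_cls)
      then show "c \<in> ?g ` carrier TC.TG" using TC.pure_closed[OF gen m] by blast
    qed
  qed
  ultimately show ?thesis by (simp add: bimod_iso_def bij_betw_def)
qed

text \<open>Both sides are the class with coordinates \<open>\<xi> f \<eta>\<close> and
  \<open>\<xi> h \<eta>\<close>, where \<open>\<xi>\<close> acts through \<open>dga_u\<close> and
  \<open>dga_v\<close>; this identifies the lift with the prescribed formula for
  \<open>g\<close>.\<close>

lemma M_act_pure:
  assumes \<xi>: "\<xi> \<in> circle_grade p" and \<eta>: "\<eta> \<in> torus_grade q"
  shows "tensor_lift (M p q) (M_act p q) (pure_tensor (Forms OB p) B (M 0 q) \<xi>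
      (M_class B OB A OA E \<sigma> 0 q (pure_tensor E A (Forms OA q) e \<eta>))) =
    M_class B OB A OA E \<sigma> p q (sigma_wedge B OB A OA E \<sigma> p q \<xi> e \<eta>)"
proof -
  interpret TC: balanced B B A "Forms OB p" "M 0 q" "M p q" "M_act p q" by (rule M_act_balanced)
  obtain f h where e: "e = (f, h)" by (cases e)
  have g: "W (i f) \<eta> \<in> torus_grade q" "W (i h) \<eta> \<in> torus_grade q"
    using \<eta> by (simp_all add: torus_grade_emb_wedge)
  then have "cls0 q (W (i f) \<eta>) (W (i h) \<eta>) \<in> carrier (M 0 q)"
    unfolding carrier_M_0 by blast
  then show ?thesis
    using \<xi> M_act_cls[OF \<xi> g] by (simp add: e TC.lift_pure sigma_wedge_eq[OF \<xi> \<eta>] pure_eq_torus_tensor[OF \<eta>])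
qed

end

theorem proposition7p3:
  fixes \<theta> :: real and p q :: nat
    and nabla :: "torus \<times> torus \<Rightarrow> ((torus \<times> torus) \<times> torus_form \<Rightarrow>\<^sub>0 int) set"
    and \<sigma> :: "(circle_form \<times> (torus \<times> torus) \<Rightarrow>\<^sub>0 int) set \<Rightarrow>
              ((torus \<times> torus) \<times> torus_form \<Rightarrow>\<^sub>0 int) set"
  defines "A \<equiv> nc_torus \<theta>" and "OA \<equiv> torus_calculus \<theta>"
    and "B \<equiv> circle_algebra" and "OB \<equiv> circle_calculus" and "E \<equiv> torus_E \<theta>"
  assumes "right_bimodule_connection B OB A OA E nabla \<sigma>"
    and "zero_curvature A OA E nabla"
    and "extendable B OB A OA E \<sigma>"
    and "\<And>f. nabla (f, 0) = pure_tensor E A (Forms OA 1) (\<one>\<^bsub>A\<^esub>, 0) (dif OA (emb OA f))"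
    and "\<And>h. nabla (0, h) = pure_tensor E A (Forms OA 1) (0, \<one>\<^bsub>A\<^esub>) (dif OA (emb OA h))"
    and "\<And>f. \<sigma> (pure_tensor (Forms OB 1) B E circle_dt (f, 0)) =
           pure_tensor E A (Forms OA 1) (\<one>\<^bsub>A\<^esub>, 0) (torus_du \<otimes>\<^bsub>OA\<^esub> emb OA f)"
    and "\<And>h. \<sigma> (pure_tensor (Forms OB 1) B E circle_dt (0, h)) =
           pure_tensor E A (Forms OA 1) (0, \<one>\<^bsub>A\<^esub>) (torus_dv \<otimes>\<^bsub>OA\<^esub> emb OA h)"
  shows "\<exists>g \<in> bimod_iso B A (tensor (Forms OB p) B (M_bimod B OB A OA E \<sigma> 0 q))
                             (M_bimod B OB A OA E \<sigma> p q).
           \<forall>\<xi>\<in>grade OB p. \<forall>e\<in>carrier E. \<forall>\<eta>\<in>grade OA q.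
             g (pure_tensor (Forms OB p) B (M_bimod B OB A OA E \<sigma> 0 q) \<xi>
                  (M_class B OB A OA E \<sigma> 0 q (pure_tensor E A (Forms OA q) e \<eta>))) =
             M_class B OB A OA E \<sigma> p q (sigma_wedge B OB A OA E \<sigma> p q \<xi> e \<eta>)"
  proof -
  \<comment> \<open>The given \<open>\<sigma>\<close> has the same values as the concrete model on
    the generating tensors, so all results on the model apply to it. The five \<open>defines\<close>
    clauses come first in \<open>assms\<close>.\<close>
  have \<sigma>: "\<sigma> t = torus_sigma \<theta> 1 t" if "t \<in> carrier (FormsE circle_algebra circle_calculus (torus_E \<theta>) 1)" for t
    using assms(6,9-12) unfolding A_def OA_def B_def OB_def E_def
    by (intro bimod_hom_eq_torus_sigma[OF _ _ _ that]) (simp_all add: right_bimodule_connection_def torus_connection_formulas del: One_nat_def)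
  show ?thesis
    unfolding A_def OA_def B_def OB_def E_def
    by (rule bexI[OF _ M_act_iso[OF \<sigma>]]) (intro ballI M_act_pure[OF \<sigma>]; simp)
qed

end
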